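(* Fix $\alpha>0$ and $\Delta>0$, and let $N=N(p)$ satisfy $N/p\to\alpha$ as $p\to\infty$. Let $\mathbf{y}=\mathbf{x}\boldsymbol{\beta}+\sqrt{\Delta}\,\boldsymbol{\epsilon}$, where $\mathbf{x}\in\mathbb{R}^{N\times p}$ has i.i.d. $\mathcal{N}(0,\tfrac1N)$ entries, $\boldsymbol{\epsilon}\sim\mathcal{N}(0,I_N)$, $\boldsymbol{\beta}$ is uniform on $\{b\in\mathbb{R}^p:\|b\|=\sqrt p\}$, and $\mathbf{x},\boldsymbol{\beta},\boldsymbol{\epsilon}$ are independent. For $r\ge 0$ define $$R_{p,r}:=\max\Big\{\tfrac1p\|a-\hat a_{\mathrm{ridge}}\|^2 :\ \|a\|\le\sqrt p,\ f_{\mathrm{TAP}}(a)\ge\sup_{\|a'\|\le\sqrt p}f_{\mathrm{TAP}}(a')-r\Big\},$$ where $\hat a_{\mathrm{ridge}}:=\operatorname{argmin}_{a\in\mathbb{R}^p}\{\frac1\Delta\|\mathbf{y}-\mathbf{x}a\|^2+\|a\|^2\}$. Then for every $r\ge0$, $\lim_{p\to\infty}R_{p,r}\le 2r$ in probability, i.e. for every $\varepsilon>0$, $\lim_{p\to\infty}\mathbb{P}[R_{p,r}>2r+\varepsilon]=0$.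
   Context: $\|\cdot\|$ is the Euclidean norm. For $a\in\mathbb{R}^p$ with $\|a\|\le\sqrt p$, write $q=\|a\|^2/p$; the TAP free energy functional is $$f_{\mathrm{TAP}}(a)=-\frac{1}{2\Delta p}\|\mathbf{y}-\mathbf{x}a\|^2-\frac{\alpha}{2}\ln\Big(1+\frac{1-q}{\Delta\alpha}\Big)+\frac12\ln(1-q),$$ with the convention $\ln 0=-\infty$. *)

theory Defs
  imports "HOL-Probability.Probability"
begin

text \<open>
  The dimension varies with the asymptotic parameter, so a vector of dimension \<open>p\<close> is an
  extensional function on \<open>{..<p}\<close>, i.e. an element of \<open>{..<p} \<rightarrow>\<^sub>E UNIV\<close>, and an
  \<open>n \<times> p\<close> matrix an extensional function on \<open>{..<n} \<times> {..<p}\<close>. The Euclidean norm is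
  \<open>L2_set a {..<p}\<close>. These spaces are the carriers of the product \<open>\<sigma>\<close>-algebras below.
\<close>

abbreviation borel_PiM :: "'i set \<Rightarrow> ('i \<Rightarrow> real) measure" where
  "borel_PiM I \<equiv> (\<Pi>\<^sub>M i\<in>I. (borel :: real measure))"

abbreviation vecs :: "nat \<Rightarrow> (nat \<Rightarrow> real) set" where
  "vecs p \<equiv> {..<p} \<rightarrow>\<^sub>E (UNIV :: real set)"

definition vec_ball :: "nat \<Rightarrow> real \<Rightarrow> (nat \<Rightarrow> real) set" where
  "vec_ball p \<rho> = {a \<in> vecs p. L2_set a {..<p} \<le> \<rho>}"

definition mat_vec :: "nat \<Rightarrow> nat \<Rightarrow> (nat \<times> nat \<Rightarrow> real) \<Rightarrow> (nat \<Rightarrow> real) \<Rightarrow> nat \<Rightarrow> real" where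
  "mat_vec n p x a = (\<lambda>i\<in>{..<n}. \<Sum>j<p. x (i, j) * a j)"

definition resid_sq ::
    "nat \<Rightarrow> nat \<Rightarrow> (nat \<times> nat \<Rightarrow> real) \<Rightarrow> (nat \<Rightarrow> real) \<Rightarrow> (nat \<Rightarrow> real) \<Rightarrow> real" where
  "resid_sq n p x y a = (L2_set (\<lambda>i. y i - mat_vec n p x a i) {..<n})\<^sup>2"

text \<open>The logarithm on the nonnegative reals, with the convention \<open>ln 0 = -\<infinity>\<close>.\<close>

definition eln :: "real \<Rightarrow> ereal" where
  "eln t = (if 0 < t then ereal (ln t) else -\<infinity>)"

definition f_TAP ::
    "real \<Rightarrow> real \<Rightarrow> nat \<Rightarrow> nat \<Rightarrow> (nat \<times> nat \<Rightarrow> real) \<Rightarrow> (nat \<Rightarrow> real) \<Rightarrow> (nat \<Rightarrow> real) \<Rightarrow> ereal"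
where
  "f_TAP \<alpha> \<Delta> n p x y a =
    (let q = (L2_set a {..<p})\<^sup>2 / real p in
      ereal (- (1 / (2 * \<Delta> * real p)) * resid_sq n p x y a
             - \<alpha> / 2 * ln (1 + (1 - q) / (\<Delta> * \<alpha>)))
      + ereal (1 / 2) * eln (1 - q))"

definition a_ridge ::
    "real \<Rightarrow> nat \<Rightarrow> nat \<Rightarrow> (nat \<times> nat \<Rightarrow> real) \<Rightarrow> (nat \<Rightarrow> real) \<Rightarrow> nat \<Rightarrow> real" where
  "a_ridge \<Delta> n p x y =
    arg_min_on (\<lambda>a. 1 / \<Delta> * resid_sq n p x y a + (L2_set a {..<p})\<^sup>2) (vecs p)"

text \<open>
  The near-maximizers form a nonempty compact set, so the maximum below is attained.
\<close>

definition R_TAP ::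
    "real \<Rightarrow> real \<Rightarrow> nat \<Rightarrow> nat \<Rightarrow> (nat \<times> nat \<Rightarrow> real) \<Rightarrow> (nat \<Rightarrow> real) \<Rightarrow> real \<Rightarrow> real" where
  "R_TAP \<alpha> \<Delta> n p x y r =
    (GREATEST d. \<exists>a \<in> vec_ball p (sqrt (real p)).
       d = 1 / real p * (L2_set (\<lambda>j. a j - a_ridge \<Delta> n p x y j) {..<p})\<^sup>2 \<and>
       f_TAP \<alpha> \<Delta> n p x y a
         \<ge> (SUP a' \<in> vec_ball p (sqrt (real p)). f_TAP \<alpha> \<Delta> n p x y a') - ereal r)"

text \<open>
  The uniform distribution on the sphere of radius \<open>\<rho>\<close>, i.e. normalized surface measure: the
  part of the sphere over a set \<open>A\<close> of directions has mass proportional to the Lebesgue measure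
  of the cone spanned by \<open>A\<close> inside the unit ball. As a distribution, it is the
  law of \<open>\<rho> u / \<parallel>u\<parallel>\<close> for \<open>u\<close> uniform on the unit ball (where \<open>u \<noteq> 0\<close> almost surely
  unless \<open>p = 0\<close>).
\<close>

definition sphere_uniform :: "nat \<Rightarrow> real \<Rightarrow> (nat \<Rightarrow> real) measure" where
  "sphere_uniform p \<rho> =
    distr (uniform_measure (\<Pi>\<^sub>M j\<in>{..<p}. lborel) (vec_ball p 1)) (borel_PiM {..<p})
      (\<lambda>u. \<lambda>j\<in>{..<p}. \<rho> * u j / L2_set u {..<p})"

lemma vec_ball_measurable: "vec_ball p \<rho> \<in> sets (\<Pi>\<^sub>M j\<in>{..<p}. (lborel::real measure))"
proof -
  have "vec_ball p \<rho> = {a \<in> space (\<Pi>\<^sub>M j\<in>{..<p}. (lborel::real measure)). sqrt (\<Sum>j<p. (a j)\<^sup>2) \<le> \<rho>}"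
    by (simp add: vec_ball_def space_PiM L2_set_def)
  also have "\<dots> \<in> sets (\<Pi>\<^sub>M j\<in>{..<p}. (lborel::real measure))"
    by measurable
  finally show ?thesis .
qed

lemma prob_space_sphere_uniform: "prob_space (sphere_uniform p \<rho>)"
proof -
  interpret product_sigma_finite "\<lambda>_::nat. lborel :: real measure"
    by (simp add: product_sigma_finite_def sigma_finite_lborel)
  let ?P = "\<Pi>\<^sub>M j\<in>{..<p}. (lborel::real measure)"
  have box: "emeasure ?P (\<Pi>\<^sub>E j\<in>{..<p}. {-c..c}) = ennreal (2*c)^p" if "c \<ge> 0" for c
    using that by (subst emeasure_PiM) (auto simp: field_simps)
  have boxm: "(\<Pi>\<^sub>E j\<in>{..<p}. {-c..c}) \<in> sets ?P" for c::real
    by (rule sets_PiM_I_finite) simp_all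
  have up: "vec_ball p 1 \<subseteq> (\<Pi>\<^sub>E j\<in>{..<p}. {-1..1})"
  proof
    fix a assume a: "a \<in> vec_ball p 1"
    have "\<bar>a j\<bar> \<le> 1" if "j < p" for j
    proof -
      have "\<bar>a j\<bar> \<le> L2_set (\<lambda>j. \<bar>a j\<bar>) {..<p}"
        using that by (intro member_le_L2_set) simp_all
      also have "\<dots> = L2_set a {..<p}" by (simp add: L2_set_def)
      also have "\<dots> \<le> 1" using a by (simp add: vec_ball_def)
      finally show ?thesis .
    qed
    then show "a \<in> (\<Pi>\<^sub>E j\<in>{..<p}. {-1..1})"
      using a by (simp add: vec_ball_def PiE_iff abs_le_iff minus_le_iff)
  qed
  define c where "c = 1 / real (Suc p)"
  have lo: "(\<Pi>\<^sub>E j\<in>{..<p}. {-c..c}) \<subseteq> vec_ball p 1"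
  proof
    fix a assume a: "a \<in> (\<Pi>\<^sub>E j\<in>{..<p}. {-c..c})"
    have "L2_set a {..<p} \<le> (\<Sum>j<p. \<bar>a j\<bar>)" by (rule L2_set_le_sum_abs)
    also have "\<dots> \<le> (\<Sum>j<p. c)"
      using a by (intro sum_mono) (simp add: PiE_iff abs_le_iff minus_le_iff)
    also have "\<dots> \<le> 1" by (simp add: c_def)
    finally show "a \<in> vec_ball p 1" using a by (auto simp: vec_ball_def PiE_iff)
  qed
  have fin: "emeasure ?P (vec_ball p 1) \<noteq> \<infinity>"
    using emeasure_mono[OF up boxm] box[of 1]
    by (auto simp: top_unique ennreal_power power_eq_top_ennreal)
  have "0 < ennreal (2*c)^p" by (simp add: c_def ennreal_power)
  also have "\<dots> \<le> emeasure ?P (vec_ball p 1)"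
    using emeasure_mono[OF lo vec_ball_measurable] box[of c] by (simp add: c_def)
  finally have pos: "emeasure ?P (vec_ball p 1) \<noteq> 0" by simp
  interpret U: prob_space "uniform_measure ?P (vec_ball p 1)"
    by (rule prob_space_uniform_measure[OF pos fin])
  show ?thesis unfolding sphere_uniform_def
    by (rule U.prob_space_distr) (simp add: L2_set_def)
qed

text \<open>
  The observation model. Independence of \<open>x\<close>, \<open>\<beta>\<close>, \<open>\<epsilon>\<close>, which take values in
  different types, is independence of the \<open>\<sigma>\<close>-algebras that they generate.
\<close>

locale gaussian_linear_model = prob_space M
  for M :: "'w measure" and n p :: nat and \<Delta> :: real
    and x :: "'w \<Rightarrow> nat \<times> nat \<Rightarrow> real"
    and \<beta> \<epsilon> y :: "'w \<Rightarrow> nat \<Rightarrow> real" +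
  assumes x_rv: "random_variable (borel_PiM ({..<n} \<times> {..<p})) x"
    and x_entry: "\<And>i j. i < n \<Longrightarrow> j < p \<Longrightarrow>
      distributed M lborel (\<lambda>\<omega>. x \<omega> (i, j)) (normal_density 0 (sqrt (1 / real n)))"
    and x_indep: "indep_vars (\<lambda>_. borel) (\<lambda>k \<omega>. x \<omega> k) ({..<n} \<times> {..<p})"
    and eps_rv: "random_variable (borel_PiM {..<n}) \<epsilon>"
    and eps_entry: "\<And>i. i < n \<Longrightarrow> distributed M lborel (\<lambda>\<omega>. \<epsilon> \<omega> i) (normal_density 0 1)"
    and eps_indep: "indep_vars (\<lambda>_. borel) (\<lambda>i \<omega>. \<epsilon> \<omega> i) {..<n}"
    and beta_rv: "random_variable (borel_PiM {..<p}) \<beta>"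
    and beta_law: "distr M (borel_PiM {..<p}) \<beta> = sphere_uniform p (sqrt (real p))"
    and indep: "indep_sets (\<lambda>k.
      [sets (vimage_algebra (space M) x (borel_PiM ({..<n} \<times> {..<p}))),
       sets (vimage_algebra (space M) \<beta> (borel_PiM {..<p})),
       sets (vimage_algebra (space M) \<epsilon> (borel_PiM {..<n}))] ! k) {0, 1, 2}"
    and y_eq: "\<And>\<omega>. \<omega> \<in> space M \<Longrightarrow>
      y \<omega> = (\<lambda>i\<in>{..<n}. mat_vec n p (x \<omega>) (\<beta> \<omega>) i + sqrt \<Delta> * \<epsilon> \<omega> i)"

end

theory Submission
  imports Defs
begin

text \<open>
  Completing the square in the ridge objective \<open>F(a) = \<parallel>y - x a\<parallel>\<^sup>2 / \<Delta> + \<parallel>a\<parallel>\<^sup>2\<close> gives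
  \<open>f\<^sub>T\<^sub>A\<^sub>P(a) = - F(a) / (2 p) + h(q)\<close> with \<open>F(a) \<ge> F(r) + \<parallel>a - r\<parallel>\<^sup>2\<close>, where \<open>r\<close> is the ridge
  estimator and \<open>h\<close> is a scalar function that is maximal at a single point \<open>q\<^sub>*\<close>. So the claim follows once
  \<open>\<parallel>r\<parallel>\<^sup>2 / p\<close> converges to \<open>q\<^sub>*\<close> in probability. Let \<open>R = (x\<^sup>T x + \<Delta>)\<^sup>-\<^sup>1\<close>. Given \<open>x\<close>, \<open>\<parallel>r\<parallel>\<^sup>2\<close> is a
  quadratic form in \<open>(\<beta>, \<epsilon>)\<close> with mean \<open>p - \<Delta> tr R\<close> and variance \<open>O(p)\<close>. Removing one row of \<open>x\<close> at a
  time shows that \<open>\<tau> = tr R / N\<close> nearly solves the Marchenko--Pastur equation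
  \<open>\<Delta> \<tau> + \<tau> / (1 + \<tau>) = p / N\<close>, whose left-hand side has slope at least \<open>\<Delta>\<close>; this determines the limit
  of \<open>\<parallel>r\<parallel>\<^sup>2 / p\<close>, which is the stationary point of \<open>h\<close>.
\<close>

section \<open>Regularized Gram matrices and their inverses\<close>

text \<open>The coordinates of \<beta> are dependent, so the stacked vector (\<beta>, \<epsilon>) is
  not a product. The probabilistic part therefore uses only the few moment bounds of
  \<open>isotropic_moments\<close>, shared by a standard Gaussian vector and the uniform vector on
  the sphere of radius sqrt p. One variance bound for quadratic forms with an independent random
  matrix then serves twice: for the norm of the ridge estimator and for the forms created by
  deleting a row. No spectral theory enters: every bound on R comes from <v, R v> >= \<Delta> |R
  v|^2, with constants depending only on \<Delta>. The factor 2 in 2r comes from F(a) >= F(r) + |a -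
  r|^2, since F enters the functional with weight 1/(2p). The Marchenko--Pastur equation meets the
  stationarity of h through s = 1 - q = \<Delta> \<alpha> \<sigma>, where \<sigma> is the limit of
  \<tau>: then s + s \<alpha> / (\<Delta> \<alpha> + s) = \<alpha> (\<Delta> \<sigma> + \<sigma> /
  (1 + \<sigma>)). Errors are carried as pathwise bounds by integrable variables of vanishing
  expectation, so that a single Markov inequality concludes.\<close>

definition dot :: "nat \<Rightarrow> (nat \<Rightarrow> real) \<Rightarrow> (nat \<Rightarrow> real) \<Rightarrow> real" where
  "dot p u v = (\<Sum>j<p. u j * v j)"

definition app :: "nat \<Rightarrow> (nat \<Rightarrow> nat \<Rightarrow> real) \<Rightarrow> (nat \<Rightarrow> real) \<Rightarrow> nat \<Rightarrow> real" where
  "app p R v = (\<lambda>j. dot p (R j) v)"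

abbreviation mrow :: "(nat \<times> nat \<Rightarrow> real) \<Rightarrow> nat \<Rightarrow> nat \<Rightarrow> real" where
  "mrow x i \<equiv> \<lambda>j. x (i, j)"

definition tr :: "nat \<Rightarrow> (nat \<Rightarrow> nat \<Rightarrow> real) \<Rightarrow> real" where
  "tr p R = (\<Sum>j<p. R j j)"

text \<open>Characterizes the inverse of \<Delta> + x^T x when only the rows in \<open>S\<close> are
  kept, which is what row deletion requires. Symmetry is demanded for all indices, also those beyond
  \<open>p\<close>, so that \<open>R k\<close> serves as row and as column without range
  conditions.\<close>

definition ridge_inverse ::
    "real \<Rightarrow> nat \<Rightarrow> (nat \<times> nat \<Rightarrow> real) \<Rightarrow> nat set \<Rightarrow> (nat \<Rightarrow> nat \<Rightarrow> real) \<Rightarrow> bool" where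
  "ridge_inverse \<Delta> p x S R \<longleftrightarrow> (\<forall>j k. R j k = R k j) \<and>
    (\<forall>j<p. \<forall>k<p. \<Delta> * R j k + (\<Sum>i\<in>S. x (i, j) * dot p (mrow x i) (R k)) = of_bool (j = k))"

text \<open>The Sherman--Morrison recursion, starting from 1/\<Delta> and adding one row per step;
  the head of the list is the row added last. The entries are explicit in the listed rows, so
  measurability and dependence on those rows alone follow by induction.\<close>

fun resolvent :: "real \<Rightarrow> nat \<Rightarrow> (nat \<times> nat \<Rightarrow> real) \<Rightarrow> nat list \<Rightarrow> nat \<Rightarrow> nat \<Rightarrow> real" where
  "resolvent \<Delta> p x [] = (\<lambda>j k. of_bool (j = k) / \<Delta>)"
| "resolvent \<Delta> p x (i # is) = (\<lambda>j k. resolvent \<Delta> p x is j k -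
     app p (resolvent \<Delta> p x is) (mrow x i) j * app p (resolvent \<Delta> p x is) (mrow x i) k /
       (1 + dot p (mrow x i) (app p (resolvent \<Delta> p x is) (mrow x i))))"

lemma dot_commute: "dot p u v = dot p v u"
  by (simp add: dot_def mult.commute)

lemma dot_self_nonneg [simp]: "0 \<le> dot p u u"
  by (simp add: dot_def sum_nonneg)

lemma dot_add_right: "dot p u (\<lambda>j. v j + w j) = dot p u v + dot p u w"
  by (simp add: dot_def sum.distrib distrib_left)

lemma dot_diff_right: "dot p u (\<lambda>j. v j - w j) = dot p u v - dot p u w"
  by (simp add: dot_def sum_subtractf right_diff_distrib)

lemma dot_scale_right: "dot p u (\<lambda>j. c * v j) = c * dot p u v"
  by (simp add: dot_def sum_distrib_left mult_ac)

lemma dot_sum_right: "dot p u (\<lambda>j. \<Sum>i\<in>S. f i j) = (\<Sum>i\<in>S. dot p u (f i))"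
  unfolding dot_def by (subst sum.swap) (simp add: sum_distrib_left)

lemma dot_combination:
  "dot p u (\<lambda>k. c * a k + (\<Sum>i\<in>S. d i * f i k)) = c * dot p u a + (\<Sum>i\<in>S. d i * dot p u (f i))"
  by (simp only: dot_add_right dot_sum_right dot_scale_right)

lemma dot_delta: "k < p \<Longrightarrow> dot p u (\<lambda>j. of_bool (j = k)) = u k"
proof -
  assume "k < p"
  have "dot p u (\<lambda>j. of_bool (j = k)) = (\<Sum>j<p. if j = k then u j else 0)"
    unfolding dot_def by (intro sum.cong) auto
  then show ?thesis using \<open>k < p\<close> by simp
qed

lemma dot_cong: "(\<And>j. j < p \<Longrightarrow> u j = u' j) \<Longrightarrow> (\<And>j. j < p \<Longrightarrow> v j = v' j) \<Longrightarrow> dot p u v = dot p u' v'"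
  unfolding dot_def by (intro sum.cong) auto

lemma dot_self_L2: "dot p u u = (L2_set u {..<p})\<^sup>2"
  by (simp add: dot_def L2_set_def sum_nonneg power2_eq_square)

lemma square_le_dot_self: "k < p \<Longrightarrow> (u k)\<^sup>2 \<le> dot p u u"
  unfolding dot_def power2_eq_square by (rule member_le_sum) auto

lemma dot_app_sym:
  assumes "\<And>j k. R j k = R k j"
  shows "dot p u (app p R v) = dot p (app p R u) v"
proof -
  have "dot p u (app p R v) = (\<Sum>j<p. \<Sum>k<p. u j * (R j k * v k))"
    by (simp add: dot_def app_def sum_distrib_left)
  also have "\<dots> = (\<Sum>k<p. \<Sum>j<p. u j * (R j k * v k))"
    by (rule sum.swap)
  also have "\<dots> = dot p (app p R u) v"
    unfolding dot_def app_def sum_distrib_right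
    using assms by (intro sum.cong refl) (metis mult.assoc mult.commute)
  finally show ?thesis .
qed

lemma ridge_inverse_sym: "ridge_inverse \<Delta> p x S R \<Longrightarrow> R j k = R k j"
  unfolding ridge_inverse_def by blast

lemma ridge_inverse_eq:
  assumes "ridge_inverse \<Delta> p x S R" "j < p" "k < p"
  shows "\<Delta> * R j k + (\<Sum>i\<in>S. x (i, j) * app p R (mrow x i) k) = of_bool (j = k)"
  using assms unfolding ridge_inverse_def app_def by (simp add: dot_commute)

lemma ridge_inverse_app:
  assumes R: "ridge_inverse \<Delta> p x S R" and j: "j < p"
  shows "\<Delta> * app p R v j + (\<Sum>i\<in>S. x (i, j) * dot p (mrow x i) (app p R v)) = v j"
proof -
  have "dot p (mrow x i) (app p R v) = dot p v (app p R (mrow x i))" for i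
    using dot_app_sym[of R p "mrow x i" v] ridge_inverse_sym[OF R] by (simp add: dot_commute)
  then have "\<Delta> * app p R v j + (\<Sum>i\<in>S. x (i, j) * dot p (mrow x i) (app p R v))
      = dot p v (\<lambda>k. \<Delta> * R j k + (\<Sum>i\<in>S. x (i, j) * app p R (mrow x i) k))"
    by (simp only: dot_combination) (simp only: app_def dot_commute)
  also have "\<dots> = dot p v (\<lambda>k. of_bool (k = j))"
    using ridge_inverse_eq[OF R j] by (intro dot_cong) auto
  also have "\<dots> = v j" by (rule dot_delta[OF j])
  finally show ?thesis .
qed

text \<open>Testing the equation (\<Delta> + x^T x) w = v against w = R v itself. This is the source
  of both positivity and boundedness of R.\<close>

lemma ridge_inverse_quad:
  assumes R: "ridge_inverse \<Delta> p x S R"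
  shows "dot p v (app p R v) = \<Delta> * dot p (app p R v) (app p R v) + (\<Sum>i\<in>S. (dot p (mrow x i) (app p R v))\<^sup>2)"
proof -
  let ?w = "app p R v"
  have "dot p ?w v = dot p ?w (\<lambda>j. \<Delta> * ?w j + (\<Sum>i\<in>S. dot p (mrow x i) ?w * x (i, j)))"
    using ridge_inverse_app[OF R, of _ v] by (intro dot_cong) (auto simp: mult.commute)
  also have "\<dots> = \<Delta> * dot p ?w ?w + (\<Sum>i\<in>S. (dot p (mrow x i) ?w)\<^sup>2)"
    by (simp only: dot_combination) (simp add: power2_eq_square dot_commute[of p ?w "mrow x i" for i])
  finally show ?thesis by (simp only: dot_commute)
qed

lemma ridge_inverse_quad_ge:
  assumes "ridge_inverse \<Delta> p x S R"
  shows "\<Delta> * dot p (app p R v) (app p R v) \<le> dot p v (app p R v)"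
  unfolding ridge_inverse_quad[OF assms] by (simp add: sum_nonneg)

lemma app_delta: "k < p \<Longrightarrow> app p R (\<lambda>j. of_bool (j = k)) j = R j k"
  by (simp add: app_def dot_delta)

lemma ridge_inverse_column:
  assumes R: "ridge_inverse \<Delta> p x S R" and "k < p"
  shows "\<Delta> * dot p (R k) (R k) \<le> R k k"
proof -
  let ?d = "\<lambda>j. of_bool (j = k)"
  have "app p R ?d = R k" 
    using ridge_inverse_sym[OF R] by (auto simp: app_delta[OF \<open>k < p\<close>])
  then show ?thesis
    using ridge_inverse_quad_ge[OF R, of ?d] dot_delta[OF \<open>k < p\<close>, of "R k"]
    by (simp add: dot_commute)
qed

text \<open>Entrywise form of 0 <= R <= 1/\<Delta>: the diagonal entry is one coordinate of its
  column, so \<Delta> (R_kk)^2 <= \<Delta> |R_k|^2 <= R_kk, and a factor R_kk cancels.\<close>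

lemma ridge_inverse_column_bounds:
  assumes R: "ridge_inverse \<Delta> p x S R" and k: "k < p" and \<Delta>: "\<Delta> > 0"
  shows "0 \<le> R k k" "R k k \<le> 1 / \<Delta>" "dot p (R k) (R k) \<le> 1 / \<Delta>\<^sup>2"
proof -
  note c = ridge_inverse_column[OF R k]
  show nn: "0 \<le> R k k" using c \<Delta> by (smt (verit) dot_self_nonneg mult_nonneg_nonneg)
  have "\<Delta> * (R k k)\<^sup>2 \<le> \<Delta> * dot p (R k) (R k)"
    using square_le_dot_self[OF k] \<Delta> by simp
  with c have "(\<Delta> * R k k) * R k k \<le> 1 * R k k" by (simp add: power2_eq_square)
  then have "R k k = 0 \<or> \<Delta> * R k k \<le> 1" using nn by (metis less_eq_real_def mult_le_cancel_right not_less)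
  then show le: "R k k \<le> 1 / \<Delta>" using \<Delta> by (auto simp: field_simps)
  have "dot p (R k) (R k) \<le> R k k / \<Delta>" using c \<Delta> by (simp add: field_simps)
  also have "\<dots> \<le> (1 / \<Delta>) / \<Delta>" using le \<Delta> by (intro divide_right_mono) auto
  finally show "dot p (R k) (R k) \<le> 1 / \<Delta>\<^sup>2" by (simp add: power2_eq_square)
qed

text \<open>Associativity of R' (\<Delta> + x^T x) R: the unit vectors are expanded once through the
  equation of \<open>R\<close> and once through that of \<open>R'\<close>.\<close>

lemma ridge_inverse_unique:
  assumes R: "ridge_inverse \<Delta> p x S R" and R': "ridge_inverse \<Delta> p x S R'" and j: "j < p" and k: "k < p"
  shows "R j k = R' j k"
proof -
  have "R' j k = dot p (R' j) (\<lambda>l. of_bool (l = k))" by (simp add: dot_delta[OF k])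
  also have "\<dots> = dot p (R' j) (\<lambda>l. \<Delta> * R k l + (\<Sum>i\<in>S. app p R (mrow x i) k * x (i, l)))"
    using ridge_inverse_eq[OF R _ k] ridge_inverse_sym[OF R]
    by (intro dot_cong) (auto simp: mult.commute)
  also have "\<dots> = \<Delta> * dot p (R' j) (R k) + (\<Sum>i\<in>S. app p R (mrow x i) k * app p R' (mrow x i) j)"
    by (simp only: dot_combination) (simp only: app_def)
  also have "\<dots> = dot p (R k) (\<lambda>l. \<Delta> * R' j l + (\<Sum>i\<in>S. app p R' (mrow x i) j * x (i, l)))"
    by (simp only: dot_combination)
      (simp add: app_def dot_commute[of p "R' j" "R k"] mult.commute)
  also have "\<dots> = dot p (R k) (\<lambda>l. of_bool (l = j))"
    using ridge_inverse_eq[OF R' _ j] ridge_inverse_sym[OF R']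
    by (intro dot_cong) (auto simp: mult.commute)
  also have "\<dots> = R k j" by (simp add: dot_delta[OF j])
  finally show ?thesis using ridge_inverse_sym[OF R] by simp
qed

text \<open>Sherman--Morrison formula for adding the rank-one term of row \<open>i\<close>. The
  denominator cannot vanish because the quadratic form of R is nonnegative.\<close>

lemma ridge_inverse_update:
  assumes R: "ridge_inverse \<Delta> p x S R" and S: "finite S" "i \<notin> S" and \<Delta>: "\<Delta> > 0"
  defines "v \<equiv> app p R (mrow x i)"
  shows "ridge_inverse \<Delta> p x (insert i S) (\<lambda>j k. R j k - v j * v k / (1 + dot p (mrow x i) v))"
proof -
  let ?t = "dot p (mrow x i) v"
  have "0 \<le> ?t"
    using ridge_inverse_quad_ge[OF R, of "mrow x i"] \<Delta> unfolding v_def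
    by (smt (verit) dot_self_nonneg mult_nonneg_nonneg)
  then have t: "1 + ?t \<noteq> 0" by simp
  have d: "dot p u (\<lambda>l. R k l - v k * v l / (1 + ?t)) = app p R u k - v k / (1 + ?t) * dot p u v" for u k
    using dot_scale_right[of p u "v k / (1 + ?t)" v]
    by (simp add: dot_diff_right app_def dot_commute[of p u "R k"])
  have "\<Delta> * (R j k - v j * v k / (1 + ?t)) +
      (\<Sum>h\<in>insert i S. x (h, j) * dot p (mrow x h) (\<lambda>l. R k l - v k * v l / (1 + ?t))) = of_bool (j = k)"
    if j: "j < p" and k: "k < p" for j k
  proof -
    have A: "\<Delta> * v j + (\<Sum>h\<in>S. x (h, j) * dot p (mrow x h) v) = x (i, j)"
      using ridge_inverse_app[OF R j, of "mrow x i"] by (simp add: v_def)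
    have B: "\<Delta> * R j k + (\<Sum>h\<in>S. x (h, j) * app p R (mrow x h) k) = of_bool (j = k)"
      by (rule ridge_inverse_eq[OF R j k])
    have "\<Delta> * (R j k - v j * v k / (1 + ?t)) +
      (\<Sum>h\<in>insert i S. x (h, j) * dot p (mrow x h) (\<lambda>l. R k l - v k * v l / (1 + ?t)))
     = (\<Delta> * R j k + (\<Sum>h\<in>S. x (h, j) * app p R (mrow x h) k))
       - v k / (1 + ?t) * (\<Delta> * v j + (\<Sum>h\<in>S. x (h, j) * dot p (mrow x h) v))
       + x (i, j) * (v k - v k / (1 + ?t) * ?t)"
      unfolding d using S
      by (simp add: algebra_simps sum_subtractf sum_distrib_left sum.distrib v_def[symmetric])
    also have "\<dots> = of_bool (j = k) + x (i, j) * (v k - v k / (1 + ?t) * ?t - v k / (1 + ?t))"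
      unfolding A B by (simp add: algebra_simps)
    \<comment> \<open>The new row enters with coefficient v_k (1 - t/(1+t) - 1/(1+t)), where t is
      \<open>?t\<close>.\<close>
    also have "v k - v k / (1 + ?t) * ?t - v k / (1 + ?t) = 0"
      using t by (simp add: divide_simps) (simp add: algebra_simps)
    finally show ?thesis by simp
  qed
  then show ?thesis
    using ridge_inverse_sym[OF R] unfolding ridge_inverse_def by (auto simp: mult.commute)
qed

lemma ridge_inverse_resolvent:
  assumes "\<Delta> > 0" "distinct is"
  shows "ridge_inverse \<Delta> p x (set is) (resolvent \<Delta> p x is)"
  using assms(2)
proof (induction "is")
  case Nil
  then show ?case using assms(1) by (auto simp: ridge_inverse_def)
next
  case (Cons i "is")
  then show ?case
    using ridge_inverse_update[of \<Delta> p x "set is" "resolvent \<Delta> p x is" i] assms(1) by simp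
qed

text \<open>The recursion depends on the order of the list only in form; uniqueness of the inverse
  removes that dependence. Hence any row may be regarded as the one added last.\<close>

lemma resolvent_cong_set:
  assumes "\<Delta> > 0" "distinct is" "distinct is'" "set is = set is'" "j < p" "k < p"
  shows "resolvent \<Delta> p x is j k = resolvent \<Delta> p x is' j k"
  using ridge_inverse_unique[OF ridge_inverse_resolvent[OF assms(1,2), of p x] _ assms(5,6)]
    ridge_inverse_resolvent[OF assms(1,3), of p x] assms(4) by simp

text \<open>The trace of \<open>R (\<Delta> + x\<^sup>T x) = 1\<close>.\<close>

lemma ridge_inverse_trace:
  assumes R: "ridge_inverse \<Delta> p x S R"
  shows "\<Delta> * tr p R + (\<Sum>i\<in>S. dot p (mrow x i) (app p R (mrow x i))) = real p"
proof -
  have "(\<Sum>i\<in>S. dot p (mrow x i) (app p R (mrow x i))) = (\<Sum>j<p. \<Sum>i\<in>S. x (i, j) * app p R (mrow x i) j)"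
    unfolding dot_def by (rule sum.swap)
  then have "\<Delta> * tr p R + (\<Sum>i\<in>S. dot p (mrow x i) (app p R (mrow x i)))
    = (\<Sum>j<p. \<Delta> * R j j + (\<Sum>i\<in>S. x (i, j) * app p R (mrow x i) j))"
    by (simp add: tr_def sum_distrib_left sum.distrib)
  also have "\<dots> = real p" using ridge_inverse_eq[OF R] by simp
  finally show ?thesis .
qed

lemma tr_ridge_inverse_nonneg:
  assumes "ridge_inverse \<Delta> p x S R" "\<Delta> > 0"
  shows "0 \<le> tr p R"
  unfolding tr_def using ridge_inverse_column_bounds(1)[OF assms(1) _ assms(2)] by (intro sum_nonneg) auto

text \<open>The rank-one correction merely rescales R x_i by 1/(1 + t), which turns t into t/(1 +
  t). The trace drops by |R x_i|^2 / (1 + t), and \<Delta> |R x_i|^2 <= t bounds this independently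
  of the dimension, so it vanishes after division by the number of rows.\<close>

lemma leave_one_out:
  fixes \<Delta> p x i "is"
  assumes \<Delta>: "\<Delta> > 0" and d: "distinct (i # is)"
  defines "R \<equiv> resolvent \<Delta> p x is" and "R' \<equiv> resolvent \<Delta> p x (i # is)"
  defines "t \<equiv> dot p (mrow x i) (app p R (mrow x i))"
  shows "0 \<le> t" "dot p (mrow x i) (app p R' (mrow x i)) = t / (1 + t)"
    "\<bar>tr p R - tr p R'\<bar> \<le> 1 / \<Delta>"
proof -
  let ?v = "app p R (mrow x i)"
  have R: "ridge_inverse \<Delta> p x (set is) R" unfolding R_def using \<Delta> d by (intro ridge_inverse_resolvent) auto
  have R'_eq: "R' j k = R j k - ?v j * ?v k / (1 + t)" for j k by (simp add: R'_def R_def t_def)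
  have q: "\<Delta> * dot p ?v ?v \<le> t" unfolding t_def by (rule ridge_inverse_quad_ge[OF R])
  then show t: "0 \<le> t" using \<Delta> by (smt (verit) dot_self_nonneg mult_nonneg_nonneg)
  have "app p R' (mrow x i) k = ?v k - ?v k / (1 + t) * t" for k
  proof -
    have "app p R' (mrow x i) k = dot p (mrow x i) (\<lambda>l. R k l - (?v k / (1 + t)) * ?v l)"
      unfolding app_def[of p R'] by (subst dot_commute, intro dot_cong) (auto simp: R'_eq)
    also have "\<dots> = ?v k - ?v k / (1 + t) * t"
      by (simp only: dot_diff_right dot_scale_right t_def) (simp only: app_def dot_commute)
    finally show ?thesis .
  qed
  also have "?v k - ?v k / (1 + t) * t = 1 / (1 + t) * ?v k" for k
    using t by (simp add: field_simps)
  finally have "app p R' (mrow x i) = (\<lambda>k. 1 / (1 + t) * ?v k)" by blast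
  then show "dot p (mrow x i) (app p R' (mrow x i)) = t / (1 + t)"
    by (simp only: dot_scale_right t_def[symmetric]) simp
  have "tr p R - tr p R' = dot p ?v ?v / (1 + t)"
    by (simp add: tr_def R'_eq sum_subtractf dot_def sum_divide_distrib)
  moreover have "0 \<le> dot p ?v ?v / (1 + t)" using t by simp
  moreover have "dot p ?v ?v / (1 + t) \<le> 1 / \<Delta>"
    using q t \<Delta> by (simp add: field_simps)
  ultimately show "\<bar>tr p R - tr p R'\<bar> \<le> 1 / \<Delta>" by linarith
qed

text \<open>
  The ridge estimator is \<open>R x\<^sup>T y = (1 - \<Delta> R) \<beta> + \<surd>\<Delta> R x\<^sup>T \<epsilon>\<close>; this is the matrix
  acting on the stacked vector \<open>(\<beta>, \<epsilon>)\<close>.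
\<close>

definition ridge_map ::
    "real \<Rightarrow> nat \<Rightarrow> (nat \<times> nat \<Rightarrow> real) \<Rightarrow> (nat \<Rightarrow> nat \<Rightarrow> real) \<Rightarrow> nat \<Rightarrow> nat + nat \<Rightarrow> real" where
  "ridge_map \<Delta> p x R j = case_sum (\<lambda>b. of_bool (j = b) - \<Delta> * R j b) (\<lambda>i. sqrt \<Delta> * app p R (mrow x i) j)"

text \<open>The two blocks contribute (1 - \<Delta> R)^2 and \<Delta> R x^T x R. Since R x^T x = 1 -
  \<Delta> R, the second equals \<Delta> (1 - \<Delta> R) R and cancels the quadratic defect of the
  first.\<close>

lemma ridge_map_gram:
  assumes R: "ridge_inverse \<Delta> p x S R" and fS: "finite S" and jk: "j < p" "k < p" and \<Delta>: "\<Delta> > 0"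
  shows "(\<Sum>a\<in>{..<p} <+> S. ridge_map \<Delta> p x R j a * ridge_map \<Delta> p x R k a) = of_bool (j = k) - \<Delta> * R j k"
proof -
  let ?B = "\<lambda>j b. of_bool (j = b) - \<Delta> * R j b"
  have B: "?B j b = (\<Sum>i\<in>S. app p R (mrow x i) j * x (i, b))" if "b < p" "j < p" for b j
    using ridge_inverse_eq[OF R that] ridge_inverse_sym[OF R, of j b] by (simp add: mult.commute eq_commute)
  have "(\<Sum>b<p. ?B j b * R b k) = (\<Sum>b<p. \<Sum>i\<in>S. app p R (mrow x i) j * (x (i, b) * R b k))"
    using B jk by (intro sum.cong) (simp_all add: sum_distrib_right mult.assoc)
  also have "\<dots> = (\<Sum>i\<in>S. app p R (mrow x i) j * (\<Sum>b<p. x (i, b) * R b k))"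
    by (subst sum.swap) (simp add: sum_distrib_left)
  also have "\<dots> = (\<Sum>i\<in>S. app p R (mrow x i) j * app p R (mrow x i) k)"
    using ridge_inverse_sym[OF R] by (simp add: app_def dot_def mult.commute)
  finally have 1: "(\<Sum>b<p. ?B j b * R b k) = (\<Sum>i\<in>S. app p R (mrow x i) j * app p R (mrow x i) k)" .
  have "(\<Sum>b<p. ?B j b * ?B k b) = (\<Sum>b<p. ?B j b * of_bool (b = k) - \<Delta> * (?B j b * R b k))"
    using ridge_inverse_sym[OF R] by (intro sum.cong) (auto simp: algebra_simps)
  also have "\<dots> = ?B j k - \<Delta> * (\<Sum>b<p. ?B j b * R b k)"
    using dot_delta[OF jk(2), of "?B j"] by (simp only: sum_subtractf dot_def sum_distrib_left)
  finally have 2: "(\<Sum>b<p. ?B j b * ?B k b) = ?B j k - \<Delta> * (\<Sum>b<p. ?B j b * R b k)" .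
  have "(\<Sum>a\<in>{..<p} <+> S. ridge_map \<Delta> p x R j a * ridge_map \<Delta> p x R k a)
    = (\<Sum>b<p. ?B j b * ?B k b) + (\<Sum>i\<in>S. \<Delta> * (app p R (mrow x i) j * app p R (mrow x i) k))"
    using \<Delta> fS by (subst sum.Plus) (auto simp: ridge_map_def mult_ac intro!: sum.cong arg_cong2[where f="(+)"])
  then show ?thesis unfolding 1 2 by (simp add: sum_distrib_left)
qed

text \<open>The squared norm of a column of 1 - \<Delta> R is 1 - 2 \<Delta> R_kk + \<Delta>^2
  |R_k|^2, and \<Delta> |R_k|^2 <= R_kk absorbs the last term. Summed over columns this gives the
  O(p) variance.\<close>

lemma ridge_map_frobenius:
  fixes R :: "nat \<Rightarrow> nat \<Rightarrow> real"
  assumes R: "ridge_inverse \<Delta> p x S R" and k: "k < p" and \<Delta>: "\<Delta> > 0"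
  shows "(\<Sum>j<p. (of_bool (j = k) - \<Delta> * R j k)\<^sup>2) \<le> 1"
proof -
  have "(\<Sum>j<p. (of_bool (j = k) - \<Delta> * R j k)\<^sup>2)
      = (\<Sum>j<p. (1 - 2 * \<Delta> * R k j) * of_bool (j = k) + \<Delta>\<^sup>2 * (R k j * R k j))"
    using ridge_inverse_sym[OF R]
    by (intro sum.cong) (auto simp: power2_eq_square algebra_simps)
  also have "\<dots> = 1 - 2 * \<Delta> * R k k + \<Delta>\<^sup>2 * dot p (R k) (R k)"
    using dot_delta[OF k, of "\<lambda>j. 1 - 2 * \<Delta> * R k j"] by (simp add: sum.distrib dot_def sum_distrib_left)
  also have "\<dots> \<le> 1 - \<Delta> * R k k"
    using mult_left_mono[OF ridge_inverse_column[OF R k], of \<Delta>] \<Delta> by (simp add: power2_eq_square algebra_simps)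
  also have "\<dots> \<le> 1" using ridge_inverse_column_bounds(1)[OF R k \<Delta>] \<Delta> by simp
  finally show ?thesis .
qed

section \<open>The TAP functional and the ridge estimator\<close>

text \<open>The function \<open>h\<close> of the overview. Its summand q/2 repays the |a|^2/(2p)
  that the ridge objective subtracts.\<close>

definition tap_potential :: "real \<Rightarrow> real \<Rightarrow> real \<Rightarrow> real" where
  "tap_potential \<alpha> \<Delta> q = q / 2 - \<alpha> / 2 * ln (1 + (1 - q) / (\<Delta> * \<alpha>)) + ln (1 - q) / 2"

lemma has_field_derivative_tap_potential:
  assumes "\<alpha> > 0" "\<Delta> > 0" "q < 1"
  shows "(tap_potential \<alpha> \<Delta> has_field_derivative
    (1 + \<alpha> / (\<Delta> * \<alpha> + (1 - q)) - 1 / (1 - q)) / 2) (at q)"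
proof -
  have "0 < \<Delta> * \<alpha>" "0 < 1 - q" "0 < \<Delta> * \<alpha> + (1 - q)" using assms by (auto intro: add_pos_pos)
  then have "0 < 1 + (1 - q) / (\<Delta> * \<alpha>)" by (simp add: add_pos_pos)
  have "(1 / (\<Delta> * \<alpha>)) / (1 + (1 - q) / (\<Delta> * \<alpha>)) = 1 / (\<Delta> * \<alpha> + (1 - q))"
    using \<open>0 < \<Delta> * \<alpha>\<close> \<open>0 < \<Delta> * \<alpha> + (1 - q)\<close> \<open>0 < 1 + (1 - q) / (\<Delta> * \<alpha>)\<close> assms
    by (simp add: divide_simps)
  moreover have "(1 + a * k - w) / 2 = 1 / 2 - a / 2 * (- k) + (- w) / 2" for a k w :: real
    by (simp add: field_simps)
  ultimately have e: "(1 + \<alpha> / (\<Delta> * \<alpha> + (1 - q)) - 1 / (1 - q)) / 2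
      = 1 / 2 - \<alpha> / 2 * (- ((1 / (\<Delta> * \<alpha>)) / (1 + (1 - q) / (\<Delta> * \<alpha>)))) + (- (1 / (1 - q))) / 2"
    by (metis mult.right_neutral times_divide_eq_right)
  have 1: "((\<lambda>q. 1 + (1 - q) / (\<Delta> * \<alpha>)) has_field_derivative - (1 / (\<Delta> * \<alpha>))) (at q)"
    using assms by (auto intro!: derivative_eq_intros)
  have 2: "((\<lambda>q. 1 - q) has_field_derivative - 1) (at q)"
    by (auto intro!: derivative_eq_intros)
  have "((\<lambda>q. ln (1 + (1 - q) / (\<Delta> * \<alpha>))) has_field_derivative
      - ((1 / (\<Delta> * \<alpha>)) / (1 + (1 - q) / (\<Delta> * \<alpha>)))) (at q)"
    using DERIV_chain2[OF DERIV_ln_divide[OF \<open>0 < 1 + (1 - q) / (\<Delta> * \<alpha>)\<close>] 1] by (simp add: mult.commute)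
  moreover have "((\<lambda>q. ln (1 - q)) has_field_derivative - (1 / (1 - q))) (at q)"
    using DERIV_chain2[OF DERIV_ln_divide[OF \<open>0 < 1 - q\<close>] 2] by simp
  ultimately show ?thesis unfolding e tap_potential_def
    by (intro DERIV_add DERIV_diff DERIV_cmult DERIV_cdivide DERIV_ident)
qed

lemma isCont_tap_potential: "\<alpha> > 0 \<Longrightarrow> \<Delta> > 0 \<Longrightarrow> q < 1 \<Longrightarrow> isCont (tap_potential \<alpha> \<Delta>) q"
  using has_field_derivative_tap_potential by (blast intro: DERIV_isCont)

text \<open>The sign of the derivative at \<open>1 - t\<close> is that of \<open>t + t \<alpha> / (\<Delta> \<alpha> + t) - 1\<close>, increasing in \<open>t\<close>.\<close>

lemma tap_potential_le:
  assumes pos: "\<alpha> > 0" "\<Delta> > 0" and s: "0 < s" "s + s * \<alpha> / (\<Delta> * \<alpha> + s) = 1" and q: "q < 1"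
  shows "tap_potential \<alpha> \<Delta> q \<le> tap_potential \<alpha> \<Delta> (1 - s)"
proof -
  define d where "d t = (1 + \<alpha> / (\<Delta> * \<alpha> + t) - 1 / t) / 2" for t
  define m where "m t = t + t * \<alpha> / (\<Delta> * \<alpha> + t)" for t
  have d: "(tap_potential \<alpha> \<Delta> has_field_derivative d (1 - u)) (at u)" if "u < 1" for u
    using has_field_derivative_tap_potential[OF pos that] by (simp add: d_def)
  have dm: "2 * t * d t = m t - 1" if "0 < t" for t
  proof -
    have "2 * t * d t = t * (1 + \<alpha> / (\<Delta> * \<alpha> + t) - 1 / t)" by (simp add: d_def)
    then show ?thesis using that by (simp add: m_def right_diff_distrib distrib_left)
  qed
  have mono: "m t \<le> m u" if "0 < t" "t \<le> u" for t u
  proof -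
    have "0 < \<Delta> * \<alpha>" using pos by simp
    then have "0 < \<Delta> * \<alpha> + t" "0 < \<Delta> * \<alpha> + u" "\<Delta> * \<alpha> * t \<le> \<Delta> * \<alpha> * u"
      using that mult_left_mono[of t u "\<Delta> * \<alpha>"] by linarith+
    then have "t / (\<Delta> * \<alpha> + t) \<le> u / (\<Delta> * \<alpha> + u)"
      by (simp add: pos_divide_le_eq pos_le_divide_eq algebra_simps)
    from mult_left_mono[OF this, of \<alpha>] show ?thesis using pos that by (simp add: m_def mult.commute)
  qed
  have ms: "m s = 1" using s by (simp add: m_def)
  have nonneg: "0 \<le> d t" if "s \<le> t" for t
  proof -
    have "0 < t" using that s by simp
    then have "0 \<le> 2 * t * d t" using mono[OF s(1) that] ms dm[OF \<open>0 < t\<close>] by linarith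
    then show ?thesis using \<open>0 < t\<close> by (simp add: zero_le_mult_iff)
  qed
  have nonpos: "d t \<le> 0" if "0 < t" "t \<le> s" for t
  proof -
    have "2 * t * d t \<le> 0" using mono[OF that] ms dm[OF that(1)] by linarith
    then show ?thesis using \<open>0 < t\<close> by (simp add: mult_le_0_iff)
  qed
  show ?thesis
  proof (cases "q \<le> 1 - s")
    case True
    then show ?thesis
    proof (rule DERIV_nonneg_imp_nondecreasing)
      fix u assume "q \<le> u" "u \<le> 1 - s"
      then have "s \<le> 1 - u" "u < 1" using s by linarith+
      then show "\<exists>y. (tap_potential \<alpha> \<Delta> has_real_derivative y) (at u) \<and> 0 \<le> y"
        using d[of u] nonneg[of "1 - u"] by blast
    qed
  next
    case False
    then have "1 - s \<le> q" by simp
    then show ?thesis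
    proof (rule DERIV_nonpos_imp_nonincreasing)
      fix u assume "1 - s \<le> u" "u \<le> q"
      then have "1 - u \<le> s" "0 < 1 - u" "u < 1" using q by linarith+
      then show "\<exists>y. (tap_potential \<alpha> \<Delta> has_real_derivative y) (at u) \<and> y \<le> 0"
        using d[of u] nonpos[of "1 - u"] by blast
    qed
  qed
qed

section \<open>The ridge objective and its unique minimizer\<close>

definition ridge_obj :: "real \<Rightarrow> nat \<Rightarrow> nat \<Rightarrow> (nat \<times> nat \<Rightarrow> real) \<Rightarrow> (nat \<Rightarrow> real) \<Rightarrow> (nat \<Rightarrow> real) \<Rightarrow> real" where
  "ridge_obj \<Delta> n p x y a = 1 / \<Delta> * resid_sq n p x y a + (L2_set a {..<p})\<^sup>2"

text \<open>The closed form R x^T y, made extensional so that it lies in \<open>vecs p\<close> and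
  can be equal to \<open>a_ridge\<close> as a function.\<close>

definition ridge :: "real \<Rightarrow> nat \<Rightarrow> nat \<Rightarrow> (nat \<times> nat \<Rightarrow> real) \<Rightarrow> (nat \<Rightarrow> real) \<Rightarrow> nat \<Rightarrow> real" where
  "ridge \<Delta> n p x y = (\<lambda>j\<in>{..<p}. app p (resolvent \<Delta> p x [0..<n]) (\<lambda>j. \<Sum>i<n. y i * x (i, j)) j)"

lemma resid_sq_eq: "resid_sq n p x y a = (\<Sum>i<n. (y i - dot p (mrow x i) a)\<^sup>2)"
  by (simp add: resid_sq_def L2_set_def sum_nonneg mat_vec_def dot_def)

text \<open>The stationarity condition of the objective, obtained from (\<Delta> + x^T x) R v = v at
  v = x^T y.\<close>

lemma ridge_normal_equation:
  assumes "\<Delta> > 0" "j < p"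
  shows "\<Delta> * ridge \<Delta> n p x y j = (\<Sum>i<n. x (i, j) * (y i - dot p (mrow x i) (ridge \<Delta> n p x y)))"
proof -
  let ?R = "resolvent \<Delta> p x [0..<n]" and ?v = "\<lambda>j. \<Sum>i<n. y i * x (i, j)"
  have R: "ridge_inverse \<Delta> p x {..<n} ?R"
    using ridge_inverse_resolvent[OF assms(1), of "[0..<n]" p x] by (simp add: atLeast0LessThan)
  have d: "dot p u (ridge \<Delta> n p x y) = dot p u (app p ?R ?v)" for u
    by (intro dot_cong) (auto simp: ridge_def)
  have r: "ridge \<Delta> n p x y j = app p ?R ?v j" using assms(2) by (simp add: ridge_def)
  show ?thesis
    using ridge_inverse_app[OF R assms(2), of ?v]
    unfolding d r by (simp add: algebra_simps sum_subtractf)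
qed

text \<open>The quadratic expansion around the ridge estimator is exact. The normal equation cancels
  the linear terms, and only the nonnegative |x d|^2 / \<Delta> is dropped, for d the difference of
  the two vectors.\<close>

lemma ridge_obj_ge:
  assumes "\<Delta> > 0"
  shows "ridge_obj \<Delta> n p x y (ridge \<Delta> n p x y) + (L2_set (\<lambda>j. a j - ridge \<Delta> n p x y j) {..<p})\<^sup>2
    \<le> ridge_obj \<Delta> n p x y a"
proof -
  let ?r = "ridge \<Delta> n p x y"
  define d where "d = (\<lambda>j. a j - ?r j)"
  have a: "dot p u a = dot p u ?r + dot p u d" for u by (simp add: d_def dot_diff_right)
  have "(\<Sum>i<n. (y i - dot p (mrow x i) ?r) * dot p (mrow x i) d)
      = (\<Sum>j<p. (\<Sum>i<n. x (i, j) * (y i - dot p (mrow x i) ?r)) * d j)"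
    unfolding dot_def[of p _ d] sum_distrib_left sum_distrib_right
    by (subst sum.swap) (simp add: mult_ac)
  also have "\<dots> = (\<Sum>j<p. \<Delta> * (?r j * d j))"
    using ridge_normal_equation[OF assms] by (intro sum.cong) (simp_all flip: ridge_normal_equation[OF assms])
  also have "\<dots> = \<Delta> * dot p ?r d" by (simp add: dot_def sum_distrib_left)
  finally have cross: "(\<Sum>i<n. (y i - dot p (mrow x i) ?r) * dot p (mrow x i) d) = \<Delta> * dot p ?r d" .
  have "resid_sq n p x y a = (\<Sum>i<n. (y i - dot p (mrow x i) ?r)\<^sup>2
      - 2 * ((y i - dot p (mrow x i) ?r) * dot p (mrow x i) d) + (dot p (mrow x i) d)\<^sup>2)"
    unfolding resid_sq_eq a by (intro sum.cong) (auto simp: power2_eq_square algebra_simps)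
  also have "\<dots> = resid_sq n p x y ?r - 2 * (\<Delta> * dot p ?r d) + (\<Sum>i<n. (dot p (mrow x i) d)\<^sup>2)"
    unfolding resid_sq_eq cross[symmetric] by (simp add: sum.distrib sum_subtractf sum_distrib_left)
  finally have "1 / \<Delta> * resid_sq n p x y a
      = 1 / \<Delta> * resid_sq n p x y ?r - 2 * dot p ?r d + 1 / \<Delta> * (\<Sum>i<n. (dot p (mrow x i) d)\<^sup>2)"
    using assms by (simp add: field_simps)
  moreover have "dot p a a = dot p ?r ?r + 2 * dot p ?r d + dot p d d"
  proof -
    have "dot p a a = dot p a ?r + dot p a d" by (rule a)
    also have "dot p a ?r = dot p ?r ?r + dot p ?r d" by (subst dot_commute) (rule a)
    also have "dot p a d = dot p d ?r + dot p d d" by (subst dot_commute) (rule a)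
    also have "dot p d ?r = dot p ?r d" by (rule dot_commute)
    finally show ?thesis by simp
  qed
  moreover have "0 \<le> 1 / \<Delta> * (\<Sum>i<n. (dot p (mrow x i) d)\<^sup>2)" using assms by (simp add: sum_nonneg)
  ultimately show ?thesis by (simp add: ridge_obj_def dot_self_L2[symmetric] d_def)
qed

text \<open>\<open>arg_min_on\<close> selects some minimizer, so uniqueness is needed: a minimizer
  agrees with the closed form on the first \<open>p\<close> coordinates by the quadratic gap, and
  everywhere by extensionality.\<close>

lemma a_ridge_eq:
  assumes "\<Delta> > 0"
  shows "a_ridge \<Delta> n p x y = ridge \<Delta> n p x y"
proof -
  let ?r = "ridge \<Delta> n p x y" and ?F = "ridge_obj \<Delta> n p x y"
  have rv: "?r \<in> vecs p" by (auto simp: ridge_def)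
  have min: "?F ?r \<le> ?F a" for a
    using ridge_obj_ge[OF assms, of n p x y a] by (smt (verit) zero_le_power2)
  have uniq: "a = ?r" if a: "a \<in> vecs p" and le: "?F a \<le> ?F ?r" for a
  proof -
    have "(L2_set (\<lambda>j. a j - ?r j) {..<p})\<^sup>2 \<le> 0" using ridge_obj_ge[OF assms, of n p x y a] le by linarith
    then have "L2_set (\<lambda>j. a j - ?r j) {..<p} = 0" by simp
    then have "a j = ?r j" if "j < p" for j using that by (simp add: L2_set_eq_0_iff)
    then show ?thesis using a rv by (intro PiE_ext[of a _ "\<lambda>_. UNIV"]) auto
  qed
  have "is_arg_min ?F (\<lambda>a. a \<in> vecs p) (a_ridge \<Delta> n p x y)"
    unfolding a_ridge_def ridge_obj_def[symmetric] arg_min_on_def arg_min_def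
    by (rule someI[of _ ?r]) (use rv min in \<open>auto simp: is_arg_min_def not_less\<close>)
  then show ?thesis by (intro uniq) (auto simp: is_arg_min_linorder rv)
qed

section \<open>Compactness of the ball and attainment of the maximum in \<open>R_TAP\<close>\<close>

lemma continuous_on_L2_set [continuous_intros]:
  fixes f :: "'a :: topological_space \<Rightarrow> 'i \<Rightarrow> real"
  assumes "\<And>i. i \<in> I \<Longrightarrow> continuous_on S (\<lambda>a. f a i)"
  shows "continuous_on S (\<lambda>a. L2_set (f a) I)"
  unfolding L2_set_def using assms by (intro continuous_intros)

text \<open>In the product topology on all functions, the extensional vectors in a cube form a
  product of compact sets, with the single point \<open>undefined\<close> as factor beyond
  \<open>p\<close>. Tychonoff makes this compact, and the ball is a closed part of it.\<close>

lemma compact_vec_ball: "compact (vec_ball p \<rho>)"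
proof -
  define S where "S i = (if i < p then {-\<rho>..\<rho>} else {undefined})" for i
  have "compactin (product_topology (\<lambda>_. euclidean) UNIV) (PiE UNIV S)"
    unfolding compactin_PiE by (simp add: S_def)
  then have "compact (PiE UNIV S)" by (simp only: euclidean_product_topology compactin_euclidean_iff)
  moreover have "closed {a :: nat \<Rightarrow> real. L2_set a {..<p} \<le> \<rho>}"
    by (intro closed_Collect_le continuous_intros continuous_on_product_coordinates)
  ultimately have "compact (PiE UNIV S \<inter> {a. L2_set a {..<p} \<le> \<rho>})" by (rule compact_Int_closed)
  also have "PiE UNIV S \<inter> {a. L2_set a {..<p} \<le> \<rho>} = vec_ball p \<rho>"
  proof (intro equalityI subsetI)
    fix a assume "a \<in> PiE UNIV S \<inter> {a. L2_set a {..<p} \<le> \<rho>}"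
    then show "a \<in> vec_ball p \<rho>"
      by (auto simp: vec_ball_def S_def PiE_iff extensional_def split: if_splits)
  next
    fix a assume a: "a \<in> vec_ball p \<rho>"
    have "\<bar>a j\<bar> \<le> \<rho>" if "j < p" for j
    proof -
      have "\<bar>a j\<bar> \<le> L2_set (\<lambda>j. \<bar>a j\<bar>) {..<p}"
        using that by (intro member_le_L2_set) simp_all
      also have "\<dots> = L2_set a {..<p}" by (simp add: L2_set_def)
      finally show ?thesis using a by (simp add: vec_ball_def)
    qed
    then show "a \<in> PiE UNIV S \<inter> {a. L2_set a {..<p} \<le> \<rho>}"
      using a by (auto simp: vec_ball_def S_def PiE_iff extensional_def abs_le_iff minus_le_iff)
  qed
  finally show ?thesis .
qed

definition sq_overlap :: "nat \<Rightarrow> (nat \<Rightarrow> real) \<Rightarrow> real" where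
  "sq_overlap p a = (L2_set a {..<p})\<^sup>2 / real p"

lemma sq_overlap_le_1: "a \<in> vec_ball p (sqrt (real p)) \<Longrightarrow> 1 \<le> p \<Longrightarrow> sq_overlap p a \<le> 1"
  using power_mono[of "L2_set a {..<p}" "sqrt (real p)" 2]
  by (simp add: vec_ball_def sq_overlap_def L2_set_nonneg)

lemma f_TAP_eq:
  assumes "sq_overlap p a < 1" "\<Delta> > 0" "1 \<le> p"
  shows "f_TAP \<alpha> \<Delta> n p x y a
    = ereal (- ridge_obj \<Delta> n p x y a / (2 * real p) + tap_potential \<alpha> \<Delta> (sq_overlap p a))"
proof -
  let ?q = "sq_overlap p a"
  have "(L2_set a {..<p})\<^sup>2 = real p * ?q" using assms(3) by (simp add: sq_overlap_def)
  then have e: "- (1 / (2 * \<Delta> * real p)) * resid_sq n p x y a = - ridge_obj \<Delta> n p x y a / (2 * real p) + ?q / 2"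
    using assms by (simp add: ridge_obj_def field_simps)
  show ?thesis
    using assms unfolding f_TAP_def sq_overlap_def[symmetric] Let_def e eln_def
    by (simp add: tap_potential_def)
qed

text \<open>
  The functional is turned into a continuous real function \<open>g = exp (2 f)\<close>, for which the
  convention \<open>ln 0 = -\<infinity>\<close> becomes \<open>g = 0\<close>.
\<close>

lemma R_TAP_attained:
  assumes pos: "\<alpha> > 0" "\<Delta> > 0" and p: "1 \<le> p" and r: "0 \<le> r"
  shows "\<exists>a \<in> vec_ball p (sqrt (real p)).
    R_TAP \<alpha> \<Delta> n p x y r = 1 / real p * (L2_set (\<lambda>j. a j - a_ridge \<Delta> n p x y j) {..<p})\<^sup>2 \<and>
    f_TAP \<alpha> \<Delta> n p x y a \<ge> (SUP a' \<in> vec_ball p (sqrt (real p)). f_TAP \<alpha> \<Delta> n p x y a') - ereal r"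
proof -
  let ?B = "vec_ball p (sqrt (real p))" and ?f = "f_TAP \<alpha> \<Delta> n p x y"
  define \<phi> where "\<phi> a = - (1 / (2 * \<Delta> * real p)) * resid_sq n p x y a
             - \<alpha> / 2 * ln (1 + (1 - sq_overlap p a) / (\<Delta> * \<alpha>))" for a
  define g where "g a = exp (2 * \<phi> a) * (1 - sq_overlap p a)" for a
  define D where "D a = 1 / real p * (L2_set (\<lambda>j. a j - a_ridge \<Delta> n p x y j) {..<p})\<^sup>2" for a
  have q1: "sq_overlap p a \<le> 1" if "a \<in> ?B" for a using sq_overlap_le_1 p that by blast
  have f: "?f a = (if 0 < g a then ereal (ln (g a) / 2) else - \<infinity>)" for a
  proof -
    have "?f a = ereal (\<phi> a) + ereal (1 / 2) * eln (1 - sq_overlap p a)"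
      by (simp only: f_TAP_def Let_def sq_overlap_def \<phi>_def)
    then show ?thesis by (auto simp: g_def eln_def zero_less_mult_iff ln_mult)
  qed
  have cont_L2: "continuous_on S (\<lambda>a. L2_set a {..<p})" for S
    by (intro continuous_intros continuous_on_subset[OF continuous_on_product_coordinates]) auto
  have cont_q: "continuous_on S (sq_overlap p)" for S
    unfolding sq_overlap_def[abs_def] using p by (intro continuous_intros cont_L2) auto
  have cont_coord: "continuous_on S (\<lambda>a. a j)" for S :: "(nat \<Rightarrow> real) set" and j
    by (intro continuous_on_subset[OF continuous_on_product_coordinates]) auto
  have "1 + (1 - sq_overlap p a) / (\<Delta> * \<alpha>) \<noteq> 0" if "a \<in> ?B" for a
    using pos q1[OF that] by (smt (verit) divide_nonneg_pos mult_pos_pos)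
  then have cont_\<phi>: "continuous_on ?B \<phi>"
    unfolding \<phi>_def[abs_def] resid_sq_eq dot_def using pos
    by (intro continuous_intros cont_q cont_coord) auto
  then have cont_g: "continuous_on ?B g"
    unfolding g_def[abs_def] by (intro continuous_intros cont_q)
  have cont_D: "continuous_on ?B D"
    unfolding D_def[abs_def] by (intro continuous_intros cont_coord)
  \<comment> \<open>The origin has a positive value of \<open>g\<close>, hence the maximum of
    \<open>g\<close> is positive and the supremum of the functional is finite.\<close>
  let ?o = "\<lambda>j\<in>{..<p}. 0 :: real"
  have L0: "L2_set ?o {..<p} = 0" by (simp add: L2_set_def)
  have z: "?o \<in> ?B" using L0 by (simp add: vec_ball_def)
  have "0 < g ?o" by (simp add: g_def sq_overlap_def L0)
  obtain a0 where a0: "a0 \<in> ?B" "\<And>a. a \<in> ?B \<Longrightarrow> g a \<le> g a0"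
    using continuous_attains_sup[OF compact_vec_ball _ cont_g] z by blast
  have ga0: "0 < g a0" using a0(2)[OF z] \<open>0 < g ?o\<close> by linarith
  have sup: "(SUP a' \<in> ?B. ?f a') = ereal (ln (g a0) / 2)"
  proof (rule SUP_eqI)
    fix a assume "a \<in> ?B"
    then show "?f a \<le> ereal (ln (g a0) / 2)" using a0(2)[of a] ga0 by (simp add: f)
  next
    fix u assume "\<And>a. a \<in> ?B \<Longrightarrow> ?f a \<le> u"
    from this[OF a0(1)] show "ereal (ln (g a0) / 2) \<le> u" using ga0 by (simp add: f)
  qed
  \<comment> \<open>In terms of \<open>g\<close> the near-maximizers are a superlevel set of a
    continuous real function, closed without any case distinction at -\<infinity>.\<close>
  have near: "?f a \<ge> (SUP a' \<in> ?B. ?f a') - ereal r \<longleftrightarrow> g a0 * exp (- 2 * r) \<le> g a" for a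
  proof -
    have "(?f a \<ge> (SUP a' \<in> ?B. ?f a') - ereal r) \<longleftrightarrow> 0 < g a \<and> ln (g a0) / 2 - r \<le> ln (g a) / 2"
      unfolding sup by (simp add: f)
    also have "\<dots> \<longleftrightarrow> 0 < g a \<and> ln (g a0 * exp (- 2 * r)) \<le> ln (g a)"
      using ga0 by (simp add: ln_mult) auto
    also have "\<dots> \<longleftrightarrow> g a0 * exp (- 2 * r) \<le> g a"
      using ga0 mult_pos_pos[OF ga0 exp_gt_zero[of "- 2 * r"]] by (smt (verit) ln_le_cancel_iff)
    finally show ?thesis .
  qed
  let ?S = "{a \<in> ?B. g a0 * exp (- 2 * r) \<le> g a}"
  have "?S = ?B \<inter> g -` {g a0 * exp (- 2 * r)..}" by auto
  moreover have "closed (?B \<inter> g -` {g a0 * exp (- 2 * r)..})"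
    using compact_imp_closed[OF compact_vec_ball] cont_g by (intro continuous_closed_preimage) auto
  ultimately have "compact ?S"
    using compact_Int_closed[OF compact_vec_ball[of p "sqrt (real p)"], of ?S] by (simp add: Int_absorb1 Collect_restrict)
  moreover have "a0 \<in> ?S" using a0 ga0 r by (simp add: mult_le_cancel_left1)
  moreover have "continuous_on ?S D" by (rule continuous_on_subset[OF cont_D]) auto
  ultimately obtain a1 where a1: "a1 \<in> ?S" "\<And>a. a \<in> ?S \<Longrightarrow> D a \<le> D a1"
    using continuous_attains_sup[of ?S D] by blast
  have "R_TAP \<alpha> \<Delta> n p x y r = D a1"
    unfolding R_TAP_def near D_def[symmetric] using a1 by (intro Greatest_equality) auto
  then show ?thesis using a1(1) near[of a1] unfolding D_def by blast
qed

text \<open>The deterministic half of the argument. The ridge estimator is a competitor in the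
  supremum, so a near-maximizer a loses at most r against it. Bounding h at the overlap of a by its
  maximum leaves (F(a) - F(ridge)) / (2p) <= r + gap, where the gap measures how far the overlap of
  the ridge estimator is from optimal for h.\<close>

lemma R_TAP_le:
  assumes pos: "\<alpha> > 0" "\<Delta> > 0" and p: "1 \<le> p" and r: "0 \<le> r"
    and s: "0 < s" "s + s * \<alpha> / (\<Delta> * \<alpha> + s) = 1"
    and q: "sq_overlap p (ridge \<Delta> n p x y) < 1"
  shows "R_TAP \<alpha> \<Delta> n p x y r
    \<le> 2 * r + 2 * (tap_potential \<alpha> \<Delta> (1 - s) - tap_potential \<alpha> \<Delta> (sq_overlap p (ridge \<Delta> n p x y)))"
proof -
  let ?B = "vec_ball p (sqrt (real p))" and ?f = "f_TAP \<alpha> \<Delta> n p x y"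
  let ?r = "ridge \<Delta> n p x y" and ?F = "ridge_obj \<Delta> n p x y" and ?h = "tap_potential \<alpha> \<Delta>"
  obtain a where a: "a \<in> ?B" and R: "R_TAP \<alpha> \<Delta> n p x y r = 1 / real p * (L2_set (\<lambda>j. a j - ?r j) {..<p})\<^sup>2"
    and near: "?f a \<ge> (SUP a' \<in> ?B. ?f a') - ereal r"
    using R_TAP_attained[OF pos p r, of n x y] unfolding a_ridge_eq[OF pos(2)] by blast
  have "(L2_set ?r {..<p})\<^sup>2 \<le> real p" using q p by (simp add: sq_overlap_def field_simps)
  then have "?r \<in> ?B" by (auto simp: vec_ball_def ridge_def real_le_rsqrt)
  then have "?f ?r \<le> (SUP a' \<in> ?B. ?f a')" by (rule SUP_upper)
  then have "?f ?r - ereal r \<le> ?f a" using near by (meson ereal_minus_mono order_refl order_trans)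
  then have fa: "ereal (- ?F ?r / (2 * real p) + ?h (sq_overlap p ?r) - r) \<le> ?f a"
    unfolding f_TAP_eq[OF q pos(2) p] by simp
  \<comment> \<open>On the boundary sphere the functional is -\<infinity>, which the finite lower
    bound \<open>fa\<close> excludes.\<close>
  have qa: "sq_overlap p a < 1"
  proof (rule ccontr)
    assume "\<not> sq_overlap p a < 1"
    then have "?f a = - \<infinity>" using sq_overlap_le_1[OF a p] by (simp add: f_TAP_def Let_def sq_overlap_def[symmetric] eln_def)
    then show False using fa by simp
  qed
  have "- ?F ?r / (2 * real p) + ?h (sq_overlap p ?r) - r \<le> - ?F a / (2 * real p) + ?h (sq_overlap p a)"
    using fa unfolding f_TAP_eq[OF qa pos(2) p] by simp
  also have "?h (sq_overlap p a) \<le> ?h (1 - s)" by (rule tap_potential_le[OF pos s qa])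
  finally have "(?F a - ?F ?r) / real p \<le> 2 * r + 2 * (?h (1 - s) - ?h (sq_overlap p ?r))"
    by (simp add: diff_divide_distrib)
  moreover have "1 / real p * (L2_set (\<lambda>j. a j - ?r j) {..<p})\<^sup>2 \<le> (?F a - ?F ?r) / real p"
    using ridge_obj_ge[OF pos(2), of n p x y a] p by (simp add: divide_right_mono)
  ultimately show ?thesis unfolding R by linarith
qed

section \<open>Variance of random quadratic forms\<close>

text \<open>What standard Gaussian and spherical vectors have in common, without independence of the
  coordinates. Inequalities suffice for the fourth-order moments: on the sphere these are strictly
  smaller than the Gaussian values 3 and 1. Monomials are given by an exponent function so that the
  parity condition is a single statement.\<close>

definition isotropic_moments :: "'a measure \<Rightarrow> 'i set \<Rightarrow> ('i \<Rightarrow> 'a \<Rightarrow> real) \<Rightarrow> bool" where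
  "isotropic_moments M I z \<longleftrightarrow> finite I \<and>
    (\<forall>e. integrable M (\<lambda>\<omega>. \<Prod>i\<in>I. z i \<omega> ^ e i)) \<and>
    (\<forall>e. (\<exists>i\<in>I. odd (e i)) \<longrightarrow> (\<integral>\<omega>. (\<Prod>i\<in>I. z i \<omega> ^ e i) \<partial>M) = 0) \<and>
    (\<forall>i\<in>I. (\<integral>\<omega>. (z i \<omega>)\<^sup>2 \<partial>M) = 1 \<and> (\<integral>\<omega>. (z i \<omega>) ^ 4 \<partial>M) \<le> 3) \<and>
    (\<forall>i\<in>I. \<forall>j\<in>I. i \<noteq> j \<longrightarrow> (\<integral>\<omega>. (z i \<omega>)\<^sup>2 * (z j \<omega>)\<^sup>2 \<partial>M) \<le> 1)"

lemma prod_power_of_bool: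
  fixes f :: "'i \<Rightarrow> 'a :: comm_monoid_mult"
  assumes "finite I" "i \<in> I"
  shows "(\<Prod>m\<in>I. f m ^ of_bool (m = i)) = f i"
proof -
  have "(\<Prod>m\<in>I. f m ^ of_bool (m = i)) = (\<Prod>m\<in>I. if m = i then f m else 1)"
    by (intro prod.cong) auto
  then show ?thesis using assms by simp
qed

text \<open>Brings a product of four coordinates into monomial form; when indices coincide, their
  contributions add up in the exponent.\<close>

lemma prod_power_of_bool4:
  fixes f :: "'i \<Rightarrow> 'a :: comm_monoid_mult"
  assumes "finite I" "i \<in> I" "j \<in> I" "k \<in> I" "l \<in> I"
  shows "(\<Prod>m\<in>I. f m ^ (of_bool (m = i) + of_bool (m = j) + of_bool (m = k) + of_bool (m = l)))
    = f i * f j * f k * f l"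
  using assms by (simp only: power_add prod.distrib prod_power_of_bool)

lemma prod_power_of_bool2:
  fixes f :: "'i \<Rightarrow> 'a :: comm_monoid_mult"
  assumes "finite I" "i \<in> I" "j \<in> I"
  shows "(\<Prod>m\<in>I. f m ^ (of_bool (m = i) + of_bool (m = j))) = f i * f j"
  using assms by (simp only: power_add prod.distrib prod_power_of_bool)

context
  fixes M :: "'a measure" and I :: "'i set" and z :: "'i \<Rightarrow> 'a \<Rightarrow> real"
  assumes iso: "isotropic_moments M I z"
begin

lemma isotropic_moments_bounds:
  shows "i \<in> I \<Longrightarrow> (\<integral>\<omega>. (z i \<omega>)\<^sup>2 \<partial>M) = 1"
    and "i \<in> I \<Longrightarrow> (\<integral>\<omega>. (z i \<omega>) ^ 4 \<partial>M) \<le> 3"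
    and "i \<in> I \<Longrightarrow> j \<in> I \<Longrightarrow> i \<noteq> j \<Longrightarrow> (\<integral>\<omega>. (z i \<omega>)\<^sup>2 * (z j \<omega>)\<^sup>2 \<partial>M) \<le> 1"
  using iso unfolding isotropic_moments_def by (elim conjE, blast)+

lemma isotropic_moments_integrable4:
  assumes "i \<in> I" "j \<in> I" "k \<in> I" "l \<in> I"
  shows "integrable M (\<lambda>\<omega>. z i \<omega> * z j \<omega> * z k \<omega> * z l \<omega>)"
  using iso assms unfolding isotropic_moments_def
  by (simp flip: prod_power_of_bool4[where I = I and f = "\<lambda>i. z i \<omega>" for \<omega>])

lemma isotropic_moments_integrable2:
  assumes "i \<in> I" "j \<in> I"
  shows "integrable M (\<lambda>\<omega>. z i \<omega> * z j \<omega>)"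
  using iso assms unfolding isotropic_moments_def
  by (simp flip: prod_power_of_bool2[where I = I and f = "\<lambda>i. z i \<omega>" for \<omega>])

text \<open>With i distinct from j and k distinct from l, both i and j occur an even number of times
  only if {k, l} = {i, j}.\<close>

lemma isotropic_moments_odd4:
  assumes ijkl: "i \<in> I" "j \<in> I" "k \<in> I" "l \<in> I" and "i \<noteq> j" "k \<noteq> l" "(k, l) \<noteq> (i, j)" "(k, l) \<noteq> (j, i)"
  shows "(\<integral>\<omega>. z i \<omega> * z j \<omega> * z k \<omega> * z l \<omega> \<partial>M) = 0"
proof -
  let ?e = "\<lambda>m. of_bool (m = i) + of_bool (m = j) + of_bool (m = k) + of_bool (m = l) :: nat"
  have "odd (?e i) \<or> odd (?e j)" using assms by auto
  then have "\<exists>m\<in>I. odd (?e m)" using ijkl by blast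
  moreover have "\<forall>e. (\<exists>i\<in>I. odd (e i)) \<longrightarrow> (\<integral>\<omega>. (\<Prod>i\<in>I. z i \<omega> ^ e i) \<partial>M) = 0"
    using iso unfolding isotropic_moments_def by (elim conjE)
  ultimately have "(\<integral>\<omega>. (\<Prod>m\<in>I. z m \<omega> ^ ?e m) \<partial>M) = 0"
    by (elim allE[of _ ?e] impE)
  moreover have "finite I" using iso by (simp add: isotropic_moments_def)
  ultimately show ?thesis using ijkl by (simp only: prod_power_of_bool4)
qed

end

text \<open>
  Independence of random variables of different types, which the library's
  \<open>indep_var\<close> does not allow.
\<close>

definition (in prob_space) indep_rv :: "'b measure \<Rightarrow> ('a \<Rightarrow> 'b) \<Rightarrow> 'c measure \<Rightarrow> ('a \<Rightarrow> 'c) \<Rightarrow> bool" where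
  "indep_rv MX X MZ Z \<longleftrightarrow> random_variable MX X \<and> random_variable MZ Z \<and>
    (\<forall>f\<in>borel_measurable MX. \<forall>g\<in>borel_measurable MZ.
      indep_var (borel :: real measure) (\<lambda>\<omega>. f (X \<omega>)) (borel :: real measure) (\<lambda>\<omega>. g (Z \<omega>)))"

text \<open>Separates the entries of a random matrix, which are bounded, from the monomials in the
  independent vector, which are only integrable.\<close>

lemma (in prob_space) indep_rv_bounded_mult:
  fixes f :: "'b \<Rightarrow> real" and g :: "'c \<Rightarrow> real"
  assumes ind: "indep_rv MX X MZ Z" and f: "f \<in> borel_measurable MX" and g: "g \<in> borel_measurable MZ"
    and bound: "\<forall>x\<in>space MX. \<bar>f x\<bar> \<le> B" and int: "integrable M (\<lambda>\<omega>. g (Z \<omega>))"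
  shows "integrable M (\<lambda>\<omega>. f (X \<omega>) * g (Z \<omega>))"
    "(\<integral>\<omega>. f (X \<omega>) * g (Z \<omega>) \<partial>M) = (\<integral>\<omega>. f (X \<omega>) \<partial>M) * (\<integral>\<omega>. g (Z \<omega>) \<partial>M)"
proof -
  have ind': "indep_var borel (\<lambda>\<omega>. f (X \<omega>)) borel (\<lambda>\<omega>. g (Z \<omega>))"
    using ind f g by (simp add: indep_rv_def)
  have X: "X \<in> measurable M MX" using ind by (simp add: indep_rv_def)
  have "AE \<omega> in M. norm (f (X \<omega>)) \<le> B"
    using bound measurable_space[OF X] by (intro AE_I2) auto
  then have "integrable M (\<lambda>\<omega>. f (X \<omega>))"
    using measurable_compose[OF X f] by (intro integrable_const_bound) auto
  then show "integrable M (\<lambda>\<omega>. f (X \<omega>) * g (Z \<omega>))"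
    "(\<integral>\<omega>. f (X \<omega>) * g (Z \<omega>) \<partial>M) = (\<integral>\<omega>. f (X \<omega>) \<partial>M) * (\<integral>\<omega>. g (Z \<omega>) \<partial>M)"
    using indep_var_integrable[OF ind' _ int] indep_var_lebesgue_integral[OF ind' _ int] by auto
qed

text \<open>W splits into a diagonal part with terms A_ii (z_i^2 - 1) and an off-diagonal part with
  terms A_ij z_i z_j. In the square of the first, distinct indices contribute at most 0, because the
  covariance of z_i^2 and z_k^2 is nonpositive and A_ii A_kk is nonnegative. In the square of the
  second, a pair meets only itself and its transpose. Each square thus has expectation at most twice
  its share of the squared Frobenius norm, and recombining them costs another factor 2.\<close>

lemma (in prob_space) quadratic_form_variance:
  fixes z :: "'i \<Rightarrow> 'a \<Rightarrow> real" and A :: "'b \<Rightarrow> 'i \<Rightarrow> 'i \<Rightarrow> real"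
  assumes ind: "indep_rv MX X (borel_PiM I) (\<lambda>\<omega>. \<lambda>i\<in>I. z i \<omega>)"
    and iso: "isotropic_moments M I z"
    and A_meas: "\<And>i j. i \<in> I \<Longrightarrow> j \<in> I \<Longrightarrow> (\<lambda>x. A x i j) \<in> borel_measurable MX"
    and A_sym: "\<And>x i j. x \<in> space MX \<Longrightarrow> i \<in> I \<Longrightarrow> j \<in> I \<Longrightarrow> A x i j = A x j i"
    and A_diag: "\<And>x i. x \<in> space MX \<Longrightarrow> i \<in> I \<Longrightarrow> 0 \<le> A x i i"
    and frob: "\<And>x. x \<in> space MX \<Longrightarrow> (\<Sum>i\<in>I. \<Sum>j\<in>I. (A x i j)\<^sup>2) \<le> C"
  defines "W \<equiv> \<lambda>\<omega>. (\<Sum>i\<in>I. \<Sum>j\<in>I. A (X \<omega>) i j * z i \<omega> * z j \<omega>) - (\<Sum>i\<in>I. A (X \<omega>) i i)"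
  shows "integrable M W" "integrable M (\<lambda>\<omega>. (W \<omega>)\<^sup>2)" "expectation (\<lambda>\<omega>. (W \<omega>)\<^sup>2) \<le> 4 * C"
proof -
  have fI: "finite I" using iso by (simp add: isotropic_moments_def)
  have X: "X \<in> measurable M MX" using ind by (simp add: indep_rv_def)
  have A_meas' [measurable]: "(\<lambda>\<omega>. A (X \<omega>) i j) \<in> borel_measurable M" if "i \<in> I" "j \<in> I" for i j
    using measurable_compose[OF X A_meas[OF that]] .
  have A_sq: "(A x i j)\<^sup>2 \<le> C" if "x \<in> space MX" "i \<in> I" "j \<in> I" for x i j
  proof -
    have "(A x i j)\<^sup>2 \<le> (\<Sum>j\<in>I. (A x i j)\<^sup>2)" using that fI by (intro member_le_sum) auto
    also have "\<dots> \<le> (\<Sum>i\<in>I. \<Sum>j\<in>I. (A x i j)\<^sup>2)" using that fI by (intro member_le_sum[where f = "\<lambda>i. \<Sum>j\<in>I. (A x i j)\<^sup>2"]) (auto intro!: sum_nonneg)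
    finally show ?thesis using frob[OF that(1)] by linarith
  qed
  \<comment> \<open>The Frobenius bound also bounds every single entry, which makes all products of
    two entries integrable.\<close>
  have A_bd: "\<bar>A x i j * A x k l\<bar> \<le> C" if "x \<in> space MX" "i \<in> I" "j \<in> I" "k \<in> I" "l \<in> I" for x i j k l
  proof -
    have "0 \<le> (\<bar>A x i j\<bar> - \<bar>A x k l\<bar>)\<^sup>2" by simp
    then have "2 * \<bar>A x i j * A x k l\<bar> \<le> (A x i j)\<^sup>2 + (A x k l)\<^sup>2"
      by (simp add: power2_eq_square abs_mult algebra_simps)
    then show ?thesis using A_sq[of x i j] A_sq[of x k l] that by linarith
  qed
  have A_sq_int: "integrable M (\<lambda>\<omega>. A (X \<omega>) i j * A (X \<omega>) k l)" if "i \<in> I" "j \<in> I" "k \<in> I" "l \<in> I" for i j k l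
    using that A_bd measurable_space[OF X] by (intro integrable_const_bound[where B = C] AE_I2) auto
  define Q where "Q i j = expectation (\<lambda>\<omega>. (A (X \<omega>) i j)\<^sup>2)" for i j
  have Q_nn: "0 \<le> Q i j" for i j by (simp add: Q_def)

  define D where "D i \<omega> = A (X \<omega>) i i * ((z i \<omega>)\<^sup>2 - 1)" for i \<omega>
  have z2_int: "integrable M (\<lambda>\<omega>. (z i \<omega>)\<^sup>2)" if "i \<in> I" for i
    using isotropic_moments_integrable2[OF iso that that] by (simp add: power2_eq_square)
  have z22_int: "integrable M (\<lambda>\<omega>. (z i \<omega>)\<^sup>2 * (z k \<omega>)\<^sup>2)" if "i \<in> I" "k \<in> I" for i k
    using isotropic_moments_integrable4[OF iso that(1,1) that(2,2)] by (simp add: power2_eq_square mult.assoc)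
  have zz_int: "integrable M (\<lambda>\<omega>. ((z i \<omega>)\<^sup>2 - 1) * ((z k \<omega>)\<^sup>2 - 1))" if "i \<in> I" "k \<in> I" for i k
    using z22_int[OF that] z2_int that by (simp add: algebra_simps)
  \<comment> \<open>The expectation is E z_i^2 z_k^2 - 1, hence at most 3 - 1 for equal and 1 - 1
    for distinct indices.\<close>
  have zz_exp: "expectation (\<lambda>\<omega>. ((z i \<omega>)\<^sup>2 - 1) * ((z k \<omega>)\<^sup>2 - 1)) \<le> 2 * of_bool (i = k)"
    if "i \<in> I" "k \<in> I" for i k
  proof -
    have "expectation (\<lambda>\<omega>. ((z i \<omega>)\<^sup>2 - 1) * ((z k \<omega>)\<^sup>2 - 1))
      = expectation (\<lambda>\<omega>. (z i \<omega>)\<^sup>2 * (z k \<omega>)\<^sup>2 - (z i \<omega>)\<^sup>2 - (z k \<omega>)\<^sup>2 + 1)"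
      by (simp add: algebra_simps)
    also have "\<dots> = expectation (\<lambda>\<omega>. (z i \<omega>)\<^sup>2 * (z k \<omega>)\<^sup>2) - expectation (\<lambda>\<omega>. (z i \<omega>)\<^sup>2) - expectation (\<lambda>\<omega>. (z k \<omega>)\<^sup>2) + 1"
      using z22_int[OF that] z2_int that by (simp add: prob_space)
    also have "\<dots> = expectation (\<lambda>\<omega>. (z i \<omega>)\<^sup>2 * (z k \<omega>)\<^sup>2) - 1"
      using isotropic_moments_bounds(1)[OF iso] that by simp
    also have "\<dots> \<le> 2 * of_bool (i = k)"
    proof (cases "i = k")
      case True
      then have "(\<lambda>\<omega>. (z i \<omega>)\<^sup>2 * (z k \<omega>)\<^sup>2) = (\<lambda>\<omega>. z i \<omega> ^ 4)" by (simp flip: power_add)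
      then show ?thesis using isotropic_moments_bounds(2)[OF iso that(2)] True by simp
    next
      case False
      then show ?thesis using isotropic_moments_bounds(3)[OF iso that] by simp
    qed
    finally show ?thesis .
  qed
  have DD: "integrable M (\<lambda>\<omega>. D i \<omega> * D k \<omega>)" "expectation (\<lambda>\<omega>. D i \<omega> * D k \<omega>) \<le> of_bool (i = k) * (2 * Q i i)"
    if ik: "i \<in> I" "k \<in> I" for i k
  proof -
    let ?g = "\<lambda>w. ((w i)\<^sup>2 - 1) * ((w k)\<^sup>2 - 1) :: real"
    have g: "?g \<in> borel_measurable (borel_PiM I)" using ik by measurable
    have f: "(\<lambda>x. A x i i * A x k k) \<in> borel_measurable MX" using A_meas ik by measurable
    have int: "integrable M (\<lambda>\<omega>. ?g (\<lambda>i\<in>I. z i \<omega>))" using zz_int ik by simp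
    have bd: "\<forall>x\<in>space MX. \<bar>A x i i * A x k k\<bar> \<le> C" using A_bd ik by blast
    note m = indep_rv_bounded_mult[OF ind f g, where B = C, OF bd int]
    have eq: "(\<lambda>\<omega>. D i \<omega> * D k \<omega>) = (\<lambda>\<omega>. (A (X \<omega>) i i * A (X \<omega>) k k) * ?g (\<lambda>i\<in>I. z i \<omega>))"
      using ik by (auto simp: D_def)
    show "integrable M (\<lambda>\<omega>. D i \<omega> * D k \<omega>)" unfolding eq by (rule m)
    have "expectation (\<lambda>\<omega>. D i \<omega> * D k \<omega>)
      = expectation (\<lambda>\<omega>. A (X \<omega>) i i * A (X \<omega>) k k) * expectation (\<lambda>\<omega>. ?g (\<lambda>i\<in>I. z i \<omega>))"
      unfolding eq by (rule m)
    also have "expectation (\<lambda>\<omega>. ?g (\<lambda>i\<in>I. z i \<omega>)) = expectation (\<lambda>\<omega>. ((z i \<omega>)\<^sup>2 - 1) * ((z k \<omega>)\<^sup>2 - 1))"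
      using ik by simp
    also have "expectation (\<lambda>\<omega>. A (X \<omega>) i i * A (X \<omega>) k k) * \<dots>
      \<le> expectation (\<lambda>\<omega>. A (X \<omega>) i i * A (X \<omega>) k k) * (2 * of_bool (i = k))"
      using zz_exp[OF ik] A_diag ik measurable_space[OF X]
      by (intro mult_left_mono Bochner_Integration.integral_nonneg_AE AE_I2 mult_nonneg_nonneg) auto
    also have "\<dots> = of_bool (i = k) * (2 * Q i i)" by (simp add: Q_def power2_eq_square)
    finally show "expectation (\<lambda>\<omega>. D i \<omega> * D k \<omega>) \<le> of_bool (i = k) * (2 * Q i i)" .
  qed
  have D_sq: "(\<lambda>\<omega>. (\<Sum>i\<in>I. D i \<omega>)\<^sup>2) = (\<lambda>\<omega>. \<Sum>i\<in>I. \<Sum>k\<in>I. D i \<omega> * D k \<omega>)"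
    by (simp add: power2_eq_square sum_product)
  have D_int: "integrable M (\<lambda>\<omega>. (\<Sum>i\<in>I. D i \<omega>)\<^sup>2)" unfolding D_sq using DD by auto
  have "expectation (\<lambda>\<omega>. (\<Sum>i\<in>I. D i \<omega>)\<^sup>2) = (\<Sum>i\<in>I. \<Sum>k\<in>I. expectation (\<lambda>\<omega>. D i \<omega> * D k \<omega>))"
    unfolding D_sq using DD by simp
  also have "\<dots> \<le> (\<Sum>i\<in>I. \<Sum>k\<in>I. of_bool (i = k) * (2 * Q i i))" using DD by (intro sum_mono) auto
  also have "\<dots> = (\<Sum>i\<in>I. 2 * Q i i)"
    using fI by (simp add: of_bool_def if_distrib[of "\<lambda>a. a * _"] cong: if_cong)
  finally have D_exp: "expectation (\<lambda>\<omega>. (\<Sum>i\<in>I. D i \<omega>)\<^sup>2) \<le> (\<Sum>i\<in>I. 2 * Q i i)" .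

  define P where "P = {(i, j) \<in> I \<times> I. i \<noteq> j}"
  have fP: "finite P" unfolding P_def using fI by (intro finite_subset[OF _ finite_cartesian_product[OF fI fI]]) auto
  define F where "F a \<omega> = A (X \<omega>) (fst a) (snd a) * (z (fst a) \<omega> * z (snd a) \<omega>)" for a \<omega>
  have FF: "integrable M (\<lambda>\<omega>. F a \<omega> * F b \<omega>)"
    "expectation (\<lambda>\<omega>. F a \<omega> * F b \<omega>) \<le> (of_bool (b = a) + of_bool (b = prod.swap a)) * Q (fst a) (snd a)"
    if ab: "a \<in> P" "b \<in> P" for a b
  proof -
    obtain i j k l where a: "a = (i, j)" and b: "b = (k, l)" by (metis surj_pair)
    have ijkl: "i \<in> I" "j \<in> I" "k \<in> I" "l \<in> I" "i \<noteq> j" "k \<noteq> l" using ab by (auto simp: a b P_def)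
    let ?g = "\<lambda>w. w i * w j * w k * w l :: real"
    have g: "?g \<in> borel_measurable (borel_PiM I)" using ijkl by measurable
    have f: "(\<lambda>x. A x i j * A x k l) \<in> borel_measurable MX" using A_meas ijkl by measurable
    have int: "integrable M (\<lambda>\<omega>. ?g (\<lambda>i\<in>I. z i \<omega>))"
      using isotropic_moments_integrable4[OF iso] ijkl by simp
    have bd: "\<forall>x\<in>space MX. \<bar>A x i j * A x k l\<bar> \<le> C" using A_bd ijkl by blast
    note m = indep_rv_bounded_mult[OF ind f g, where B = C, OF bd int]
    have eq: "(\<lambda>\<omega>. F a \<omega> * F b \<omega>) = (\<lambda>\<omega>. (A (X \<omega>) i j * A (X \<omega>) k l) * ?g (\<lambda>i\<in>I. z i \<omega>))"
      using ijkl by (auto simp: F_def a b)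
    show "integrable M (\<lambda>\<omega>. F a \<omega> * F b \<omega>)" unfolding eq by (rule m)
    have e: "expectation (\<lambda>\<omega>. F a \<omega> * F b \<omega>)
      = expectation (\<lambda>\<omega>. A (X \<omega>) i j * A (X \<omega>) k l) * expectation (\<lambda>\<omega>. z i \<omega> * z j \<omega> * z k \<omega> * z l \<omega>)"
    proof -
      have "expectation (\<lambda>\<omega>. F a \<omega> * F b \<omega>)
        = expectation (\<lambda>\<omega>. A (X \<omega>) i j * A (X \<omega>) k l) * expectation (\<lambda>\<omega>. ?g (\<lambda>i\<in>I. z i \<omega>))"
        unfolding eq by (rule m)
      then show ?thesis using ijkl by simp
    qed
    \<comment> \<open>Either the two pairs agree up to transposition, and symmetry of
      \<open>A\<close> produces a square, or the fourth-order moment vanishes by parity.\<close>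
    show "expectation (\<lambda>\<omega>. F a \<omega> * F b \<omega>) \<le> (of_bool (b = a) + of_bool (b = prod.swap a)) * Q (fst a) (snd a)"
    proof (cases "b = a \<or> b = prod.swap a")
      case True
      have "z i \<omega> * z j \<omega> * z k \<omega> * z l \<omega> = (z i \<omega>)\<^sup>2 * (z j \<omega>)\<^sup>2" for \<omega>
        using True by (auto simp: a b power2_eq_square)
      moreover have "expectation (\<lambda>\<omega>. A (X \<omega>) i j * A (X \<omega>) k l) = Q i j"
        unfolding Q_def
        using True A_sym ijkl measurable_space[OF X]
        by (intro Bochner_Integration.integral_cong) (auto simp: a b power2_eq_square)
      ultimately have "expectation (\<lambda>\<omega>. F a \<omega> * F b \<omega>) = Q i j * expectation (\<lambda>\<omega>. (z i \<omega>)\<^sup>2 * (z j \<omega>)\<^sup>2)"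
        unfolding e by simp
      also have "\<dots> \<le> Q i j * 1"
        using isotropic_moments_bounds(3)[OF iso ijkl(1,2,5)] Q_nn by (intro mult_left_mono)
      finally have le: "expectation (\<lambda>\<omega>. F a \<omega> * F b \<omega>) \<le> Q i j" by simp
      have "(1::real) \<le> of_bool (b = a) + of_bool (b = prod.swap a)" using True by (elim disjE) simp_all
      from mult_right_mono[OF this Q_nn[of i j]] le show ?thesis by (simp add: a)
    next
      case False
      then show ?thesis unfolding e using isotropic_moments_odd4[OF iso, of i j k l] ijkl using Q_nn[of i j] by (simp add: a b)
    qed
  qed
  have F_sq: "(\<lambda>\<omega>. (\<Sum>a\<in>P. F a \<omega>)\<^sup>2) = (\<lambda>\<omega>. \<Sum>a\<in>P. \<Sum>b\<in>P. F a \<omega> * F b \<omega>)"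
    by (simp add: power2_eq_square sum_product)
  have F_int: "integrable M (\<lambda>\<omega>. (\<Sum>a\<in>P. F a \<omega>)\<^sup>2)" unfolding F_sq using FF by auto
  have "expectation (\<lambda>\<omega>. (\<Sum>a\<in>P. F a \<omega>)\<^sup>2) = (\<Sum>a\<in>P. \<Sum>b\<in>P. expectation (\<lambda>\<omega>. F a \<omega> * F b \<omega>))"
    unfolding F_sq using FF by simp
  also have "\<dots> \<le> (\<Sum>a\<in>P. \<Sum>b\<in>P. (of_bool (b = a) + of_bool (b = prod.swap a)) * Q (fst a) (snd a))"
    using FF by (intro sum_mono) auto
  also have "\<dots> = (\<Sum>a\<in>P. 2 * Q (fst a) (snd a))"
  proof (intro sum.cong refl)
    fix a assume a: "a \<in> P"
    then have sa: "prod.swap a \<in> P" by (auto simp: P_def)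
    have 1: "(\<Sum>b\<in>P. of_bool (b = c) :: real) = 1" if "c \<in> P" for c
      using fP that by (simp add: of_bool_def)
    have "(\<Sum>b\<in>P. (of_bool (b = a) + of_bool (b = prod.swap a)) * Q (fst a) (snd a))
      = ((\<Sum>b\<in>P. of_bool (b = a)) + (\<Sum>b\<in>P. of_bool (b = prod.swap a))) * Q (fst a) (snd a)"
      by (simp only: sum_distrib_right sum.distrib[symmetric])
    then show "(\<Sum>b\<in>P. (of_bool (b = a) + of_bool (b = prod.swap a)) * Q (fst a) (snd a)) = 2 * Q (fst a) (snd a)"
      unfolding 1[OF a] 1[OF sa] by simp
  qed
  finally have F_exp: "expectation (\<lambda>\<omega>. (\<Sum>a\<in>P. F a \<omega>)\<^sup>2) \<le> (\<Sum>a\<in>P. 2 * Q (fst a) (snd a))" .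

  have split: "(\<Sum>i\<in>I. \<Sum>j\<in>I. f i j) = (\<Sum>i\<in>I. f i i) + (\<Sum>a\<in>P. f (fst a) (snd a))" for f :: "'i \<Rightarrow> 'i \<Rightarrow> real"
  proof -
    have "(\<Sum>i\<in>I. \<Sum>j\<in>I. f i j) = (\<Sum>a\<in>I \<times> I. f (fst a) (snd a))"
      by (simp add: sum.cartesian_product case_prod_beta)
    also have "I \<times> I = (\<lambda>i. (i, i)) ` I \<union> P" by (auto simp: P_def)
    also have "(\<Sum>a\<in>(\<lambda>i. (i, i)) ` I \<union> P. f (fst a) (snd a))
      = (\<Sum>a\<in>(\<lambda>i. (i, i)) ` I. f (fst a) (snd a)) + (\<Sum>a\<in>P. f (fst a) (snd a))"
      using fI fP by (intro sum.union_disjoint) (auto simp: P_def)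
    also have "(\<Sum>a\<in>(\<lambda>i. (i, i)) ` I. f (fst a) (snd a)) = (\<Sum>i\<in>I. f i i)"
      by (subst sum.reindex) (auto simp: inj_on_def)
    finally show ?thesis .
  qed
  have W: "W \<omega> = (\<Sum>i\<in>I. D i \<omega>) + (\<Sum>a\<in>P. F a \<omega>)" for \<omega>
    unfolding W_def split D_def F_def
    by (simp add: algebra_simps sum_subtractf power2_eq_square)
  have [measurable]: "z i \<in> borel_measurable M" if "i \<in> I" for i
  proof -
    have "(\<lambda>\<omega>. (\<lambda>i\<in>I. z i \<omega>) i) \<in> borel_measurable M"
      using ind that measurable_compose[OF _ measurable_component_singleton, of _ M I "\<lambda>_. borel" i]
      unfolding indep_rv_def by blast
    then show ?thesis using that by simp
  qed
  have W_meas[measurable]: "W \<in> borel_measurable M" unfolding W_def by measurable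
  have W_le: "(W \<omega>)\<^sup>2 \<le> 2 * (\<Sum>i\<in>I. D i \<omega>)\<^sup>2 + 2 * (\<Sum>a\<in>P. F a \<omega>)\<^sup>2" for \<omega>
  proof -
    have "0 \<le> ((\<Sum>i\<in>I. D i \<omega>) - (\<Sum>a\<in>P. F a \<omega>))\<^sup>2" by simp
    then show ?thesis unfolding W by (simp add: power2_eq_square algebra_simps)
  qed
  show int: "integrable M (\<lambda>\<omega>. (W \<omega>)\<^sup>2)"
    by (rule Bochner_Integration.integrable_bound[of M "\<lambda>\<omega>. 2 * (\<Sum>i\<in>I. D i \<omega>)\<^sup>2 + 2 * (\<Sum>a\<in>P. F a \<omega>)\<^sup>2"])
      (use D_int F_int W_le in auto)
  then show "integrable M W"
    by (rule square_integrable_imp_integrable[rotated]) simp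
  have "expectation (\<lambda>\<omega>. (W \<omega>)\<^sup>2) \<le> expectation (\<lambda>\<omega>. 2 * (\<Sum>i\<in>I. D i \<omega>)\<^sup>2 + 2 * (\<Sum>a\<in>P. F a \<omega>)\<^sup>2)"
    using int D_int F_int W_le by (intro integral_mono) auto
  also have "\<dots> \<le> 2 * (\<Sum>i\<in>I. 2 * Q i i) + 2 * (\<Sum>a\<in>P. 2 * Q (fst a) (snd a))"
    using D_int F_int D_exp F_exp by simp
  also have "\<dots> = 4 * (\<Sum>i\<in>I. \<Sum>j\<in>I. Q i j)"
    unfolding split by (simp add: sum_distrib_left[symmetric])
  also have "(\<Sum>i\<in>I. \<Sum>j\<in>I. Q i j) = expectation (\<lambda>\<omega>. \<Sum>i\<in>I. \<Sum>j\<in>I. (A (X \<omega>) i j)\<^sup>2)"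
    using A_sq_int by (simp add: Q_def power2_eq_square)
  also have "\<dots> \<le> expectation (\<lambda>\<omega>. C)"
    using A_sq_int frob measurable_space[OF X] by (intro integral_mono) (auto simp: power2_eq_square)
  also have "\<dots> = C" by (simp add: prob_space)
  finally show "expectation (\<lambda>\<omega>. (W \<omega>)\<^sup>2) \<le> 4 * C" by simp
qed

text \<open>Nonnegativity of the variance of |W|. It turns variance bounds into first-moment bounds,
  which add up over rows and feed Markov's inequality.\<close>

lemma (in prob_space) expectation_abs_le_sqrt:
  fixes W :: "'a \<Rightarrow> real"
  assumes "integrable M W" "integrable M (\<lambda>\<omega>. (W \<omega>)\<^sup>2)" "expectation (\<lambda>\<omega>. (W \<omega>)\<^sup>2) \<le> B"
  shows "expectation (\<lambda>\<omega>. \<bar>W \<omega>\<bar>) \<le> sqrt B"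
proof (rule real_le_rsqrt)
  have "variance (\<lambda>\<omega>. \<bar>W \<omega>\<bar>) = expectation (\<lambda>\<omega>. (\<bar>W \<omega>\<bar>)\<^sup>2) - (expectation (\<lambda>\<omega>. \<bar>W \<omega>\<bar>))\<^sup>2"
    using assms by (intro variance_eq) auto
  moreover have "0 \<le> variance (\<lambda>\<omega>. \<bar>W \<omega>\<bar>)" by (rule variance_positive)
  ultimately show "(expectation (\<lambda>\<omega>. \<bar>W \<omega>\<bar>))\<^sup>2 \<le> B" using assms(3) by simp
qed

section \<open>Moments of the uniform distribution on the sphere\<close>

abbreviation lborel_PiM :: "nat \<Rightarrow> (nat \<Rightarrow> real) measure" where
  "lborel_PiM p \<equiv> (\<Pi>\<^sub>M j\<in>{..<p}. (lborel :: real measure))"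

lemma sets_lborel_PiM: "sets (lborel_PiM p) = sets (borel_PiM {..<p})"
  by (intro sets_PiM_cong) auto

lemma measurable_fun_upd_PiM:
  assumes "i < p" "f \<in> borel_measurable (lborel_PiM p)"
  shows "(\<lambda>u. u(i := f u)) \<in> measurable (lborel_PiM p) (lborel_PiM p)"
proof -
  have "{..<p} = insert i {..<p}" using assms(1) by auto
  then show ?thesis
    using assms measurable_fun_upd[where I = "{..<p}" and J = "{..<p}" and i = i and M = "\<lambda>_. lborel" and N = "lborel_PiM p"
        and f = "\<lambda>u. u" and h = f] by simp
qed

text \<open>Integrating over coordinate \<open>i\<close> first, with the others fixed,
  \<open>g u\<close> is a constant, and the claim becomes invariance of Lebesgue measure on the line
  under translations and reflections. Shears use c = 1, sign flips c = -1.\<close>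

lemma distr_shear_PiM:
  fixes g :: "(nat \<Rightarrow> real) \<Rightarrow> real"
  assumes i: "i < p" and g: "g \<in> borel_measurable (lborel_PiM p)" and c: "\<bar>c\<bar> = 1"
    and indep: "\<And>u y. g (u(i := y)) = g u"
  defines "T \<equiv> \<lambda>u. u(i := c * u i + g u)"
  shows "T \<in> measurable (lborel_PiM p) (lborel_PiM p)" "distr (lborel_PiM p) (lborel_PiM p) T = lborel_PiM p"
proof -
  let ?P = "lborel_PiM p" and ?J = "{..<p} - {i}"
  interpret product_sigma_finite "\<lambda>_::nat. lborel :: real measure"
    by (simp add: product_sigma_finite_def sigma_finite_lborel)
  have ins: "{..<p} = insert i ?J" using i by auto
  have [measurable]: "(\<lambda>u. u i) \<in> borel_measurable ?P" using i by simp
  note g[measurable]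
  show T[measurable]: "T \<in> measurable ?P ?P"
    unfolding T_def using i by (intro measurable_fun_upd_PiM) auto
  show "distr ?P ?P T = ?P"
  proof (rule measure_eqI)
    fix A assume "A \<in> sets (distr ?P ?P T)"
    then have A[measurable]: "A \<in> sets ?P" by simp
    have split: "(\<integral>\<^sup>+u. f u \<partial>?P) = (\<integral>\<^sup>+u. (\<integral>\<^sup>+y. f (u(i := y)) \<partial>lborel) \<partial>(PiM ?J (\<lambda>_. lborel)))"
      if "f \<in> borel_measurable ?P" for f
      using product_nn_integral_insert[of ?J i f] that ins by simp
    have "emeasure (distr ?P ?P T) A = (\<integral>\<^sup>+u. indicator A (T u) \<partial>?P)"
      by (subst nn_integral_indicator[symmetric], simp, subst nn_integral_distr) simp_all
    also have "\<dots> = (\<integral>\<^sup>+u. (\<integral>\<^sup>+y. indicator A (T (u(i := y))) \<partial>lborel) \<partial>(PiM ?J (\<lambda>_. lborel)))"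
      by (rule split) measurable
    also have "\<dots> = (\<integral>\<^sup>+u. (\<integral>\<^sup>+y. indicator A (u(i := g u + c * y)) \<partial>lborel) \<partial>(PiM ?J (\<lambda>_. lborel)))"
      by (simp add: T_def indep add.commute)
    also have "\<dots> = (\<integral>\<^sup>+u. (\<integral>\<^sup>+y. indicator A (u(i := y)) \<partial>lborel) \<partial>(PiM ?J (\<lambda>_. lborel)))"
    proof (rule nn_integral_cong)
      fix u assume u: "u \<in> space (PiM ?J (\<lambda>_. lborel :: real measure))"
      have "(\<lambda>y. u(i := y)) \<in> measurable lborel (PiM (insert i ?J) (\<lambda>_. lborel :: real measure))"
        using u by (intro measurable_fun_upd[where J = ?J]) auto
      then have "(\<lambda>y. u(i := y)) \<in> measurable lborel ?P" using ins by simp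
      then have "(\<lambda>y. indicator A (u(i := y)) :: ennreal) \<in> borel_measurable borel" by simp
      from nn_integral_real_affine[OF this, of c "g u"] c
      show "(\<integral>\<^sup>+y. indicator A (u(i := g u + c * y)) \<partial>lborel) = (\<integral>\<^sup>+y. indicator A (u(i := y)) \<partial>lborel)"
        by force
    qed
    also have "\<dots> = (\<integral>\<^sup>+u. indicator A u \<partial>?P)" by (rule split[symmetric]) simp
    also have "\<dots> = emeasure ?P A" by simp
    finally show "emeasure (distr ?P ?P T) A = emeasure ?P A" .
  qed simp
qed

definition rotate_pair :: "nat \<Rightarrow> nat \<Rightarrow> real \<Rightarrow> real \<Rightarrow> (nat \<Rightarrow> real) \<Rightarrow> nat \<Rightarrow> real" where
  "rotate_pair i j c s u = u(i := c * u i - s * u j, j := s * u i + c * u j)"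

text \<open>A plane rotation is a product of three shears.\<close>

lemma distr_rotate_pair_PiM:
  assumes ij: "i < p" "j < p" "i \<noteq> j" and cs: "c\<^sup>2 + s\<^sup>2 = 1" "c \<noteq> - 1"
  shows "rotate_pair i j c s \<in> measurable (lborel_PiM p) (lborel_PiM p)"
    "distr (lborel_PiM p) (lborel_PiM p) (rotate_pair i j c s) = lborel_PiM p"
proof -
  let ?P = "lborel_PiM p"
  \<comment> \<open>For c = cos and s = sin of an angle, this is minus the tangent of half the
    angle, hence the exclusion of c = -1.\<close>
  define t where "t = - s / (1 + c)"
  define S1 where "S1 = (\<lambda>u :: nat \<Rightarrow> real. u(i := 1 * u i + t * u j))"
  define S2 where "S2 = (\<lambda>u :: nat \<Rightarrow> real. u(j := 1 * u j + s * u i))"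
  have S1: "S1 \<in> measurable ?P ?P" "distr ?P ?P S1 = ?P"
    unfolding S1_def using ij by (intro distr_shear_PiM; simp)+
  have S2: "S2 \<in> measurable ?P ?P" "distr ?P ?P S2 = ?P"
    unfolding S2_def using ij by (intro distr_shear_PiM; simp)+
  have c0: "1 + c \<noteq> 0" using cs by auto
  have t: "1 + s * t = c" "t * (1 + c) = - s"
  proof -
    have "s\<^sup>2 = (1 - c) * (1 + c)" using cs by (simp add: power2_eq_square algebra_simps)
    then show "1 + s * t = c" using c0 by (simp add: t_def power2_eq_square field_simps)
    show "t * (1 + c) = - s" using c0 by (simp add: t_def)
  qed
  have "S1 (S2 (S1 u)) = rotate_pair i j c s u" for u
  proof -
    have 1: "u j + s * (u i + t * u j) = s * u i + c * u j"
      unfolding t(1)[symmetric] by (simp add: algebra_simps)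
    have "u i + t * u j + t * (s * u i + c * u j) = (1 + s * t) * u i + (t * (1 + c)) * u j"
      by (simp add: algebra_simps)
    then have 2: "u i + t * u j + t * (s * u i + c * u j) = c * u i - s * u j"
      unfolding t by simp
    show ?thesis using ij 1 2 by (auto simp: S1_def S2_def rotate_pair_def fun_eq_iff)
  qed
  then have e: "rotate_pair i j c s = S1 \<circ> (S2 \<circ> S1)" by auto
  show "rotate_pair i j c s \<in> measurable ?P ?P"
    unfolding e using S1 S2 by (intro measurable_comp)
  have "distr ?P ?P (S2 \<circ> S1) = ?P"
    using distr_distr[OF S2(1) S1(1)] S1(2) S2(2) by simp
  then show "distr ?P ?P (rotate_pair i j c s) = ?P"
    unfolding e using distr_distr[OF S1(1) measurable_comp[OF S1(1) S2(1)]] S1(2) by simp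
qed

text \<open>A map that preserves Lebesgue measure and the norm preserves the uniform measure on the
  ball; being homogeneous as well, it commutes with the radial projection to the sphere.\<close>

lemma distr_sphere_uniform:
  assumes T: "T \<in> measurable (lborel_PiM p) (lborel_PiM p)" "distr (lborel_PiM p) (lborel_PiM p) T = lborel_PiM p"
    and norm: "\<And>u. u \<in> vecs p \<Longrightarrow> L2_set (T u) {..<p} = L2_set u {..<p}"
    and lin: "\<And>u k. u \<in> vecs p \<Longrightarrow> T (\<lambda>j\<in>{..<p}. k * u j) = (\<lambda>j\<in>{..<p}. k * T u j)"
  shows "distr (sphere_uniform p \<rho>) (borel_PiM {..<p}) T = sphere_uniform p \<rho>"
proof -
  let ?P = "lborel_PiM p" and ?B = "borel_PiM {..<p}"
  let ?U = "uniform_measure ?P (vec_ball p 1)"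
  define \<phi> where "\<phi> u = (\<lambda>j\<in>{..<p}. \<rho> * u j / L2_set u {..<p})" for u :: "nat \<Rightarrow> real"
  have \<phi>: "\<phi> \<in> measurable ?U ?B" unfolding \<phi>_def L2_set_def by simp
  have TB: "T \<in> measurable ?B ?B" using T(1) by (simp cong: measurable_cong_sets add: sets_lborel_PiM)
  have TU: "T \<in> measurable ?U ?P" using T(1) by simp
  note ball = vec_ball_measurable[of p 1]
  have U: "distr ?U ?P T = ?U"
  proof (rule measure_eqI)
    fix A assume "A \<in> sets (distr ?U ?P T)"
    then have A: "A \<in> sets ?P" by simp
    have "vec_ball p 1 \<inter> (T -` A \<inter> space ?P) = T -` (vec_ball p 1 \<inter> A) \<inter> space ?P"
      using norm measurable_space[OF T(1)] by (auto simp: vec_ball_def space_PiM)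
    then have "emeasure (distr ?U ?P T) A = emeasure ?P (T -` (vec_ball p 1 \<inter> A) \<inter> space ?P) / emeasure ?P (vec_ball p 1)"
      using A T(1) ball measurable_sets[OF T(1) A] by (simp add: emeasure_distr[OF TU])
    also have "emeasure ?P (T -` (vec_ball p 1 \<inter> A) \<inter> space ?P) = emeasure (distr ?P ?P T) (vec_ball p 1 \<inter> A)"
      using A ball by (simp add: emeasure_distr[OF T(1)])
    finally show "emeasure (distr ?U ?P T) A = emeasure ?U A"
      using A ball by (simp add: T(2))
  qed simp
  have comm: "(T \<circ> \<phi>) u = (\<phi> \<circ> T) u" if "u \<in> space ?U" for u
  proof -
    have u: "u \<in> vecs p" using that by (simp add: space_PiM)
    show ?thesis using lin[OF u, of "\<rho> / L2_set u {..<p}"] norm[OF u] by (simp add: \<phi>_def)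
  qed
  have "distr (sphere_uniform p \<rho>) ?B T = distr ?U ?B (T \<circ> \<phi>)"
    unfolding sphere_uniform_def \<phi>_def[symmetric] by (rule distr_distr[OF TB \<phi>])
  also have "\<dots> = distr ?U ?B (\<phi> \<circ> T)" by (intro distr_cong refl comm)
  also have "\<dots> = distr (distr ?U ?P T) ?B \<phi>"
    by (rule distr_distr[symmetric]) (use \<phi> TU in simp_all)
  also have "\<dots> = sphere_uniform p \<rho>" unfolding U sphere_uniform_def \<phi>_def[abs_def] ..
  finally show ?thesis .
qed

lemma distr_sphere_uniform_rotate_pair:
  assumes ij: "i < p" "j < p" "i \<noteq> j" and cs: "c\<^sup>2 + s\<^sup>2 = 1" "c \<noteq> - 1"
  shows "distr (sphere_uniform p \<rho>) (borel_PiM {..<p}) (rotate_pair i j c s) = sphere_uniform p \<rho>"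
proof (rule distr_sphere_uniform)
  show "rotate_pair i j c s \<in> measurable (lborel_PiM p) (lborel_PiM p)"
    "distr (lborel_PiM p) (lborel_PiM p) (rotate_pair i j c s) = lborel_PiM p"
    by (rule distr_rotate_pair_PiM[OF assms])+
  fix u :: "nat \<Rightarrow> real" assume "u \<in> vecs p"
  have split: "(\<Sum>m<p. (v m)\<^sup>2) = (v i)\<^sup>2 + ((v j)\<^sup>2 + (\<Sum>m\<in>{..<p} - {i} - {j}. (v m)\<^sup>2))" for v :: "nat \<Rightarrow> real"
    using ij by (simp add: sum.remove[of "{..<p}" i] sum.remove[of "{..<p} - {i}" j])
  have "(c * a - s * b)\<^sup>2 + (s * a + c * b)\<^sup>2 = (c\<^sup>2 + s\<^sup>2) * (a\<^sup>2 + b\<^sup>2)" for a b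
    by (simp add: power2_eq_square algebra_simps)
  then have "(c * u i - s * u j)\<^sup>2 + (s * u i + c * u j)\<^sup>2 = (u i)\<^sup>2 + (u j)\<^sup>2" using cs by simp
  then show "L2_set (rotate_pair i j c s u) {..<p} = L2_set u {..<p}"
    using ij unfolding L2_set_def split by (simp add: rotate_pair_def)
  fix k :: real
  show "rotate_pair i j c s (\<lambda>j\<in>{..<p}. k * u j) = (\<lambda>ja\<in>{..<p}. k * rotate_pair i j c s u ja)"
    using ij by (auto simp: rotate_pair_def fun_eq_iff algebra_simps)
qed

lemma distr_sphere_uniform_flip:
  assumes i: "i < p"
  shows "distr (sphere_uniform p \<rho>) (borel_PiM {..<p}) (\<lambda>u. u(i := - u i)) = sphere_uniform p \<rho>"
proof (rule distr_sphere_uniform)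
  show "(\<lambda>u. u(i := - u i)) \<in> measurable (lborel_PiM p) (lborel_PiM p)"
    "distr (lborel_PiM p) (lborel_PiM p) (\<lambda>u. u(i := - u i)) = lborel_PiM p"
    using distr_shear_PiM[OF i, of "\<lambda>_. 0" "- 1"] by simp_all
  fix u :: "nat \<Rightarrow> real" assume "u \<in> vecs p"
  have "(\<Sum>m<p. ((u(i := - u i)) m)\<^sup>2) = (\<Sum>m<p. (u m)\<^sup>2)" by (intro sum.cong) auto
  then show "L2_set (u(i := - u i)) {..<p} = L2_set u {..<p}" by (simp add: L2_set_def)
  fix k :: real
  show "(\<lambda>j\<in>{..<p}. k * u j)(i := - (\<lambda>j\<in>{..<p}. k * u j) i) = (\<lambda>j\<in>{..<p}. k * (u(i := - u i)) j)"
    using i by (auto simp: fun_eq_iff)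
qed

text \<open>The normalization fails only at the origin, a null set because there is at least one
  coordinate.\<close>

lemma AE_sphere_uniform:
  assumes "1 \<le> p"
  shows "AE b in sphere_uniform p \<rho>. (\<Sum>j<p. (b j)\<^sup>2) = \<rho>\<^sup>2"
proof -
  let ?P = "lborel_PiM p"
  let ?U = "uniform_measure ?P (vec_ball p 1)"
  interpret product_sigma_finite "\<lambda>_::nat. lborel :: real measure"
    by (simp add: product_sigma_finite_def sigma_finite_lborel)
  have Z: "(\<Pi>\<^sub>E j\<in>{..<p}. {0 :: real}) \<in> null_sets ?P"
  proof (rule null_setsI)
    show "emeasure ?P (\<Pi>\<^sub>E j\<in>{..<p}. {0 :: real}) = 0"
      using assms by (subst emeasure_PiM) auto
  qed (intro sets_PiM_I_finite; simp)
  then have "AE u in ?P. u \<notin> (\<Pi>\<^sub>E j\<in>{..<p}. {0 :: real})" by (rule AE_not_in)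
  moreover have "AE u in ?P. u \<in> space ?P" by (rule AE_space)
  ultimately have "AE u in ?P. L2_set u {..<p} \<noteq> 0"
  proof eventually_elim
    case (elim u)
    show ?case
    proof
      assume "L2_set u {..<p} = 0"
      then have "\<forall>j\<in>{..<p}. u j = 0" by (simp add: L2_set_eq_0_iff)
      then show False using elim unfolding space_PiM PiE_def by blast
    qed
  qed
  then have "AE u in ?U. L2_set u {..<p} \<noteq> 0"
    by (intro AE_uniform_measureI vec_ball_measurable) auto
  then have "AE u in ?U. (\<Sum>j<p. ((\<lambda>j\<in>{..<p}. \<rho> * u j / L2_set u {..<p}) j)\<^sup>2) = \<rho>\<^sup>2"
  proof eventually_elim
    case (elim u)
    have "(\<Sum>j<p. ((\<lambda>j\<in>{..<p}. \<rho> * u j / L2_set u {..<p}) j)\<^sup>2) = \<rho>\<^sup>2 * (\<Sum>j<p. (u j)\<^sup>2) / (L2_set u {..<p})\<^sup>2"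
      by (simp add: power_mult_distrib power_divide sum_distrib_left sum_divide_distrib)
    also have "(\<Sum>j<p. (u j)\<^sup>2) = (L2_set u {..<p})\<^sup>2" by (simp add: L2_set_def sum_nonneg)
    finally show ?case using elim by simp
  qed
  then show ?thesis
    unfolding sphere_uniform_def by (subst AE_distr_iff) (auto simp: L2_set_def)
qed

text \<open>All moments come from symmetry and the norm constraint, without a density. Sign flips
  kill odd moments and quarter turns equate the coordinates; the constraint then makes second
  moments 1. A further rotation gives E b_i^4 = 3 E b_i^2 b_j^2, and the constraint multiplied by
  b_i^2 fixes E b_i^4 = 3p/(p + 2).\<close>

lemma isotropic_moments_sphere_uniform:
  assumes p: "1 \<le> p"
  shows "isotropic_moments (sphere_uniform p (sqrt (real p))) {..<p} (\<lambda>j b. b j)"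
proof -
  define S where "S = sphere_uniform p (sqrt (real p))"
  interpret prob_space S unfolding S_def by (rule prob_space_sphere_uniform)
  have sets[measurable_cong]: "sets S = sets (borel_PiM {..<p})" by (simp add: S_def sphere_uniform_def)
  have norm: "AE b in S. (\<Sum>j<p. (b j)\<^sup>2) = real p"
    using AE_sphere_uniform[OF p, of "sqrt (real p)"] unfolding S_def by simp
  have bd: "AE b in S. \<forall>j<p. \<bar>b j\<bar> \<le> sqrt (real p)"
    using norm
  proof eventually_elim
    case (elim b)
    have "(b j)\<^sup>2 \<le> real p" if "j < p" for j
      using that member_le_sum[of j "{..<p}" "\<lambda>j. (b j)\<^sup>2"] elim by simp
    then show ?case by (metis real_sqrt_abs real_sqrt_le_iff)
  qed
  have mono_meas: "(\<lambda>b. \<Prod>j<p. b j ^ e j) \<in> borel_measurable S" for e by measurable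
  have int: "integrable S (\<lambda>b. \<Prod>j<p. b j ^ e j)" for e
  proof (rule integrable_const_bound[where B = "\<Prod>j<p. sqrt (real p) ^ e j"])
    show "AE b in S. norm (\<Prod>j<p. b j ^ e j) \<le> (\<Prod>j<p. sqrt (real p) ^ e j)"
      using bd by eventually_elim (auto simp: abs_prod power_abs intro!: prod_mono power_mono)
  qed (rule mono_meas)
  have invariant: "(\<integral>b. f (T b) \<partial>S) = (\<integral>b. f b \<partial>S)"
    if "distr S (borel_PiM {..<p}) T = S" "T \<in> measurable S (borel_PiM {..<p})" "f \<in> borel_measurable S"
    for T and f :: "(nat \<Rightarrow> real) \<Rightarrow> real"
    using integral_distr[of T S "borel_PiM {..<p}" f] that by (simp add: measurable_cong_sets[OF sets refl])
  have odd: "(\<integral>b. (\<Prod>j<p. b j ^ e j) \<partial>S) = 0" if "i < p" "odd (e i)" for e i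
  proof -
    have D: "distr S (borel_PiM {..<p}) (\<lambda>b. b(i := - b i)) = S"
      unfolding S_def by (rule distr_sphere_uniform_flip[OF that(1)])
    have "(\<lambda>b. b(i := - b i)) \<in> measurable S (borel_PiM {..<p})"
      using measurable_fun_upd_PiM[OF that(1), of "\<lambda>b. - b i"] that(1)
      by (simp add: measurable_cong_sets[OF sets refl] sets_lborel_PiM cong: measurable_cong_sets)
    from invariant[OF D this mono_meas]
    have "(\<integral>b. (\<Prod>j<p. (b(i := - b i)) j ^ e j) \<partial>S) = (\<integral>b. (\<Prod>j<p. b j ^ e j) \<partial>S)" .
    moreover have "(\<Prod>j<p. (b(i := - b i)) j ^ e j) = - (\<Prod>j<p. b j ^ e j)" for b :: "nat \<Rightarrow> real"
      using that by (simp add: prod.remove[of "{..<p}" i])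
    ultimately show ?thesis by simp
  qed
  have mono4: "b i * b j * b k * b l = (\<Prod>m<p. b m ^ (of_bool (m = i) + of_bool (m = j) + of_bool (m = k) + of_bool (m = l)))"
    if "i < p" "j < p" "k < p" "l < p" for i j k l and b :: "nat \<Rightarrow> real"
    using that by (subst prod_power_of_bool4) auto
  have int4: "integrable S (\<lambda>b. b i * b j * b k * b l)" if "i < p" "j < p" "k < p" "l < p" for i j k l
    using int that by (simp add: mono4)
  define v where "v i = (\<integral>b. (b i)\<^sup>2 \<partial>S)" for i
  define d where "d i = (\<integral>b. (b i) ^ 4 \<partial>S)" for i
  define c where "c i j = (\<integral>b. (b i)\<^sup>2 * (b j)\<^sup>2 \<partial>S)" for i j
  have coord[measurable]: "(\<lambda>b. b i) \<in> borel_measurable S" if "i < p" for i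
    using that by (simp add: measurable_cong_sets[OF sets refl])
  have rotate: "(\<integral>b. f (rotate_pair i j c s b) \<partial>S) = (\<integral>b. f b \<partial>S)"
    if "i < p" "j < p" "i \<noteq> j" "c\<^sup>2 + s\<^sup>2 = 1" "c \<noteq> - 1" "f \<in> borel_measurable S" for i j c s and f :: "(nat \<Rightarrow> real) \<Rightarrow> real"
  proof (rule invariant[OF _ _ that(6)])
    show "distr S (borel_PiM {..<p}) (rotate_pair i j c s) = S"
      unfolding S_def by (rule distr_sphere_uniform_rotate_pair[OF that(1-5)])
    show "rotate_pair i j c s \<in> measurable S (borel_PiM {..<p})"
      using distr_rotate_pair_PiM(1)[OF that(1-5)]
      by (simp add: measurable_cong_sets[OF sets refl] sets_lborel_PiM cong: measurable_cong_sets)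
  qed
  \<comment> \<open>The quarter turn c = 0, s = 1 sends coordinate \<open>i\<close> to minus
    coordinate \<open>j\<close>; the even power hides the sign.\<close>
  have vd: "v i = v j" "d i = d j" if "i < p" "j < p" for i j
    using that rotate[of i j 0 1 "\<lambda>b. (b i)\<^sup>2"] rotate[of i j 0 1 "\<lambda>b. (b i) ^ 4"]
    by (cases "i = j"; simp add: v_def d_def rotate_pair_def)+
  have sq_int: "integrable S (\<lambda>b. (b i)\<^sup>2)" if "i < p" for i
    using int[of "\<lambda>m. of_bool (m = i) + of_bool (m = i)"] that prod_power_of_bool2[of "{..<p}" i i b for b :: "nat \<Rightarrow> real"]
    by (simp add: power2_eq_square)
  have v1: "v i = 1" if "i < p" for i
  proof -
    have "real p * v i = (\<Sum>j<p. v j)" using vd(1)[OF _ that] by simp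
    also have "\<dots> = (\<integral>b. (\<Sum>j<p. (b j)\<^sup>2) \<partial>S)" using sq_int by (simp add: v_def)
    also have "\<dots> = (\<integral>b. real p \<partial>S)" using norm by (intro integral_cong_AE) auto
    finally show ?thesis using p by (simp add: prob_space)
  qed
  txt \<open>Invariance of the fourth moment under a rotation by an angle with sine \<open>4 / 5\<close> and cosine \<open>3 / 5\<close>.\<close>
  have dc: "d i = 3 * c i j" if ij: "i < p" "j < p" "i \<noteq> j" for i j
  proof -
    have odd3: "(\<integral>b. b i * b i * b i * b j \<partial>S) = 0" "(\<integral>b. b i * b j * b j * b j \<partial>S) = 0"
      using ij by (simp_all only: mono4, auto intro!: odd[of i] odd[of j])
    have "d j = (\<integral>b. (4 / 5 * b i + 3 / 5 * b j) ^ 4 \<partial>S)"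
      using rotate[of i j "3 / 5" "4 / 5" "\<lambda>b. (b j) ^ 4"] ij
      by (simp add: d_def rotate_pair_def power2_eq_square)
    also have "\<dots> = (\<integral>b. 256 / 625 * (b i * b i * b i * b i) + 768 / 625 * (b i * b i * b i * b j)
        + 864 / 625 * (b i * b i * b j * b j) + 432 / 625 * (b i * b j * b j * b j) + 81 / 625 * (b j * b j * b j * b j) \<partial>S)"
      by (intro Bochner_Integration.integral_cong refl) (simp add: eval_nat_numeral field_simps)
    also have "\<dots> = 256 / 625 * d i + 864 / 625 * c i j + 81 / 625 * d j"
      using ij int4 odd3 by (simp add: d_def c_def eval_nat_numeral mult.assoc)
    \<comment> \<open>Since \<open>d i = d j\<close>, multiplying by 625 leaves 288 d = 864 c. The
      rational sine and cosine keep the expansion free of roots.\<close>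
    finally show ?thesis using vd(2)[OF ij(1,2)] by (simp add: field_simps)
  qed
  have di: "d i * (real p + 2) = 3 * real p" if i: "i < p" for i
  proof -
    have c_int: "integrable S (\<lambda>b. (b i)\<^sup>2 * (b j)\<^sup>2)" if "j < p" for j
      using int4[OF i i that that] by (simp add: power2_eq_square mult.assoc)
    \<comment> \<open>Summing the mixed moments over j recovers the norm constraint, so d + (p - 1)
      d / 3 = p.\<close>
    have "(\<Sum>j<p. c i j) = (\<integral>b. (\<Sum>j<p. (b i)\<^sup>2 * (b j)\<^sup>2) \<partial>S)" using c_int by (simp add: c_def)
    also have "\<dots> = (\<integral>b. real p * (b i)\<^sup>2 \<partial>S)"
    proof (rule integral_cong_AE)
      show "AE b in S. (\<Sum>j<p. (b i)\<^sup>2 * (b j)\<^sup>2) = real p * (b i)\<^sup>2"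
        using norm by eventually_elim (simp add: sum_distrib_left[symmetric])
    qed (use i in measurable)
    also have "\<dots> = real p" using v1[OF i] by (simp add: v_def)
    finally have "real p = c i i + (\<Sum>j\<in>{..<p} - {i}. c i j)" using i by (simp add: sum.remove[of "{..<p}" i])
    also have "(\<Sum>j\<in>{..<p} - {i}. c i j) = (\<Sum>j\<in>{..<p} - {i}. d i / 3)"
      using dc[OF i] by (intro sum.cong) auto
    also have "\<dots> = (real p - 1) * (d i / 3)" using i by (simp add: of_nat_diff)
    also have "c i i = d i" by (simp add: c_def d_def flip: power_add)
    finally show ?thesis by (simp add: field_simps)
  qed
  have d3: "d i \<le> 3" if "i < p" for i
  proof (rule mult_right_le_imp_le)
    show "d i * (real p + 2) \<le> 3 * (real p + 2)" using di[OF that] by simp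
  qed simp
  have c1: "c i j \<le> 1" if "i < p" "j < p" "i \<noteq> j" for i j using dc[OF that] d3[OF that(1)] by simp
  show ?thesis
    unfolding isotropic_moments_def S_def[symmetric] v_def[symmetric] d_def[symmetric] c_def[symmetric]
    using int odd v1 d3 c1 by (intro conjI allI impI ballI) auto
qed

section \<open>Gaussian moments and independence\<close>

lemma isotropic_moments_distr:
  assumes X: "X \<in> measurable M (borel_PiM I)"
    and iso: "isotropic_moments (distr M (borel_PiM I) X) I (\<lambda>i b. b i)"
  shows "isotropic_moments M I (\<lambda>i \<omega>. X \<omega> i)"
proof -
  let ?D = "distr M (borel_PiM I) X"
  have e: "(\<integral>b. f b \<partial>?D) = (\<integral>\<omega>. f (X \<omega>) \<partial>M)" if "f \<in> borel_measurable (borel_PiM I)" for f :: "_ \<Rightarrow> real"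
    using that by (rule integral_distr[OF X])
  have i: "integrable ?D f \<longleftrightarrow> integrable M (\<lambda>\<omega>. f (X \<omega>))" if "f \<in> borel_measurable (borel_PiM I)" for f :: "_ \<Rightarrow> real"
    using that by (rule integrable_distr_eq[OF X])
  have 1: "(\<lambda>b. \<Prod>i\<in>I. b i ^ e i :: real) \<in> borel_measurable (borel_PiM I)" for e by measurable
  have 2: "(\<lambda>b. (b i) ^ k :: real) \<in> borel_measurable (borel_PiM I)" if "i \<in> I" for i k using that by measurable
  have 3: "(\<lambda>b. (b i)\<^sup>2 * (b j)\<^sup>2 :: real) \<in> borel_measurable (borel_PiM I)" if "i \<in> I" "j \<in> I" for i j using that by measurable
  show ?thesis
    using iso unfolding isotropic_moments_def
    by (simp add: e[OF 1] i[OF 1] e[OF 2] e[OF 3])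
qed

text \<open>Lets a row of the matrix, indexed by pairs with fixed first component, be treated as a
  vector indexed by columns.\<close>

lemma isotropic_moments_reindex:
  assumes z: "isotropic_moments M (f ` I) z" and f: "inj_on f I"
  shows "isotropic_moments M I (\<lambda>i. z (f i))"
proof -
  have "finite I" using z f by (simp add: isotropic_moments_def finite_image_iff)
  have e: "(\<Prod>k\<in>f ` I. z k \<omega> ^ e (inv_into I f k)) = (\<Prod>i\<in>I. z (f i) \<omega> ^ e i)" for e \<omega>
    using f by (simp add: prod.reindex)
  have "integrable M (\<lambda>\<omega>. \<Prod>i\<in>I. z (f i) \<omega> ^ e i)" for e
    unfolding e[symmetric] using z by (simp add: isotropic_moments_def)
  moreover have "(\<integral>\<omega>. (\<Prod>i\<in>I. z (f i) \<omega> ^ e i) \<partial>M) = 0" if "i \<in> I" "odd (e i)" for e i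
  proof -
    have "\<exists>k\<in>f ` I. odd (e (inv_into I f k))" using that f by (intro bexI[of _ "f i"]) auto
    moreover have "\<forall>e. (\<exists>k\<in>f ` I. odd (e k)) \<longrightarrow> (\<integral>\<omega>. (\<Prod>k\<in>f ` I. z k \<omega> ^ e k) \<partial>M) = 0"
      using z unfolding isotropic_moments_def by (elim conjE)
    ultimately have "(\<integral>\<omega>. (\<Prod>k\<in>f ` I. z k \<omega> ^ e (inv_into I f k)) \<partial>M) = 0"
      by (elim allE[of _ "\<lambda>k. e (inv_into I f k)"] impE)
    then show ?thesis by (simp only: e)
  qed
  moreover have "f i \<noteq> f j" if "i \<in> I" "j \<in> I" "i \<noteq> j" for i j
    using that f by (auto dest: inj_onD)
  ultimately show ?thesis
    using \<open>finite I\<close> isotropic_moments_bounds[OF z]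
    unfolding isotropic_moments_def by (intro conjI allI impI ballI) auto
qed

lemma (in prob_space) isotropic_moments_normal:
  assumes I: "finite I" and \<sigma>: "\<sigma> > 0" and ind: "indep_vars (\<lambda>_. borel) X I"
    and dist: "\<And>i. i \<in> I \<Longrightarrow> distributed M lborel (X i) (normal_density 0 \<sigma>)"
  shows "isotropic_moments M I (\<lambda>i \<omega>. X i \<omega> / \<sigma>)"
proof -
  have int: "integrable M (\<lambda>\<omega>. (X i \<omega> / \<sigma>) ^ k)" if "i \<in> I" for i k
    using distributed_integrable[OF dist[OF that], of "\<lambda>x. x ^ k"] integrable_normal_moment[OF \<sigma>, of 0 k]
    by (simp add: power_divide)
  have expn: "expectation (\<lambda>\<omega>. (X i \<omega> / \<sigma>) ^ k) = (\<integral>x. normal_density 0 \<sigma> x * x ^ k \<partial>lborel) / \<sigma> ^ k"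
    if "i \<in> I" for i k
    using distributed_integral[OF dist[OF that], of "\<lambda>x. x ^ k"] by (simp add: power_divide)
  have odd: "expectation (\<lambda>\<omega>. (X i \<omega> / \<sigma>) ^ k) = 0" if "i \<in> I" "odd k" for i k
    using that(2) integral_normal_moment_odd[OF \<sigma>, of 0] by (auto simp: expn[OF that(1)] elim!: oddE)
  have second: "expectation (\<lambda>\<omega>. (X i \<omega> / \<sigma>)\<^sup>2) = 1" if "i \<in> I" for i
  proof -
    have "(\<integral>x. normal_density 0 \<sigma> x * x\<^sup>2 \<partial>lborel) = \<sigma>\<^sup>2"
      using integral_normal_moment_even[OF \<sigma>, of 0 1] by simp
    then show ?thesis unfolding expn[OF that] using \<sigma> by simp
  qed
  have fourth: "expectation (\<lambda>\<omega>. (X i \<omega> / \<sigma>) ^ 4) = 3" if "i \<in> I" for i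
    using integral_normal_moment_even[OF \<sigma>, of 0 2] \<sigma>
    unfolding expn[OF that] by (simp add: fact_numeral field_simps flip: power_mult)
  have ind': "indep_vars (\<lambda>_. borel) (\<lambda>i \<omega>. (X i \<omega> / \<sigma>) ^ e i) I" for e
    using indep_vars_compose2[OF ind, of "\<lambda>i x. (x / \<sigma>) ^ e i" "\<lambda>_. borel"] by simp
  have prod_int: "integrable M (\<lambda>\<omega>. \<Prod>i\<in>I. (X i \<omega> / \<sigma>) ^ e i)" for e
    using indep_vars_integrable[OF I ind'] int by blast
  have prod_exp: "expectation (\<lambda>\<omega>. \<Prod>i\<in>I. (X i \<omega> / \<sigma>) ^ e i) = (\<Prod>i\<in>I. expectation (\<lambda>\<omega>. (X i \<omega> / \<sigma>) ^ e i))" for e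
    using indep_vars_lebesgue_integral[OF I ind'] int by blast
  have prod_odd: "expectation (\<lambda>\<omega>. \<Prod>i\<in>I. (X i \<omega> / \<sigma>) ^ e i) = 0" if "i \<in> I" "odd (e i)" for e i
    using that odd I unfolding prod_exp by (auto simp: prod_zero_iff)
  have mixed: "expectation (\<lambda>\<omega>. (X i \<omega> / \<sigma>)\<^sup>2 * (X j \<omega> / \<sigma>)\<^sup>2) = 1" if ij: "i \<in> I" "j \<in> I" "i \<noteq> j" for i j
  proof -
    let ?e = "\<lambda>m. of_bool (m = i) + of_bool (m = i) + of_bool (m = j) + of_bool (m = j) :: nat"
    have "(X i \<omega> / \<sigma>)\<^sup>2 * (X j \<omega> / \<sigma>)\<^sup>2 = (\<Prod>m\<in>I. (X m \<omega> / \<sigma>) ^ ?e m)" for \<omega>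
      using I ij by (subst prod_power_of_bool4) (auto simp: power2_eq_square)
    then have "expectation (\<lambda>\<omega>. (X i \<omega> / \<sigma>)\<^sup>2 * (X j \<omega> / \<sigma>)\<^sup>2)
        = (\<Prod>m\<in>I. expectation (\<lambda>\<omega>. (X m \<omega> / \<sigma>) ^ ?e m))"
      by (simp only: prod_exp)
    also have "\<dots> = (\<Prod>m\<in>I. 1)"
    proof (intro prod.cong refl)
      fix m assume "m \<in> I"
      then show "expectation (\<lambda>\<omega>. (X m \<omega> / \<sigma>) ^ ?e m) = 1"
        using second[of m] ij(3) by (cases "m = i"; cases "m = j"; simp add: prob_space numeral_2_eq_2)
    qed
    finally show ?thesis by simp
  qed
  show ?thesis
    unfolding isotropic_moments_def using I prod_int prod_odd second fourth mixed
    by (intro conjI allI impI ballI) auto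
qed

text \<open>Allows a spherical block to be stacked on a Gaussian one: monomials factor over the two
  blocks, an odd exponent kills one factor, and mixed second moments across blocks are 1 *
  1.\<close>

lemma (in prob_space) isotropic_moments_Plus:
  assumes ind: "indep_rv (borel_PiM I) X (borel_PiM J) Y"
    and X: "isotropic_moments M I (\<lambda>i \<omega>. X \<omega> i)" and Y: "isotropic_moments M J (\<lambda>j \<omega>. Y \<omega> j)"
  shows "isotropic_moments M (I <+> J) (\<lambda>k \<omega>. case_sum (X \<omega>) (Y \<omega>) k)"
proof -
  have fin: "finite I" "finite J" using X Y by (simp_all add: isotropic_moments_def)
  have split: "(\<Prod>k\<in>I <+> J. case_sum (X \<omega>) (Y \<omega>) k ^ e k)
      = (\<Prod>i\<in>I. X \<omega> i ^ e (Inl i)) * (\<Prod>j\<in>J. Y \<omega> j ^ e (Inr j))" for e \<omega>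
    using fin by (subst prod.Plus) auto
  have ind': "indep_var borel (\<lambda>\<omega>. f (X \<omega>)) borel (\<lambda>\<omega>. g (Y \<omega>))"
    if "f \<in> borel_measurable (borel_PiM I)" "g \<in> borel_measurable (borel_PiM J)" for f g :: "_ \<Rightarrow> real"
    using ind that unfolding indep_rv_def by blast
  have mX: "(\<lambda>b. \<Prod>i\<in>I. b i ^ e i :: real) \<in> borel_measurable (borel_PiM I)" for e by measurable
  have mY: "(\<lambda>b. \<Prod>i\<in>J. b i ^ e i :: real) \<in> borel_measurable (borel_PiM J)" for e by measurable
  have iX: "integrable M (\<lambda>\<omega>. \<Prod>i\<in>I. X \<omega> i ^ e i)" for e using X by (simp add: isotropic_moments_def)
  have iY: "integrable M (\<lambda>\<omega>. \<Prod>j\<in>J. Y \<omega> j ^ e j)" for e using Y by (simp add: isotropic_moments_def)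
  have oX: "expectation (\<lambda>\<omega>. \<Prod>i\<in>I. X \<omega> i ^ e i) = 0" if "i \<in> I" "odd (e i)" for e i
    using X that unfolding isotropic_moments_def by (elim conjE) blast
  have oY: "expectation (\<lambda>\<omega>. \<Prod>j\<in>J. Y \<omega> j ^ e j) = 0" if "j \<in> J" "odd (e j)" for e j
    using Y that unfolding isotropic_moments_def by (elim conjE) blast
  have int: "integrable M (\<lambda>\<omega>. \<Prod>k\<in>I <+> J. case_sum (X \<omega>) (Y \<omega>) k ^ e k)" for e
    unfolding split by (rule indep_var_integrable[OF ind'[OF mX mY] iX iY])
  have expn: "expectation (\<lambda>\<omega>. \<Prod>k\<in>I <+> J. case_sum (X \<omega>) (Y \<omega>) k ^ e k)
    = expectation (\<lambda>\<omega>. \<Prod>i\<in>I. X \<omega> i ^ e (Inl i)) * expectation (\<lambda>\<omega>. \<Prod>j\<in>J. Y \<omega> j ^ e (Inr j))" for e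
    unfolding split by (rule indep_var_lebesgue_integral[OF ind'[OF mX mY] iX iY])
  have odd: "expectation (\<lambda>\<omega>. \<Prod>k\<in>I <+> J. case_sum (X \<omega>) (Y \<omega>) k ^ e k) = 0"
    if "k \<in> I <+> J" "odd (e k)" for e k
  proof (cases k)
    case (Inl i)
    then have "i \<in> I" "odd (e (Inl i))" using that by auto
    then show ?thesis unfolding expn using oX[of i "\<lambda>i. e (Inl i)"] by simp
  next
    case (Inr j)
    then have "j \<in> J" "odd (e (Inr j))" using that by auto
    then show ?thesis unfolding expn using oY[of j "\<lambda>j. e (Inr j)"] by simp
  qed
  have sX: "integrable M (\<lambda>\<omega>. (X \<omega> i)\<^sup>2)" if "i \<in> I" for i
    using isotropic_moments_integrable2[OF X that that] by (simp add: power2_eq_square)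
  have sY: "integrable M (\<lambda>\<omega>. (Y \<omega> j)\<^sup>2)" if "j \<in> J" for j
    using isotropic_moments_integrable2[OF Y that that] by (simp add: power2_eq_square)
  have mixed: "expectation (\<lambda>\<omega>. (X \<omega> i)\<^sup>2 * (Y \<omega> j)\<^sup>2) = 1" if "i \<in> I" "j \<in> J" for i j
  proof -
    have "(\<lambda>b. (b i)\<^sup>2 :: real) \<in> borel_measurable (borel_PiM I)" "(\<lambda>b. (b j)\<^sup>2 :: real) \<in> borel_measurable (borel_PiM J)"
      using that by measurable
    from indep_var_lebesgue_integral[OF ind'[OF this] sX[OF that(1)] sY[OF that(2)]]
    show ?thesis using isotropic_moments_bounds(1)[OF X that(1)] isotropic_moments_bounds(1)[OF Y that(2)] by simp
  qed
  then have mixed': "expectation (\<lambda>\<omega>. (Y \<omega> j)\<^sup>2 * (X \<omega> i)\<^sup>2) = 1" if "i \<in> I" "j \<in> J" for i j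
    using that by (simp add: mult.commute)
  have "(\<integral>\<omega>. (case_sum (X \<omega>) (Y \<omega>) k)\<^sup>2 \<partial>M) = 1 \<and> (\<integral>\<omega>. (case_sum (X \<omega>) (Y \<omega>) k) ^ 4 \<partial>M) \<le> 3"
    if "k \<in> I <+> J" for k
    using that isotropic_moments_bounds(1,2)[OF X] isotropic_moments_bounds(1,2)[OF Y] by auto
  moreover have "(\<integral>\<omega>. (case_sum (X \<omega>) (Y \<omega>) k)\<^sup>2 * (case_sum (X \<omega>) (Y \<omega>) l)\<^sup>2 \<partial>M) \<le> 1"
    if "k \<in> I <+> J" "l \<in> I <+> J" "k \<noteq> l" for k l
    using that by (elim PlusE)
      (auto simp: mixed mixed' intro: isotropic_moments_bounds(3)[OF X] isotropic_moments_bounds(3)[OF Y])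
  ultimately show ?thesis
    unfolding isotropic_moments_def
  proof (intro conjI)
    show "\<forall>e. (\<exists>k\<in>I <+> J. odd (e k)) \<longrightarrow> expectation (\<lambda>\<omega>. \<Prod>k\<in>I <+> J. case_sum (X \<omega>) (Y \<omega>) k ^ e k) = 0"
      using odd by blast
  qed (use fin int in auto)
qed

text \<open>Every event described by a real function of \<open>X\<close> lies in \<open>A\<close>,
  and likewise for \<open>Z\<close> and \<open>B\<close>, so independence of the larger classes is
  inherited. \<open>A\<close> and \<open>B\<close> may exceed the generated algebras, as is
  convenient for several variables stacked into one.\<close>

lemma (in prob_space) indep_rvI:
  assumes X: "random_variable MX X" and Z: "random_variable MZ Z" and ind: "indep_set A B"
    and A: "sigma_algebra (space M) A" "\<And>S. S \<in> sets MX \<Longrightarrow> X -` S \<inter> space M \<in> A"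
    and B: "sigma_algebra (space M) B" "\<And>S. S \<in> sets MZ \<Longrightarrow> Z -` S \<inter> space M \<in> B"
  shows "indep_rv MX X MZ Z"
  unfolding indep_rv_def
proof (intro conjI ballI X Z)
  have sub: "sigma_sets (space M) {(\<lambda>\<omega>. f (Y \<omega>)) -` S \<inter> space M |S. S \<in> sets borel} \<subseteq> C"
    if "sigma_algebra (space M) C" "\<And>S. S \<in> sets MY \<Longrightarrow> Y -` S \<inter> space M \<in> C"
      "random_variable MY Y" "f \<in> borel_measurable MY"
    for C :: "'a set set" and MY :: "'d measure" and Y and f :: "'d \<Rightarrow> real"
  proof (intro sigma_algebra.sigma_sets_subset[OF that(1)] subsetI)
    fix D assume "D \<in> {(\<lambda>\<omega>. f (Y \<omega>)) -` S \<inter> space M |S. S \<in> sets borel}"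
    then obtain S where S: "S \<in> sets borel" and D: "D = (\<lambda>\<omega>. f (Y \<omega>)) -` S \<inter> space M" by blast
    have "D = Y -` (f -` S \<inter> space MY) \<inter> space M" using measurable_space[OF that(3)] by (auto simp: D)
    then show "D \<in> C" using that(2)[OF measurable_sets[OF that(4) S]] by simp
  qed
  fix f :: "_ \<Rightarrow> real" and g :: "_ \<Rightarrow> real"
  assume f: "f \<in> borel_measurable MX" and g: "g \<in> borel_measurable MZ"
  show "indep_var borel (\<lambda>\<omega>. f (X \<omega>)) borel (\<lambda>\<omega>. g (Z \<omega>))"
    unfolding indep_var_eq indep_set_def
  proof (intro conjI)
    show "indep_sets (case_bool (sigma_sets (space M) {(\<lambda>\<omega>. f (X \<omega>)) -` A \<inter> space M |A. A \<in> sets borel})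
        (sigma_sets (space M) {(\<lambda>\<omega>. g (Z \<omega>)) -` A \<inter> space M |A. A \<in> sets borel})) UNIV"
    proof (rule indep_sets_mono_sets[OF ind[unfolded indep_set_def]])
      fix b :: bool
      show "case_bool (sigma_sets (space M) {(\<lambda>\<omega>. f (X \<omega>)) -` A \<inter> space M |A. A \<in> sets borel})
        (sigma_sets (space M) {(\<lambda>\<omega>. g (Z \<omega>)) -` A \<inter> space M |A. A \<in> sets borel}) b \<subseteq> case_bool A B b"
        using sub[OF A X f] sub[OF B Z g] by (cases b) auto
    qed
  qed (use X Z f g in measurable)
qed

lemma (in prob_space) indep_rv_compose:
  assumes "indep_rv MX X MZ Z" "F \<in> measurable MX NX" "G \<in> measurable MZ NZ"
  shows "indep_rv NX (\<lambda>\<omega>. F (X \<omega>)) NZ (\<lambda>\<omega>. G (Z \<omega>))"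
  unfolding indep_rv_def
proof (intro conjI ballI)
  show "random_variable NX (\<lambda>\<omega>. F (X \<omega>))" "random_variable NZ (\<lambda>\<omega>. G (Z \<omega>))"
    using assms measurable_compose unfolding indep_rv_def by blast+
  fix f :: "_ \<Rightarrow> real" and g :: "_ \<Rightarrow> real"
  assume "f \<in> borel_measurable NX" "g \<in> borel_measurable NZ"
  then have m: "(\<lambda>x. f (F x)) \<in> borel_measurable MX" "(\<lambda>x. g (G x)) \<in> borel_measurable MZ"
    using assms measurable_compose by blast+
  have "\<forall>f\<in>borel_measurable MX. \<forall>g\<in>borel_measurable MZ.
      indep_var (borel :: real measure) (\<lambda>\<omega>. f (X \<omega>)) (borel :: real measure) (\<lambda>\<omega>. g (Z \<omega>))"
    using assms(1) by (simp add: indep_rv_def)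
  from bspec[OF bspec[OF this m(1)] m(2)]
  show "indep_var borel (\<lambda>\<omega>. f (F (X \<omega>))) borel (\<lambda>\<omega>. g (G (Z \<omega>)))" .
qed

lemma (in prob_space) indep_rv_of_indep_var:
  assumes "indep_var MX X MZ Z"
  shows "indep_rv MX X MZ Z"
  using assms indep_var_rv1[OF assms] indep_var_rv2[OF assms] indep_var_compose[OF assms, of _ borel _ borel]
  by (auto simp: indep_rv_def comp_def)

section \<open>Independence and moments in the observation model\<close>

context gaussian_linear_model
begin

abbreviation (input) stack :: "'w \<Rightarrow> nat + nat \<Rightarrow> real" where
  "stack \<omega> \<equiv> \<lambda>k\<in>{..<p} <+> {..<n}. case_sum (\<beta> \<omega>) (\<epsilon> \<omega>) k"

lemma indep_rv_beta_eps: "indep_rv (borel_PiM {..<p}) \<beta> (borel_PiM {..<n}) \<epsilon>"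
proof (rule indep_rvI[OF beta_rv eps_rv])
  let ?F = "\<lambda>k. [sets (vimage_algebra (space M) x (borel_PiM ({..<n} \<times> {..<p}))),
       sets (vimage_algebra (space M) \<beta> (borel_PiM {..<p})),
       sets (vimage_algebra (space M) \<epsilon> (borel_PiM {..<n}))] ! k"
  let ?I = "case_bool {1} {2 :: nat}"
  have "indep_sets (\<lambda>b. sigma_sets (space M) (\<Union>k\<in>?I b. ?F k)) UNIV"
  proof (rule indep_sets_collect_sigma)
    show "indep_sets ?F (\<Union>b\<in>UNIV. ?I b)"
      by (rule indep_sets_mono_index[OF _ indep]) (auto split: bool.split_asm)
    show "Int_stable (?F k)" if "k \<in> ?I b" for b k
      using that by (cases b) (auto intro: sets.Int_stable)
  qed (auto simp: disjoint_family_on_def split: bool.split)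
  also have "(\<lambda>b. sigma_sets (space M) (\<Union>k\<in>?I b. ?F k))
     = case_bool (sets (vimage_algebra (space M) \<beta> (borel_PiM {..<p}))) (sets (vimage_algebra (space M) \<epsilon> (borel_PiM {..<n})))"
    using sets.sigma_sets_eq[of "vimage_algebra (space M) \<beta> (borel_PiM {..<p})"]
      sets.sigma_sets_eq[of "vimage_algebra (space M) \<epsilon> (borel_PiM {..<n})"]
    by (auto simp: fun_eq_iff split: bool.split)
  finally show "indep_set (sets (vimage_algebra (space M) \<beta> (borel_PiM {..<p}))) (sets (vimage_algebra (space M) \<epsilon> (borel_PiM {..<n})))"
    by (simp add: indep_set_def)
qed (use sets.sigma_algebra_axioms[of "vimage_algebra (space M) \<beta> (borel_PiM {..<p})"]
  sets.sigma_algebra_axioms[of "vimage_algebra (space M) \<epsilon> (borel_PiM {..<n})"] in \<open>auto intro: in_vimage_algebra\<close>)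

text \<open>Joint independence is essential here: \<open>x\<close> must be independent of the pair
  (\<beta>, \<epsilon>). It comes from grouping the three algebras as {0} against {1, 2}.\<close>

lemma indep_rv_x_stack: "indep_rv (borel_PiM ({..<n} \<times> {..<p})) x (borel_PiM ({..<p} <+> {..<n})) stack"
proof -
  let ?Fx = "sets (vimage_algebra (space M) x (borel_PiM ({..<n} \<times> {..<p})))"
  let ?Fb = "sets (vimage_algebra (space M) \<beta> (borel_PiM {..<p}))"
  let ?Fe = "sets (vimage_algebra (space M) \<epsilon> (borel_PiM {..<n}))"
  let ?F = "\<lambda>k. [?Fx, ?Fb, ?Fe] ! k"
  let ?I = "case_bool {0} {1, 2 :: nat}"
  \<comment> \<open>The algebra generated by \<beta> and \<epsilon> together. The stacked vector is
    measurable with respect to it, since each of its coordinates is.\<close>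
  define N where "N = sigma (space M) (?Fb \<union> ?Fe)"
  have sub: "?Fb \<union> ?Fe \<subseteq> Pow (space M)"
    using sets.sets_into_space[of _ "vimage_algebra (space M) \<beta> (borel_PiM {..<p})"]
      sets.sets_into_space[of _ "vimage_algebra (space M) \<epsilon> (borel_PiM {..<n})"] by auto
  then have N: "space N = space M" "sets N = sigma_sets (space M) (?Fb \<union> ?Fe)" "?Fb \<union> ?Fe \<subseteq> sets N"
    by (auto simp: N_def space_measure_of_conv sets_measure_of)
  have "\<beta> \<in> measurable N (borel_PiM {..<p})"
    using N measurable_space[OF beta_rv] by (intro measurableI) (auto intro: in_vimage_algebra)
  moreover have "\<epsilon> \<in> measurable N (borel_PiM {..<n})"
    using N measurable_space[OF eps_rv] by (intro measurableI) (auto intro: in_vimage_algebra)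
  ultimately have coord: "(\<lambda>\<omega>. case_sum (\<beta> \<omega>) (\<epsilon> \<omega>) k) \<in> borel_measurable N" if "k \<in> {..<p} <+> {..<n}" for k
    using that by (auto intro: measurable_compose[OF _ measurable_component_singleton])
  have stackN: "stack \<in> measurable N (borel_PiM ({..<p} <+> {..<n}))"
    using coord by (intro measurable_restrict) auto
  have coordM: "(\<lambda>\<omega>. case_sum (\<beta> \<omega>) (\<epsilon> \<omega>) k) \<in> borel_measurable M" if "k \<in> {..<p} <+> {..<n}" for k
    using that beta_rv eps_rv by (auto intro: measurable_compose[OF _ measurable_component_singleton])
  have stackM: "random_variable (borel_PiM ({..<p} <+> {..<n})) stack"
    using coordM by (intro measurable_restrict) auto
  have "indep_sets (\<lambda>b. sigma_sets (space M) (\<Union>k\<in>?I b. ?F k)) UNIV"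
  proof (rule indep_sets_collect_sigma)
    show "indep_sets ?F (\<Union>b\<in>UNIV. ?I b)"
      by (rule indep_sets_mono_index[OF _ indep]) (auto split: bool.split_asm)
    show "Int_stable (?F k)" if "k \<in> ?I b" for b k
      using that by (cases b) (auto intro: sets.Int_stable)
  qed (auto simp: disjoint_family_on_def split: bool.split)
  also have "(\<lambda>b. sigma_sets (space M) (\<Union>k\<in>?I b. ?F k)) = case_bool ?Fx (sets N)"
    using sets.sigma_sets_eq[of "vimage_algebra (space M) x (borel_PiM ({..<n} \<times> {..<p}))"]
    by (auto simp: fun_eq_iff N split: bool.split)
  finally have ind: "indep_set ?Fx (sets N)" by (simp add: indep_set_def)
  show ?thesis
  proof (rule indep_rvI[OF x_rv stackM ind])
    show "sigma_algebra (space M) ?Fx"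
      using sets.sigma_algebra_axioms[of "vimage_algebra (space M) x (borel_PiM ({..<n} \<times> {..<p}))"] by simp
    show "sigma_algebra (space M) (sets N)" using sets.sigma_algebra_axioms[of N] N by simp
    show "stack -` S \<inter> space M \<in> sets N" if "S \<in> sets (borel_PiM ({..<p} <+> {..<n}))" for S
      using measurable_sets[OF stackN that] N by simp
  qed (auto intro: in_vimage_algebra)
qed

lemma isotropic_moments_eps: "isotropic_moments M {..<n} (\<lambda>i \<omega>. \<epsilon> \<omega> i)"
  using isotropic_moments_normal[of "{..<n}" 1 "\<lambda>i \<omega>. \<epsilon> \<omega> i"] eps_indep eps_entry by simp

text \<open>Rows occupy disjoint blocks of independent entries. The factor sqrt n rescales the
  entries to unit variance, as \<open>isotropic_moments\<close> requires.\<close>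

lemma indep_rv_row:
  assumes i: "i < n"
  shows "indep_rv (borel_PiM (({..<n} - {i}) \<times> {..<p})) (\<lambda>\<omega>. restrict (x \<omega>) (({..<n} - {i}) \<times> {..<p}))
    (borel_PiM {..<p}) (\<lambda>\<omega>. \<lambda>j\<in>{..<p}. sqrt (real n) * x \<omega> (i, j))"
proof -
  let ?A = "({..<n} - {i}) \<times> {..<p}" and ?B = "{i} \<times> {..<p}"
  have "indep_var (borel_PiM ?A) (\<lambda>\<omega>. restrict (x \<omega>) ?A) (borel_PiM ?B) (\<lambda>\<omega>. restrict (x \<omega>) ?B)"
    using indep_var_restrict[OF x_indep, of ?A ?B] i by auto
  note ind = indep_rv_of_indep_var[OF this]
  have "(\<lambda>b. \<lambda>j\<in>{..<p}. sqrt (real n) * b (i, j)) \<in> measurable (borel_PiM ?B) (borel_PiM {..<p})"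
    by (intro measurable_restrict borel_measurable_times borel_measurable_const measurable_component_singleton) auto
  from indep_rv_compose[OF ind measurable_ident this]
  have "indep_rv (borel_PiM ?A) (\<lambda>\<omega>. restrict (x \<omega>) ?A) (borel_PiM {..<p})
    (\<lambda>\<omega>. \<lambda>j\<in>{..<p}. sqrt (real n) * (restrict (x \<omega>) ?B) (i, j))"
    by simp
  moreover have "(\<lambda>\<omega>. \<lambda>j\<in>{..<p}. sqrt (real n) * (restrict (x \<omega>) ?B) (i, j)) = (\<lambda>\<omega>. \<lambda>j\<in>{..<p}. sqrt (real n) * x \<omega> (i, j))"
    by (auto simp: fun_eq_iff)
  ultimately show ?thesis by simp
qed

lemma isotropic_moments_row:
  assumes i: "i < n"
  shows "isotropic_moments M {..<p} (\<lambda>j \<omega>. sqrt (real n) * x \<omega> (i, j))"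
proof -
  have "indep_vars (\<lambda>_. borel) (\<lambda>k \<omega>. x \<omega> k) (Pair i ` {..<p})"
    using i by (intro indep_vars_subset[OF x_indep]) auto
  then have "isotropic_moments M (Pair i ` {..<p}) (\<lambda>k \<omega>. x \<omega> k / sqrt (1 / real n))"
    using x_entry[OF i] i by (intro isotropic_moments_normal) auto
  from isotropic_moments_reindex[OF this]
  show ?thesis by (simp add: real_sqrt_divide mult.commute inj_on_def)
qed

end

section \<open>Measurability and locality of the resolvent\<close>

lemma borel_measurable_dot [measurable (raw)]:
  assumes "\<And>j. j < p \<Longrightarrow> (\<lambda>w. u w j) \<in> borel_measurable N" "\<And>j. j < p \<Longrightarrow> (\<lambda>w. v w j) \<in> borel_measurable N"
  shows "(\<lambda>w. dot p (u w) (v w)) \<in> borel_measurable N"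
  unfolding dot_def using assms by (intro borel_measurable_sum borel_measurable_times) auto

text \<open>\<open>K\<close> has to contain only the listed rows, so the resolvent without row
  \<open>i\<close> is measurable in the remaining rows alone.\<close>

lemma borel_measurable_resolvent:
  assumes "set is \<times> {..<p} \<subseteq> K"
  shows "(\<lambda>x. resolvent \<Delta> p x is j k) \<in> borel_measurable (borel_PiM K)"
  using assms
proof (induction "is" arbitrary: j k)
  case (Cons i "is")
  then have [measurable]: "(\<lambda>x. resolvent \<Delta> p x is j k) \<in> borel_measurable (borel_PiM K)" for j k by auto
  have [measurable]: "(\<lambda>x. x (i, j)) \<in> borel_measurable (borel_PiM K)" if "j < p" for j
    using Cons.prems that by (intro measurable_component_singleton) auto
  show ?case unfolding resolvent.simps app_def by measurable
qed simp

text \<open>Makes the resolvent without row \<open>i\<close> a function of the restricted matrix,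
  which is the variable independent of that row.\<close>

lemma resolvent_cong:
  assumes "\<And>i j. i \<in> set is \<Longrightarrow> j < p \<Longrightarrow> x (i, j) = x' (i, j)"
  shows "resolvent \<Delta> p x is = resolvent \<Delta> p x' is"
  using assms
proof (induction "is")
  case (Cons i "is")
  then have IH: "resolvent \<Delta> p x is = resolvent \<Delta> p x' is" by simp
  have a: "app p R (mrow x i) = app p R (mrow x' i)" for R
    unfolding app_def using Cons.prems by (auto intro!: dot_cong)
  have d: "dot p (mrow x i) v = dot p (mrow x' i) v" for v
    using Cons.prems by (auto intro!: dot_cong)
  show ?case by (simp add: IH a d)
qed simp

section \<open>Concentration of the ridge estimator\<close>

text \<open>K^T K and K K^T have equal Frobenius norm: both squares are the same fourfold sum,
  summed in different orders. The quadratic form involves the former, while only the latter has a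
  closed form.\<close>

lemma gram_frobenius:
  fixes K :: "'j \<Rightarrow> 'i \<Rightarrow> real"
  shows "(\<Sum>a\<in>I. \<Sum>b\<in>I. (\<Sum>j\<in>J. K j a * K j b)\<^sup>2) = (\<Sum>j\<in>J. \<Sum>k\<in>J. (\<Sum>a\<in>I. K j a * K k a)\<^sup>2)"
proof -
  have "(\<Sum>a\<in>I. \<Sum>b\<in>I. (\<Sum>j\<in>J. K j a * K j b)\<^sup>2)
    = (\<Sum>a\<in>I. \<Sum>b\<in>I. \<Sum>j\<in>J. \<Sum>k\<in>J. K j a * K k a * (K j b * K k b))"
    by (simp add: power2_eq_square sum_product mult_ac)
  also have "\<dots> = (\<Sum>a\<in>I. \<Sum>j\<in>J. \<Sum>b\<in>I. \<Sum>k\<in>J. K j a * K k a * (K j b * K k b))"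
    by (intro sum.cong refl sum.swap)
  also have "\<dots> = (\<Sum>j\<in>J. \<Sum>a\<in>I. \<Sum>b\<in>I. \<Sum>k\<in>J. K j a * K k a * (K j b * K k b))"
    by (rule sum.swap)
  also have "\<dots> = (\<Sum>j\<in>J. \<Sum>a\<in>I. \<Sum>k\<in>J. \<Sum>b\<in>I. K j a * K k a * (K j b * K k b))"
    by (intro sum.cong refl sum.swap)
  also have "\<dots> = (\<Sum>j\<in>J. \<Sum>k\<in>J. \<Sum>a\<in>I. \<Sum>b\<in>I. K j a * K k a * (K j b * K k b))"
    by (intro sum.cong refl sum.swap)
  also have "\<dots> = (\<Sum>j\<in>J. \<Sum>k\<in>J. (\<Sum>a\<in>I. K j a * K k a)\<^sup>2)"
    by (simp only: power2_eq_square sum_product)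
  finally show ?thesis .
qed

text \<open>Substituting the model for y in R x^T y; the signal part R x^T x \<beta> becomes (1 -
  \<Delta> R) \<beta> by the defining equation of the inverse.\<close>

lemma ridge_eq_ridge_map:
  fixes \<Delta> p n x b e
  assumes \<Delta>: "\<Delta> > 0" and j: "j < p"
  defines "y \<equiv> (\<lambda>i\<in>{..<n}. mat_vec n p x b i + sqrt \<Delta> * e i)"
  shows "ridge \<Delta> n p x y j
    = (\<Sum>a\<in>{..<p} <+> {..<n}. ridge_map \<Delta> p x (resolvent \<Delta> p x [0..<n]) j a * case_sum b e a)"
proof -
  let ?R = "resolvent \<Delta> p x [0..<n]"
  have R: "ridge_inverse \<Delta> p x {..<n} ?R"
    using ridge_inverse_resolvent[OF \<Delta>, of "[0..<n]" p x] by (simp add: atLeast0LessThan)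
  have B: "of_bool (j = l) - \<Delta> * ?R j l = (\<Sum>i<n. app p ?R (mrow x i) j * x (i, l))" if "l < p" for l
  proof -
    have "of_bool (j = l) - \<Delta> * ?R l j = (\<Sum>i<n. x (i, l) * app p ?R (mrow x i) j)"
      using ridge_inverse_eq[OF R that j] by auto
    then show ?thesis by (simp only: ridge_inverse_sym[OF R, of l j] mult.commute)
  qed
  have "ridge \<Delta> n p x y j = dot p (?R j) (\<lambda>l. \<Sum>i<n. y i * x (i, l))"
    using j by (simp add: ridge_def app_def)
  also have "\<dots> = (\<Sum>i<n. y i * app p ?R (mrow x i) j)"
    by (simp add: dot_sum_right dot_scale_right app_def)
  also have "\<dots> = (\<Sum>i<n. (\<Sum>l<p. app p ?R (mrow x i) j * x (i, l) * b l) + sqrt \<Delta> * app p ?R (mrow x i) j * e i)"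
    by (intro sum.cong) (auto simp: y_def mat_vec_def distrib_left distrib_right sum_distrib_left sum_distrib_right mult_ac)
  also have "\<dots> = (\<Sum>l<p. \<Sum>i<n. app p ?R (mrow x i) j * x (i, l) * b l) + (\<Sum>i<n. sqrt \<Delta> * app p ?R (mrow x i) j * e i)"
    unfolding sum.distrib by (subst sum.swap) simp
  also have "(\<Sum>l<p. \<Sum>i<n. app p ?R (mrow x i) j * x (i, l) * b l) = (\<Sum>l<p. (of_bool (j = l) - \<Delta> * ?R j l) * b l)"
    using B by (intro sum.cong) (simp_all add: sum_distrib_right)
  finally show ?thesis
    by (subst sum.Plus) (simp_all add: ridge_map_def)
qed

context gaussian_linear_model
begin

lemma isotropic_moments_stack:
  assumes "1 \<le> p"
  shows "isotropic_moments M ({..<p} <+> {..<n}) (\<lambda>k \<omega>. case_sum (\<beta> \<omega>) (\<epsilon> \<omega>) k)"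
proof (rule isotropic_moments_Plus[OF indep_rv_beta_eps _ isotropic_moments_eps])
  show "isotropic_moments M {..<p} (\<lambda>j \<omega>. \<beta> \<omega> j)"
    using isotropic_moments_sphere_uniform[OF assms] by (intro isotropic_moments_distr[OF beta_rv]) (simp add: beta_law)
qed

abbreviation (input) res :: "'w \<Rightarrow> nat \<Rightarrow> nat \<Rightarrow> real" where
  "res \<omega> \<equiv> resolvent \<Delta> p (x \<omega>) [0..<n]"

text \<open>
  The ridge estimator is \<open>K z\<close> for the stacked vector \<open>z\<close> and a matrix \<open>K\<close> with
  \<open>K K\<^sup>T = 1 - \<Delta> R\<close>, which gives both the trace and the Frobenius norm of \<open>K\<^sup>T K\<close>.
\<close>

lemma ridge_norm_concentration:
  assumes \<Delta>: "\<Delta> > 0" and p: "1 \<le> p"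
  defines "W \<equiv> \<lambda>\<omega>. (L2_set (ridge \<Delta> n p (x \<omega>) (y \<omega>)) {..<p})\<^sup>2 - (real p - \<Delta> * tr p (res \<omega>))"
  shows "integrable M W" "expectation (\<lambda>\<omega>. \<bar>W \<omega>\<bar>) \<le> 2 * sqrt (real p)"
proof -
  let ?I = "{..<p} <+> {..<n}" and ?K = "{..<n} \<times> {..<p}"
  define z where "z = (\<lambda>k \<omega>. case_sum (\<beta> \<omega>) (\<epsilon> \<omega>) k)"
  define G where "G u = resolvent \<Delta> p u [0..<n]" for u :: "nat \<times> nat \<Rightarrow> real"
  define K where "K u = ridge_map \<Delta> p u (G u)" for u :: "nat \<times> nat \<Rightarrow> real"
  define A where "A u a b = (\<Sum>j<p. K u j a * K u j b)" for u a b
  have R: "ridge_inverse \<Delta> p u {..<n} (G u)" for u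
    using ridge_inverse_resolvent[OF \<Delta>, of "[0..<n]" p u] by (simp add: atLeast0LessThan G_def)
  have gram: "(\<Sum>a\<in>?I. K u j a * K u k a) = of_bool (j = k) - \<Delta> * G u j k" if "j < p" "k < p" for u j k
    unfolding K_def using ridge_map_gram[OF R _ that \<Delta>] by simp
  \<comment> \<open>After passing to K K^T, each of the p columns of 1 - \<Delta> R contributes at
    most 1.\<close>
  have frob: "(\<Sum>a\<in>?I. \<Sum>b\<in>?I. (A u a b)\<^sup>2) \<le> real p" for u
  proof -
    have "(\<Sum>a\<in>?I. \<Sum>b\<in>?I. (A u a b)\<^sup>2) = (\<Sum>j<p. \<Sum>k<p. (\<Sum>a\<in>?I. K u j a * K u k a)\<^sup>2)"
      unfolding A_def by (rule gram_frobenius)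
    also have "\<dots> = (\<Sum>j<p. \<Sum>k<p. (of_bool (j = k) - \<Delta> * G u j k)\<^sup>2)"
      by (intro sum.cong refl arg_cong[where f = "\<lambda>a. a\<^sup>2"] gram) auto
    also have "\<dots> = (\<Sum>k<p. \<Sum>j<p. (of_bool (j = k) - \<Delta> * G u j k)\<^sup>2)"
      by (rule sum.swap)
    also have "\<dots> \<le> (\<Sum>k<p. 1)"
      by (intro sum_mono ridge_map_frobenius[OF R _ \<Delta>]) auto
    finally show ?thesis by simp
  qed
  have trA: "(\<Sum>a\<in>?I. A u a a) = real p - \<Delta> * tr p (G u)" for u
  proof -
    have "(\<Sum>a\<in>?I. A u a a) = (\<Sum>j<p. \<Sum>a\<in>?I. K u j a * K u j a)" unfolding A_def by (rule sum.swap)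
    also have "\<dots> = (\<Sum>j<p. 1 - \<Delta> * G u j j)" by (intro sum.cong) (auto simp: gram)
    also have "\<dots> = real p - \<Delta> * tr p (G u)" by (simp add: sum_subtractf tr_def sum_distrib_left)
    finally show ?thesis .
  qed
  have meas_G[measurable]: "(\<lambda>u. G u j k) \<in> borel_measurable (borel_PiM ?K)" for j k
    unfolding G_def by (intro borel_measurable_resolvent) auto
  have [measurable]: "(\<lambda>u. u (i, j)) \<in> borel_measurable (borel_PiM ?K)" if "i < n" "j < p" for i j
    using that by (intro measurable_component_singleton) auto
  have meas_K[measurable]: "(\<lambda>u. K u j a) \<in> borel_measurable (borel_PiM ?K)" if "a \<in> ?I" for j a
    using that unfolding K_def ridge_map_def app_def by (elim PlusE; simp) measurable
  have meas_A: "(\<lambda>u. A u a b) \<in> borel_measurable (borel_PiM ?K)" if "a \<in> ?I" "b \<in> ?I" for a b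
    unfolding A_def using that by measurable
  have ridge: "ridge \<Delta> n p (x \<omega>) (y \<omega>) j = (\<Sum>a\<in>?I. K (x \<omega>) j a * z a \<omega>)" if "\<omega> \<in> space M" "j < p" for \<omega> j
    unfolding K_def G_def z_def y_eq[OF that(1)] by (rule ridge_eq_ridge_map[OF \<Delta> that(2)])
  define W' where "W' \<omega> = (\<Sum>a\<in>?I. \<Sum>b\<in>?I. A (x \<omega>) a b * z a \<omega> * z b \<omega>) - (\<Sum>a\<in>?I. A (x \<omega>) a a)" for \<omega>
  have W: "W \<omega> = W' \<omega>" if "\<omega> \<in> space M" for \<omega>
  proof -
    have "(L2_set (ridge \<Delta> n p (x \<omega>) (y \<omega>)) {..<p})\<^sup>2 = (\<Sum>j<p. (\<Sum>a\<in>?I. K (x \<omega>) j a * z a \<omega>)\<^sup>2)"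
      using ridge[OF that] by (simp add: L2_set_def sum_nonneg)
    also have "\<dots> = (\<Sum>j<p. \<Sum>a\<in>?I. \<Sum>b\<in>?I. K (x \<omega>) j a * K (x \<omega>) j b * z a \<omega> * z b \<omega>)"
      by (simp add: power2_eq_square sum_product mult_ac)
    also have "\<dots> = (\<Sum>a\<in>?I. \<Sum>j<p. \<Sum>b\<in>?I. K (x \<omega>) j a * K (x \<omega>) j b * z a \<omega> * z b \<omega>)"
      by (rule sum.swap)
    also have "\<dots> = (\<Sum>a\<in>?I. \<Sum>b\<in>?I. A (x \<omega>) a b * z a \<omega> * z b \<omega>)"
      unfolding A_def sum_distrib_right by (intro sum.cong refl sum.swap)
    finally show ?thesis unfolding W_def W'_def trA by (simp add: G_def)
  qed
  have ind: "indep_rv (borel_PiM ?K) x (borel_PiM ?I) (\<lambda>\<omega>. \<lambda>k\<in>?I. z k \<omega>)"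
    using indep_rv_x_stack by (simp add: z_def)
  have iso: "isotropic_moments M ?I z" using isotropic_moments_stack[OF p] by (simp add: z_def)
  have sym: "A u a b = A u b a" for u a b by (simp add: A_def mult.commute)
  have diag: "0 \<le> A u a a" for u a by (simp add: A_def sum_nonneg)
  note v = quadratic_form_variance[OF ind iso meas_A sym diag frob, folded W'_def]
  have i: "integrable M W'" "expectation (\<lambda>\<omega>. \<bar>W' \<omega>\<bar>) \<le> sqrt (4 * real p)"
    using v by (auto intro!: expectation_abs_le_sqrt)
  show "integrable M W" using i(1) by (simp add: W cong: Bochner_Integration.integrable_cong)
  have "expectation (\<lambda>\<omega>. \<bar>W \<omega>\<bar>) = expectation (\<lambda>\<omega>. \<bar>W' \<omega>\<bar>)"
    by (intro Bochner_Integration.integral_cong) (auto simp: W)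
  then show "expectation (\<lambda>\<omega>. \<bar>W \<omega>\<bar>) \<le> 2 * sqrt (real p)" using i(2) by (simp add: real_sqrt_mult)
qed

text \<open>Row i is z / sqrt n for an isotropic z independent of the other rows, hence of the
  resolvent built from them. The quadratic form thus has matrix R/n, trace tr R / n and squared
  Frobenius norm at most p / (\<Delta> n)^2.\<close>

lemma leave_one_out_concentration:
  assumes \<Delta>: "\<Delta> > 0" and i: "i < n"
  defines "R \<equiv> \<lambda>\<omega>. resolvent \<Delta> p (x \<omega>) (remove1 i [0..<n])"
  defines "W \<equiv> \<lambda>\<omega>. dot p (mrow (x \<omega>) i) (app p (R \<omega>) (mrow (x \<omega>) i)) - tr p (R \<omega>) / real n"
  shows "integrable M W" "expectation (\<lambda>\<omega>. \<bar>W \<omega>\<bar>) \<le> 2 * sqrt (real p) / (\<Delta> * real n)"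
proof -
  let ?K = "({..<n} - {i}) \<times> {..<p}" and ?is = "remove1 i [0..<n]"
  define z where "z = (\<lambda>j \<omega>. sqrt (real n) * x \<omega> (i, j))"
  define A where "A u j k = resolvent \<Delta> p u ?is j k / real n" for u :: "nat \<times> nat \<Rightarrow> real" and j k
  have set: "set ?is = {..<n} - {i}" by (auto simp: set_remove1_eq)
  have Ru: "ridge_inverse \<Delta> p u ({..<n} - {i}) (resolvent \<Delta> p u ?is)" for u
    using ridge_inverse_resolvent[OF \<Delta>, of ?is p u] by (simp add: set)
  have n: "0 < real n" using i by simp
  have frob: "(\<Sum>j<p. \<Sum>k<p. (A u j k)\<^sup>2) \<le> real p / (\<Delta> * real n)\<^sup>2" for u
  proof -
    have "(\<Sum>j<p. \<Sum>k<p. (A u j k)\<^sup>2) = (\<Sum>j<p. dot p (resolvent \<Delta> p u ?is j) (resolvent \<Delta> p u ?is j)) / (real n)\<^sup>2"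
      by (simp add: A_def dot_def power_divide sum_divide_distrib power2_eq_square)
    also have "\<dots> \<le> (\<Sum>j<p. 1 / \<Delta>\<^sup>2) / (real n)\<^sup>2"
      using ridge_inverse_column_bounds(3)[OF Ru _ \<Delta>] by (intro divide_right_mono sum_mono) auto
    finally show ?thesis by (simp add: power_mult_distrib)
  qed
  have res: "resolvent \<Delta> p (restrict (x \<omega>) ?K) ?is = R \<omega>" for \<omega>
    unfolding R_def by (rule resolvent_cong) (auto simp: set)
  define W' where "W' \<omega> = (\<Sum>j<p. \<Sum>k<p. A (restrict (x \<omega>) ?K) j k * z j \<omega> * z k \<omega>) - (\<Sum>j<p. A (restrict (x \<omega>) ?K) j j)" for \<omega>
  have W: "W = W'"
  proof
    fix \<omega>
    have "dot p (mrow (x \<omega>) i) (app p (R \<omega>) (mrow (x \<omega>) i)) = (\<Sum>j<p. \<Sum>k<p. A (restrict (x \<omega>) ?K) j k * z j \<omega> * z k \<omega>)"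
      unfolding dot_def app_def sum_distrib_left
    proof (intro sum.cong refl)
      fix j k
      have "z j \<omega> * z k \<omega> = (sqrt (real n) * sqrt (real n)) * (x \<omega> (i, j) * x \<omega> (i, k))"
        by (simp only: z_def mult_ac)
      then have "A (restrict (x \<omega>) ?K) j k * (z j \<omega> * z k \<omega>) = R \<omega> j k * (x \<omega> (i, j) * x \<omega> (i, k))"
        using n by (simp add: A_def res)
      then show "x \<omega> (i, j) * (R \<omega> j k * x \<omega> (i, k)) = A (restrict (x \<omega>) ?K) j k * z j \<omega> * z k \<omega>"
        by (simp add: mult_ac)
    qed
    then show "W \<omega> = W' \<omega>" by (simp add: W_def W'_def tr_def A_def res sum_divide_distrib)
  qed
  have meas: "(\<lambda>u. A u j k) \<in> borel_measurable (borel_PiM ?K)" for j k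
    unfolding A_def using set by (intro borel_measurable_divide borel_measurable_resolvent borel_measurable_const) auto
  have sym: "A u j k = A u k j" for u j k using ridge_inverse_sym[OF Ru] by (simp add: A_def)
  have diag: "0 \<le> A u j j" if "j \<in> {..<p}" for u j
    using ridge_inverse_column_bounds(1)[OF Ru _ \<Delta>] that by (simp add: A_def)
  have iso: "isotropic_moments M {..<p} z" unfolding z_def by (rule isotropic_moments_row[OF i])
  have ind: "indep_rv (borel_PiM ?K) (\<lambda>\<omega>. restrict (x \<omega>) ?K) (borel_PiM {..<p}) (\<lambda>\<omega>. \<lambda>j\<in>{..<p}. z j \<omega>)"
    unfolding z_def by (rule indep_rv_row[OF i])
  note v = quadratic_form_variance[OF ind iso meas sym diag frob, folded W'_def]
  have "expectation (\<lambda>\<omega>. \<bar>W' \<omega>\<bar>) \<le> sqrt (4 * (real p / (\<Delta> * real n)\<^sup>2))"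
    by (rule expectation_abs_le_sqrt[OF v])
  also have "\<dots> = 2 * sqrt (real p) / (\<Delta> * real n)"
    using \<Delta> n by (simp add: real_sqrt_mult real_sqrt_divide)
  finally show "expectation (\<lambda>\<omega>. \<bar>W \<omega>\<bar>) \<le> 2 * sqrt (real p) / (\<Delta> * real n)" by (simp add: W)
  show "integrable M W" using v(1) by (simp add: W)
qed

text \<open>The finite-size form of the Marchenko--Pastur fixed point equation for \<open>tr R / n\<close>.\<close>

lemma trace_fixed_point:
  assumes \<Delta>: "\<Delta> > 0" and n: "1 \<le> n"
  defines "\<tau> \<equiv> \<lambda>\<omega>. tr p (res \<omega>) / real n"
  shows "\<exists>V. integrable M V \<and> expectation V \<le> 2 * sqrt (real p) / (\<Delta> * real n) + 1 / (\<Delta> * real n) \<and>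
    (\<forall>\<omega>. 0 \<le> \<tau> \<omega> \<and> \<bar>\<Delta> * \<tau> \<omega> + \<tau> \<omega> / (1 + \<tau> \<omega>) - real p / real n\<bar> \<le> V \<omega>)"
proof -
  define R where "R i \<omega> = resolvent \<Delta> p (x \<omega>) (remove1 i [0..<n])" for i \<omega>
  define t where "t i \<omega> = dot p (mrow (x \<omega>) i) (app p (R i \<omega>) (mrow (x \<omega>) i))" for i \<omega>
  define W where "W i \<omega> = t i \<omega> - tr p (R i \<omega>) / real n" for i \<omega>
  \<comment> \<open>The terms \<open>W i\<close> compare each form with the trace after deletion of
    its row; 1/(\<Delta> n) pays for the change of the normalized trace when the row is
    restored.\<close>
  define V where "V \<omega> = (\<Sum>i<n. \<bar>W i \<omega>\<bar>) / real n + 1 / (\<Delta> * real n)" for \<omega>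
  have W: "integrable M (W i)" "expectation (\<lambda>\<omega>. \<bar>W i \<omega>\<bar>) \<le> 2 * sqrt (real p) / (\<Delta> * real n)" if "i < n" for i
    using leave_one_out_concentration[OF \<Delta> that] unfolding W_def[abs_def] t_def R_def by auto
  have n0: "0 < real n" using n by simp
  have sum_int: "integrable M (\<lambda>\<omega>. \<Sum>i<n. \<bar>W i \<omega>\<bar>)" using W(1) by (intro Bochner_Integration.integrable_sum) auto
  have V_int: "integrable M V" unfolding V_def[abs_def] using sum_int by auto
  have "expectation V = (\<Sum>i<n. expectation (\<lambda>\<omega>. \<bar>W i \<omega>\<bar>)) / real n + 1 / (\<Delta> * real n)"
    unfolding V_def[abs_def] using W(1) sum_int by (simp add: prob_space)
  also have "\<dots> \<le> (\<Sum>i<n. 2 * sqrt (real p) / (\<Delta> * real n)) / real n + 1 / (\<Delta> * real n)"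
    using W(2) by (intro add_right_mono divide_right_mono sum_mono) auto
  also have "\<dots> = 2 * sqrt (real p) / (\<Delta> * real n) + 1 / (\<Delta> * real n)" using n0 by simp
  finally have V_exp: "expectation V \<le> 2 * sqrt (real p) / (\<Delta> * real n) + 1 / (\<Delta> * real n)" .
  have inv: "ridge_inverse \<Delta> p u {..<n} (resolvent \<Delta> p u [0..<n])" for u
    using ridge_inverse_resolvent[OF \<Delta>, of "[0..<n]" p u] by (simp add: atLeast0LessThan)
  have \<tau>0: "0 \<le> \<tau> \<omega>" for \<omega>
    unfolding \<tau>_def using tr_ridge_inverse_nonneg[OF inv \<Delta>] by simp
  have "\<bar>\<Delta> * \<tau> \<omega> + \<tau> \<omega> / (1 + \<tau> \<omega>) - real p / real n\<bar> \<le> V \<omega>" for \<omega>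
  proof -
    let ?u = "x \<omega>"
    have loo: "0 \<le> t i \<omega>" "dot p (mrow ?u i) (app p (res \<omega>) (mrow ?u i)) = t i \<omega> / (1 + t i \<omega>)"
      "\<bar>tr p (R i \<omega>) - tr p (res \<omega>)\<bar> \<le> 1 / \<Delta>" if i: "i < n" for i
    proof -
      let ?is = "remove1 i [0..<n]"
      \<comment> \<open>Listing row \<open>i\<close> first makes it the row added last, so that the
        leave-one-out identities apply.\<close>
      have d: "distinct (i # ?is)" "set [0..<n] = set (i # ?is)" using i by (auto simp: set_remove1_eq)
      have e: "res \<omega> j k = resolvent \<Delta> p ?u (i # ?is) j k" if "j < p" "k < p" for j k
        by (rule resolvent_cong_set[OF \<Delta> _ d that]) simp
      note l = leave_one_out[OF \<Delta> d(1), where p = p and x = ?u]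
      show "0 \<le> t i \<omega>" using l(1) by (simp add: t_def R_def)
      have "dot p (mrow ?u i) (app p (res \<omega>) (mrow ?u i))
        = dot p (mrow ?u i) (app p (resolvent \<Delta> p ?u (i # ?is)) (mrow ?u i))"
        unfolding app_def using e by (intro dot_cong refl) auto
      also have "\<dots> = t i \<omega> / (1 + t i \<omega>)" using l(2) by (simp only: t_def R_def)
      finally show "dot p (mrow ?u i) (app p (res \<omega>) (mrow ?u i)) = t i \<omega> / (1 + t i \<omega>)" .
      have "tr p (res \<omega>) = tr p (resolvent \<Delta> p ?u (i # ?is))"
        unfolding tr_def using e by (intro sum.cong) auto
      then show "\<bar>tr p (R i \<omega>) - tr p (res \<omega>)\<bar> \<le> 1 / \<Delta>" using l(3) by (simp only: R_def)
    qed
    \<comment> \<open>The map t / (1 + t) has Lipschitz constant 1 on the nonnegative reals.\<close>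
    have lip: "\<bar>\<tau> \<omega> / (1 + \<tau> \<omega>) - t i \<omega> / (1 + t i \<omega>)\<bar> \<le> \<bar>W i \<omega>\<bar> + 1 / (\<Delta> * real n)" if i: "i < n" for i
    proof -
      have "\<tau> \<omega> / (1 + \<tau> \<omega>) - t i \<omega> / (1 + t i \<omega>) = (\<tau> \<omega> - t i \<omega>) / ((1 + \<tau> \<omega>) * (1 + t i \<omega>))"
        using \<tau>0[of \<omega>] loo(1)[OF i] by (simp add: divide_simps) (simp add: algebra_simps)
      also have "\<bar>\<dots>\<bar> = \<bar>\<tau> \<omega> - t i \<omega>\<bar> / ((1 + \<tau> \<omega>) * (1 + t i \<omega>))"
        using \<tau>0[of \<omega>] loo(1)[OF i] by (simp add: abs_divide abs_mult)
      also have "\<dots> \<le> \<bar>\<tau> \<omega> - t i \<omega>\<bar> / 1"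
        using \<tau>0[of \<omega>] loo(1)[OF i] mult_mono[of 1 "1 + \<tau> \<omega>" 1 "1 + t i \<omega>"]
        by (intro divide_left_mono) auto
      also have "\<dots> = \<bar>(tr p (res \<omega>) - tr p (R i \<omega>)) / real n - W i \<omega>\<bar>"
        by (simp add: \<tau>_def W_def diff_divide_distrib)
      also have "\<dots> \<le> \<bar>(tr p (res \<omega>) - tr p (R i \<omega>)) / real n\<bar> + \<bar>W i \<omega>\<bar>" by (rule abs_triangle_ineq4)
      also have "\<bar>(tr p (res \<omega>) - tr p (R i \<omega>)) / real n\<bar> \<le> (1 / \<Delta>) / real n"
        using loo(3)[OF i] n0 by (simp only: abs_divide abs_minus_commute abs_of_pos) (rule divide_right_mono, simp_all)
      finally show ?thesis by simp
    qed
    \<comment> \<open>The trace identity is the exact equation behind the fixed point: divided by n,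
      it becomes the equation for \<tau> once each \<open>t i\<close> is replaced by \<tau>.\<close>
    have "\<Delta> * tr p (res \<omega>) + (\<Sum>i<n. t i \<omega> / (1 + t i \<omega>)) = real p"
      using ridge_inverse_trace[OF inv[of ?u]] loo(2) by simp
    then have "real p / real n = (\<Delta> * tr p (res \<omega>) + (\<Sum>i<n. t i \<omega> / (1 + t i \<omega>))) / real n" by simp
    then have "\<Delta> * \<tau> \<omega> + \<tau> \<omega> / (1 + \<tau> \<omega>) - real p / real n
      = (\<Sum>i<n. \<tau> \<omega> / (1 + \<tau> \<omega>) - t i \<omega> / (1 + t i \<omega>)) / real n"
      using n0 by (simp add: \<tau>_def sum_subtractf add_divide_distrib diff_divide_distrib)
    also have "\<bar>\<dots>\<bar> \<le> (\<Sum>i<n. \<bar>\<tau> \<omega> / (1 + \<tau> \<omega>) - t i \<omega> / (1 + t i \<omega>)\<bar>) / real n"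
      using n0 by (simp add: divide_right_mono)
    also have "\<dots> \<le> (\<Sum>i<n. \<bar>W i \<omega>\<bar> + 1 / (\<Delta> * real n)) / real n"
      using lip by (intro divide_right_mono sum_mono) auto
    also have "\<dots> = V \<omega>" using n0 by (simp add: V_def sum.distrib add_divide_distrib)
    finally show ?thesis .
  qed
  then show ?thesis using V_int V_exp \<tau>0 by blast
qed

text \<open>With \<rho> = n/p the overlap is 1 - \<Delta> \<rho> \<tau> + W/p. The bound collects
  the fluctuation W/p (first term), the fixed point error (next two), the mismatch of p/n and
  1/\<alpha> in the equation (fourth), and the replacement of \<rho> by \<alpha> in the limit
  (last).\<close>

lemma ridge_overlap_error:
  assumes \<Delta>: "\<Delta> > 0" and \<alpha>: "\<alpha> > 0" and p: "1 \<le> p" and n: "1 \<le> n"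
    and \<sigma>: "0 \<le> \<sigma>" "\<Delta> * \<sigma> + \<sigma> / (1 + \<sigma>) = 1 / \<alpha>"
  shows "\<exists>V. integrable M V \<and>
    expectation V \<le> 2 / sqrt (real p) + 2 / (\<Delta> * sqrt (real p)) + 1 / (\<Delta> * real p)
      + \<bar>1 - (real n / real p) / \<alpha>\<bar> + \<Delta> * \<sigma> * \<bar>real n / real p - \<alpha>\<bar> \<and>
    (\<forall>\<omega>. \<bar>sq_overlap p (ridge \<Delta> n p (x \<omega>) (y \<omega>)) - (1 - \<Delta> * \<alpha> * \<sigma>)\<bar> \<le> V \<omega>)"
proof -
  define W where "W \<omega> = (L2_set (ridge \<Delta> n p (x \<omega>) (y \<omega>)) {..<p})\<^sup>2 - (real p - \<Delta> * tr p (res \<omega>))" for \<omega>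
  define \<tau> where "\<tau> \<omega> = tr p (res \<omega>) / real n" for \<omega>
  have W: "integrable M W" "expectation (\<lambda>\<omega>. \<bar>W \<omega>\<bar>) \<le> 2 * sqrt (real p)"
    using ridge_norm_concentration[OF \<Delta> p] unfolding W_def[abs_def] by auto
  obtain V where V: "integrable M V" "expectation V \<le> 2 * sqrt (real p) / (\<Delta> * real n) + 1 / (\<Delta> * real n)"
    and \<tau>: "\<And>\<omega>. 0 \<le> \<tau> \<omega>" "\<And>\<omega>. \<bar>\<Delta> * \<tau> \<omega> + \<tau> \<omega> / (1 + \<tau> \<omega>) - real p / real n\<bar> \<le> V \<omega>"
    using trace_fixed_point[OF \<Delta> n] unfolding \<tau>_def[abs_def] by blast
  define \<rho> where "\<rho> = real n / real p"
  have p0: "0 < real p" and n0: "0 < real n" and \<rho>: "0 < \<rho>" using p n by (auto simp: \<rho>_def)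
  define E where "E = \<bar>1 - \<rho> / \<alpha>\<bar> + \<Delta> * \<sigma> * \<bar>\<rho> - \<alpha>\<bar>"
  define U where "U \<omega> = \<bar>W \<omega>\<bar> / real p + \<rho> * V \<omega> + E" for \<omega>
  have U_int: "integrable M U" unfolding U_def[abs_def] using W(1) V(1) by auto
  have "expectation U = expectation (\<lambda>\<omega>. \<bar>W \<omega>\<bar>) / real p + \<rho> * expectation V + E"
    unfolding U_def[abs_def] using W(1) V(1) by (simp add: prob_space)
  also have "\<dots> \<le> 2 * sqrt (real p) / real p + \<rho> * (2 * sqrt (real p) / (\<Delta> * real n) + 1 / (\<Delta> * real n)) + E"
    using W(2) V(2) p0 \<rho> by (intro add_mono divide_right_mono mult_left_mono) auto
  also have "2 * sqrt (real p) / real p = 2 / sqrt (real p)"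
    using p0 by (simp add: field_simps)
  also have "\<rho> * (2 * sqrt (real p) / (\<Delta> * real n) + 1 / (\<Delta> * real n)) = (2 * sqrt (real p) / real p) / \<Delta> + 1 / (\<Delta> * real p)"
    using p0 n0 \<Delta> by (simp add: \<rho>_def field_simps)
  also have "2 * sqrt (real p) / real p = 2 / sqrt (real p)"
    using p0 by (simp add: field_simps)
  finally have U_exp: "expectation U \<le> 2 / sqrt (real p) + 2 / (\<Delta> * sqrt (real p)) + 1 / (\<Delta> * real p) + E"
    by (simp add: mult.commute)
  have "\<bar>sq_overlap p (ridge \<Delta> n p (x \<omega>) (y \<omega>)) - (1 - \<Delta> * \<alpha> * \<sigma>)\<bar> \<le> U \<omega>" for \<omega>
  proof -
    have q: "sq_overlap p (ridge \<Delta> n p (x \<omega>) (y \<omega>)) = W \<omega> / real p + 1 - \<Delta> * \<rho> * \<tau> \<omega>"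
      using p0 n0 by (simp add: sq_overlap_def W_def \<tau>_def \<rho>_def field_simps)
    \<comment> \<open>Stability of the equation: the fraction is increasing, so the left-hand side
      separates two nonnegative points at least as much as the linear term \<Delta> does.\<close>
    have slope: "\<Delta> * \<bar>\<tau> \<omega> - \<sigma>\<bar> \<le> \<bar>(\<Delta> * \<tau> \<omega> + \<tau> \<omega> / (1 + \<tau> \<omega>)) - (\<Delta> * \<sigma> + \<sigma> / (1 + \<sigma>))\<bar>"
    proof -
      have mono: "a / (1 + a) \<le> b / (1 + b)" if "0 \<le> a" "a \<le> b" for a b :: real
        using that by (simp add: divide_simps) (simp add: algebra_simps)
      show ?thesis
      proof (cases "\<sigma> \<le> \<tau> \<omega>")
        case True
        from mono[OF \<sigma>(1) this] True \<Delta> show ?thesis by (simp add: right_diff_distrib)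
      next
        case False
        then have "\<tau> \<omega> \<le> \<sigma>" by simp
        from mono[OF \<tau>(1) this] this \<Delta> show ?thesis by (simp add: right_diff_distrib abs_if)
      qed
    qed
    also have "\<dots> \<le> V \<omega> + \<bar>real p / real n - 1 / \<alpha>\<bar>"
      unfolding \<sigma>(2) using \<tau>(2)[of \<omega>] by linarith
    finally have "\<rho> * (\<Delta> * \<bar>\<tau> \<omega> - \<sigma>\<bar>) \<le> \<rho> * (V \<omega> + \<bar>real p / real n - 1 / \<alpha>\<bar>)"
      using \<rho> by (intro mult_left_mono) auto
    also have "\<dots> = \<rho> * V \<omega> + \<bar>\<rho> * (real p / real n - 1 / \<alpha>)\<bar>"
      using \<rho> by (simp add: distrib_left abs_mult)
    also have "\<rho> * (real p / real n - 1 / \<alpha>) = 1 - \<rho> / \<alpha>"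
      using p0 n0 by (simp add: \<rho>_def right_diff_distrib)
    finally have 1: "\<rho> * (\<Delta> * \<bar>\<tau> \<omega> - \<sigma>\<bar>) \<le> \<rho> * V \<omega> + \<bar>1 - \<rho> / \<alpha>\<bar>" .
    have "\<bar>sq_overlap p (ridge \<Delta> n p (x \<omega>) (y \<omega>)) - (1 - \<Delta> * \<alpha> * \<sigma>)\<bar>
      = \<bar>W \<omega> / real p - \<rho> * (\<Delta> * (\<tau> \<omega> - \<sigma>)) - \<Delta> * \<sigma> * (\<rho> - \<alpha>)\<bar>"
      unfolding q by (simp add: algebra_simps)
    also have "\<dots> \<le> \<bar>W \<omega> / real p\<bar> + \<bar>\<rho> * (\<Delta> * (\<tau> \<omega> - \<sigma>))\<bar> + \<bar>\<Delta> * \<sigma> * (\<rho> - \<alpha>)\<bar>" by linarith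
    also have "\<dots> = \<bar>W \<omega>\<bar> / real p + \<rho> * (\<Delta> * \<bar>\<tau> \<omega> - \<sigma>\<bar>) + \<Delta> * \<sigma> * \<bar>\<rho> - \<alpha>\<bar>"
      using p0 \<rho> \<Delta> \<sigma>(1) by (simp add: abs_mult)
    also have "\<dots> \<le> U \<omega>" using 1 by (simp add: U_def E_def)
    finally show ?thesis .
  qed
  then show ?thesis using U_int U_exp unfolding E_def \<rho>_def by (intro exI[of _ U]) auto
qed

end

section \<open>The limiting fixed point and convergence in probability\<close>

lemma fixed_point_exists:
  fixes \<alpha> \<Delta> :: real
  assumes "\<alpha> > 0" "\<Delta> > 0"
  shows "\<exists>\<sigma>>0. \<Delta> * \<sigma> + \<sigma> / (1 + \<sigma>) = 1 / \<alpha>"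
proof -
  let ?f = "\<lambda>\<sigma>. \<Delta> * \<sigma> + \<sigma> / (1 + \<sigma>)"
  \<comment> \<open>At the right end point the linear term alone already equals 1/\<alpha>.\<close>
  have "\<exists>\<sigma>\<ge>0. \<sigma> \<le> 1 / (\<Delta> * \<alpha>) \<and> ?f \<sigma> = 1 / \<alpha>"
    using assms by (intro IVT') (auto intro!: continuous_intros)
  then obtain \<sigma> where "0 \<le> \<sigma>" "?f \<sigma> = 1 / \<alpha>" by blast
  moreover have "\<sigma> \<noteq> 0" using calculation assms by auto
  ultimately show ?thesis by (intro exI[of _ \<sigma>]) auto
qed

theorem corollary1:
  fixes \<alpha> \<Delta> :: real
    and N :: "nat \<Rightarrow> nat"
    and M :: "nat \<Rightarrow> 'w measure"
    and x :: "nat \<Rightarrow> 'w \<Rightarrow> nat \<times> nat \<Rightarrow> real"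
    and \<beta> \<epsilon> y :: "nat \<Rightarrow> 'w \<Rightarrow> nat \<Rightarrow> real"
  assumes "\<alpha> > 0" and "\<Delta> > 0"
    and "(\<lambda>p. real (N p) / real p) \<longlonglongrightarrow> \<alpha>"
    and "\<And>p. p \<ge> 1 \<Longrightarrow> gaussian_linear_model (M p) (N p) p \<Delta> (x p) (\<beta> p) (\<epsilon> p) (y p)"
  shows "\<forall>r\<ge>0. \<forall>e>0.
    (\<lambda>p. measure (M p) {\<omega> \<in> space (M p). R_TAP \<alpha> \<Delta> (N p) p (x p \<omega>) (y p \<omega>) r > 2 * r + e})
      \<longlonglongrightarrow> 0"
proof (intro allI impI)
  fix r e :: real assume r: "0 \<le> r" and e: "0 < e"
  obtain \<sigma> where \<sigma>: "\<sigma> > 0" "\<Delta> * \<sigma> + \<sigma> / (1 + \<sigma>) = 1 / \<alpha>"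
    using fixed_point_exists[OF assms(1,2)] by blast
  \<comment> \<open>The limit of 1 - q for the overlap q of the ridge estimator. The next lines
    check that it is the stationary point required by \<open>R_TAP_le\<close>.\<close>
  define s where "s = \<Delta> * \<alpha> * \<sigma>"
  have s0: "0 < s" using assms(1,2) \<sigma>(1) by (simp add: s_def)
  have "s * \<alpha> / (\<Delta> * \<alpha> + s) = \<alpha> * (\<sigma> / (1 + \<sigma>))"
  proof -
    have "\<Delta> * \<alpha> + s = \<Delta> * \<alpha> * (1 + \<sigma>)" by (simp add: s_def algebra_simps)
    then show ?thesis using assms(1,2) by (simp add: s_def)
  qed
  then have "s + s * \<alpha> / (\<Delta> * \<alpha> + s) = \<alpha> * (\<Delta> * \<sigma> + \<sigma> / (1 + \<sigma>))"
    by (simp add: s_def distrib_left)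
  then have s1: "s + s * \<alpha> / (\<Delta> * \<alpha> + s) = 1" using \<sigma>(2) assms(1) by simp
  let ?h = "tap_potential \<alpha> \<Delta>"
  have "isCont ?h (1 - s)" using isCont_tap_potential[OF assms(1,2)] s0 by simp
  then obtain \<eta>0 where \<eta>0: "0 < \<eta>0" "\<And>q. \<bar>q - (1 - s)\<bar> < \<eta>0 \<Longrightarrow> \<bar>?h q - ?h (1 - s)\<bar> < e / 2"
    using e unfolding continuous_at_eps_delta dist_real_def by (meson half_gt_zero)
  \<comment> \<open>The bound by \<eta>0 controls h; the bound by s keeps the overlap below 1, where
    h is defined and the ridge estimator is admissible.\<close>
  define \<eta> where "\<eta> = min \<eta>0 s"
  have \<eta>: "0 < \<eta>" using \<eta>0 s0 by (simp add: \<eta>_def)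
  \<comment> \<open>The expected overlap error divided by \<eta>, as produced by Markov's
    inequality.\<close>
  define b where "b p = (2 / sqrt (real p) + 2 / (\<Delta> * sqrt (real p)) + 1 / (\<Delta> * real p)
      + \<bar>1 - (real (N p) / real p) / \<alpha>\<bar> + \<Delta> * \<sigma> * \<bar>real (N p) / real p - \<alpha>\<bar>) / \<eta>" for p
  have "b \<longlonglongrightarrow> (0 + 0 / \<Delta> + 0 / \<Delta> + \<bar>1 - \<alpha> / \<alpha>\<bar> + \<Delta> * \<sigma> * \<bar>\<alpha> - \<alpha>\<bar>) / \<eta>"
  proof -
    have sq: "(\<lambda>p. 2 / sqrt (real p)) \<longlonglongrightarrow> 0"
      by (intro tendsto_divide_0[OF tendsto_const] filterlim_at_top_imp_at_infinity
          filterlim_compose[OF sqrt_at_top] filterlim_real_sequentially)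
    have inv: "(\<lambda>p. 1 / real p) \<longlonglongrightarrow> 0" by (rule lim_1_over_n)
    have "b = (\<lambda>p. (2 / sqrt (real p) + 2 / sqrt (real p) / \<Delta> + 1 / real p / \<Delta>
      + \<bar>1 - (real (N p) / real p) / \<alpha>\<bar> + \<Delta> * \<sigma> * \<bar>real (N p) / real p - \<alpha>\<bar>) / \<eta>)"
      by (simp add: b_def fun_eq_iff mult.commute)
    then show ?thesis
      using assms \<eta> by (simp only:) (intro tendsto_intros sq inv; simp)
  qed
  then have b0: "b \<longlonglongrightarrow> 0" using assms(1) by simp
  \<comment> \<open>Positivity of \<alpha> forces at least one row for large p, as the normalized
    trace divides by the number of rows.\<close>
  have N1: "eventually (\<lambda>p. 1 \<le> N p) sequentially"
  proof -
    have "eventually (\<lambda>p. 0 < real (N p) / real p) sequentially"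
      using order_tendstoD(1)[OF assms(3,1)] .
    then show ?thesis by eventually_elim (simp add: zero_less_divide_iff)
  qed
  have bound: "measure (M p) {\<omega> \<in> space (M p). R_TAP \<alpha> \<Delta> (N p) p (x p \<omega>) (y p \<omega>) r > 2 * r + e} \<le> b p"
    if p: "1 \<le> p" and N: "1 \<le> N p" for p
  proof -
    interpret gaussian_linear_model "M p" "N p" p \<Delta> "x p" "\<beta> p" "\<epsilon> p" "y p" using assms(4)[OF p] .
    obtain V where V: "integrable (M p) V" "expectation V \<le> \<eta> * b p"
      and q: "\<And>\<omega>. \<bar>sq_overlap p (ridge \<Delta> (N p) p (x p \<omega>) (y p \<omega>)) - (1 - s)\<bar> \<le> V \<omega>"
      using ridge_overlap_error[OF assms(2,1) p N less_imp_le[OF \<sigma>(1)] \<sigma>(2)] \<eta>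
      unfolding b_def s_def by auto
    have V0: "0 \<le> V \<omega>" for \<omega> using q[of \<omega>] by linarith
    let ?D = "{\<omega> \<in> space (M p). R_TAP \<alpha> \<Delta> (N p) p (x p \<omega>) (y p \<omega>) r > 2 * r + e}"
    \<comment> \<open>Only the containing event has to be measurable; measurability of
      \<open>R_TAP\<close> is never claimed.\<close>
    have sub: "?D \<subseteq> {\<omega> \<in> space (M p). \<eta> \<le> V \<omega>}"
    proof (intro subsetI CollectI conjI)
      fix \<omega> assume \<omega>: "\<omega> \<in> ?D"
      then show "\<omega> \<in> space (M p)" by simp
      let ?q = "sq_overlap p (ridge \<Delta> (N p) p (x p \<omega>) (y p \<omega>))"
      show "\<eta> \<le> V \<omega>"
      proof (rule ccontr)
        assume "\<not> \<eta> \<le> V \<omega>"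
        then have "\<bar>?q - (1 - s)\<bar> < \<eta>" using q[of \<omega>] by linarith
        then have close: "\<bar>?q - (1 - s)\<bar> < \<eta>0" and q1: "?q < 1" by (auto simp: \<eta>_def)
        have "2 * r + e < R_TAP \<alpha> \<Delta> (N p) p (x p \<omega>) (y p \<omega>) r" using \<omega> by simp
        \<comment> \<open>The tolerance is e/2 because \<open>R_TAP_le\<close> doubles the gap in
          h.\<close>
        moreover have "?h (1 - s) - ?h ?q < e / 2" using abs_less_iff[THEN iffD1, OF \<eta>0(2)[OF close]] by simp
        ultimately show False using R_TAP_le[OF assms(1,2) p r s0 s1 q1] unfolding right_diff_distrib by linarith
      qed
    qed
    have meas: "{\<omega> \<in> space (M p). \<eta> \<le> V \<omega>} \<in> events"
      using borel_measurable_integrable[OF V(1)] by measurable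
    have "prob ?D \<le> prob {\<omega> \<in> space (M p). \<eta> \<le> V \<omega>}" by (rule finite_measure_mono[OF sub meas])
    also have "\<dots> \<le> expectation V / \<eta>"
      using integral_Markov_inequality_measure[OF V(1), of "space (M p)" \<eta>] V0 \<eta> by simp
    also have "\<dots> \<le> b p" using V(2) \<eta> by (simp add: field_simps)
    finally show ?thesis .
  qed
  show "(\<lambda>p. measure (M p) {\<omega> \<in> space (M p). R_TAP \<alpha> \<Delta> (N p) p (x p \<omega>) (y p \<omega>) r > 2 * r + e}) \<longlonglongrightarrow> 0"
  proof (rule tendsto_sandwich[OF _ _ tendsto_const b0])
    show "eventually (\<lambda>p. measure (M p) {\<omega> \<in> space (M p). R_TAP \<alpha> \<Delta> (N p) p (x p \<omega>) (y p \<omega>) r > 2 * r + e} \<le> b p) sequentially"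
      using N1 eventually_ge_at_top[of 1] by eventually_elim (rule bound)
  qed simp
qed

end
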